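(* Let $R=R(B_2,S_1,S_2)$ be a reduced extended affine root system of type $X=B_2$, nullity $\nu$ and twist number $t$. Then $R$ is a minimal extended affine root system if one of the following conditions holds: (a) $\mathrm{ind}(S_1)-t\le3$ and $\mathrm{ind}(S_2)-(\nu-t)\le3$; (b) $t\le3$, $\nu-t\le3$, $\mathrm{ind}(S_1)\ne7$ and $\mathrm{ind}(S_2)\neq7$. In particular, if $\nu-t\le3$ and $t\le3$, then $R$ is minimal if and only if $\mathrm{ind}(S_1)\ne7$ and $\mathrm{ind}(S_2)\ne7$.
   Context: A semilattice in a finite-dimensional real vector space $U$ is a discrete spanning subset $S\subseteq U$ with $0\in S$ and $S=S\pm2S$; $\langle S\rangle$ is its $\mathbb Z$-span. If $\sigma_1,\dots,\sigma_n\in S$ form a $\mathbb Z$-basis of $\langle S\rangle$ (such elements exist), $\mathrm{supp}(S)=\{J\subseteq\{1,\dots,n\}:\sum_{r\in J}\sigma_r\in S\}$ and $\mathrm{ind}(S)=|\mathrm{supp}(S)|-1$ (equivalently, $\mathrm{ind}(S)+1$ is the number of cosets of $2\langle S\rangle$ contained in $S$). A reduced extended affine root system of type $B_2$, nullity $\nu$ and twist number $t$ is described as follows: $\mathcal V=\dot{\mathcal V}\oplus\mathcal V^0$ is a real vector space with a positive semidefinite symmetric bilinear form with radical $\mathcal V^0=\mathcal V_1^0\oplus\mathcal V_2^0$, $\dim\mathcal V^0_1=t$, $\dim\mathcal V^0_2=\nu-t$; $\dot R=\{0\}\cup\dot R_{sh}\cup\dot R_{lg}$ is a finite root system of type $B_2$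 spanning $\dot{\mathcal V}$ (short and long roots); $S_i$ is a semilattice in $\mathcal V_i^0$; with $S=S_1\oplus\langle S_2\rangle$, $R=R(B_2,S_1,S_2)=(S+S)\cup(\dot R_{sh}+S_1\oplus\langle S_2\rangle)\cup(\dot R_{lg}+2\langle S_1\rangle\oplus S_2)$. $R^\times=\{\alpha\in R:(\alpha,\alpha)\neq0\}$, $\alpha^\vee=2\alpha/(\alpha,\alpha)$. Let $\tilde{\mathcal V}=\mathcal V\oplus(\mathcal V^0)^*$ with the form extended by $(\dot\beta_1+\delta_1+\lambda_1,\dot\beta_2+\delta_2+\lambda_2)=(\dot\beta_1,\dot\beta_2)+\lambda_1(\delta_2)+\lambda_2(\delta_1)$ for $\dot\beta_i\in\dot{\mathcal V}$, $\delta_i\in\mathcal V^0$, $\lambda_i\in(\mathcal V^0)^*$. The Weyl group $\mathcal W$ is the subgroup of $GL(\tilde{\mathcal V})$ generated by $w_\alpha(u)=u-(u,\alpha^\vee)\alpha$, $\alpha\in R^\times$. $R$ is minimal if there is no $\alpha\in R^\times$ such that the reflections $w_\beta$, $\beta\in R^\times\setminus\mathcal W\alpha$, generate $\mathcal W$. *)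

theory Defs
  imports
    "HOL-Analysis.Analysis"
    "HOL-Algebra.Bij"
    "HOL-Algebra.Generated_Groups"
    "HOL-Computational_Algebra.Group_Closure"
    "HOL-Library.Set_Algebras"
begin

section \<open>Semilattices\<close>

definition semilattice_in :: "'v::euclidean_space set \<Rightarrow> 'v set \<Rightarrow> bool" where
  "semilattice_in U S \<longleftrightarrow>
     S \<subseteq> U \<and> discrete S \<and> span S = U \<and> 0 \<in> S \<and>
     S = {x + 2 *\<^sub>R y | x y. x \<in> S \<and> y \<in> S} \<union> {x - 2 *\<^sub>R y | x y. x \<in> S \<and> y \<in> S}"

definition int_basis_from :: "'v::euclidean_space set \<Rightarrow> nat \<Rightarrow> (nat \<Rightarrow> 'v) \<Rightarrow> bool" where
  "int_basis_from S n \<sigma> \<longleftrightarrow>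
     \<sigma> ` {1..n} \<subseteq> S \<and>
     group_closure S = {\<Sum>r\<in>{1..n}. of_int (c r) *\<^sub>R \<sigma> r | c. True} \<and>
     (\<forall>c :: nat \<Rightarrow> int. (\<Sum>r\<in>{1..n}. of_int (c r) *\<^sub>R \<sigma> r) = 0 \<longrightarrow> (\<forall>r\<in>{1..n}. c r = 0))"

definition supp :: "'v::euclidean_space set \<Rightarrow> nat \<Rightarrow> (nat \<Rightarrow> 'v) \<Rightarrow> nat set set" where
  "supp S n \<sigma> = {J. J \<subseteq> {1..n} \<and> (\<Sum>r\<in>J. \<sigma> r) \<in> S}"

text \<open>For a semilattice a basis as below exists and the cardinality of the support does not depend
  on it, being the number of cosets of twice the lattice contained in \<open>S\<close>. So the choice is
  immaterial, and no truncation occurs since the empty set belongs to every support.\<close>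

definition ind :: "'v::euclidean_space set \<Rightarrow> nat" where
  "ind S = (SOME k. \<exists>n \<sigma>. int_basis_from S n \<sigma> \<and> k = card (supp S n \<sigma>) - 1)"

section \<open>Root systems\<close>

definition direct_sum :: "'v::euclidean_space set \<Rightarrow> 'v set \<Rightarrow> 'v set \<Rightarrow> bool" where
  "direct_sum U A B \<longleftrightarrow> subspace A \<and> subspace B \<and> A \<inter> B = {0} \<and> U = A + B"

text \<open>The usual coordinates for type \<open>B\<^sub>2\<close>, the scale of the form being left free.\<close>

definition finite_root_system_B2 ::
  "('v::euclidean_space \<Rightarrow> 'v \<Rightarrow> real) \<Rightarrow> 'v set \<Rightarrow> 'v set \<Rightarrow> 'v set \<Rightarrow> bool" where
  "finite_root_system_B2 B Vd Rsh Rlg \<longleftrightarrow>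
     span (Rsh \<union> Rlg) = Vd \<and>
     (\<exists>\<epsilon>1 \<epsilon>2. B \<epsilon>1 \<epsilon>1 > 0 \<and> B \<epsilon>2 \<epsilon>2 = B \<epsilon>1 \<epsilon>1 \<and> B \<epsilon>1 \<epsilon>2 = 0 \<and>
        Rsh = {\<epsilon>1, - \<epsilon>1, \<epsilon>2, - \<epsilon>2} \<and>
        Rlg = {\<epsilon>1 + \<epsilon>2, \<epsilon>1 - \<epsilon>2, - \<epsilon>1 + \<epsilon>2, - \<epsilon>1 - \<epsilon>2})"

definition ears_B2 :: "'v::euclidean_space set \<Rightarrow> 'v set \<Rightarrow> 'v set \<Rightarrow> 'v set \<Rightarrow> 'v set" where
  "ears_B2 Rsh Rlg S1 S2 =
     (let S = S1 + group_closure S2 in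
        (S + S)
        \<union> (Rsh + (S1 + group_closure S2))
        \<union> (Rlg + ((\<lambda>x. 2 *\<^sub>R x) ` group_closure S1 + S2)))"

definition nonisotropic :: "('v::euclidean_space \<Rightarrow> 'v \<Rightarrow> real) \<Rightarrow> 'v set \<Rightarrow> 'v set" where
  "nonisotropic B R = {\<alpha> \<in> R. B \<alpha> \<alpha> \<noteq> 0}"

section \<open>The extended space and the Weyl group\<close>

text \<open>The whole type \<open>'v\<close> is the direct sum of \<open>Vd\<close> and the radical \<open>V\<^sup>0\<close> of the form. The dual of
  \<open>V\<^sup>0\<close> is realised by the functionals on \<open>'v\<close> that vanish on \<open>Vd\<close> (restriction to \<open>V\<^sup>0\<close> being an
  isomorphism); such a functional sees only the \<open>V\<^sup>0\<close>-component of its argument. All linear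
  functionals are bounded, the dimension being finite.\<close>

definition ext_space :: "'v::euclidean_space set \<Rightarrow> ('v \<times> ('v \<Rightarrow>\<^sub>L real)) set" where
  "ext_space Vd = UNIV \<times> {l. \<forall>x\<in>Vd. blinfun_apply l x = 0}"

definition ext_form ::
  "('v::euclidean_space \<Rightarrow> 'v \<Rightarrow> real) \<Rightarrow> 'v \<times> ('v \<Rightarrow>\<^sub>L real) \<Rightarrow> 'v \<times> ('v \<Rightarrow>\<^sub>L real) \<Rightarrow> real" where
  "ext_form B u u' =
     B (fst u) (fst u') + blinfun_apply (snd u) (fst u') + blinfun_apply (snd u') (fst u)"

definition GL_on :: "'a::real_vector set \<Rightarrow> ('a \<Rightarrow> 'a) monoid" where
  "GL_on X = (BijGroup X)\<lparr>carrier :=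
     {f \<in> Bij X. (\<forall>x\<in>X. \<forall>y\<in>X. f (x + y) = f x + f y) \<and> (\<forall>a. \<forall>x\<in>X. f (a *\<^sub>R x) = a *\<^sub>R f x)}\<rparr>"

definition coroot :: "('v::euclidean_space \<Rightarrow> 'v \<Rightarrow> real) \<Rightarrow> 'v \<Rightarrow> 'v" where
  "coroot B \<alpha> = (2 / B \<alpha> \<alpha>) *\<^sub>R \<alpha>"

definition reflection ::
  "('v::euclidean_space \<Rightarrow> 'v \<Rightarrow> real) \<Rightarrow> 'v set \<Rightarrow> 'v
     \<Rightarrow> ('v \<times> ('v \<Rightarrow>\<^sub>L real) \<Rightarrow> 'v \<times> ('v \<Rightarrow>\<^sub>L real))" where
  "reflection B Vd \<alpha> = (\<lambda>u\<in>ext_space Vd. u - ext_form B u (coroot B \<alpha>, 0) *\<^sub>R (\<alpha>, 0))"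

definition refl_group ::
  "('v::euclidean_space \<Rightarrow> 'v \<Rightarrow> real) \<Rightarrow> 'v set \<Rightarrow> 'v set
     \<Rightarrow> ('v \<times> ('v \<Rightarrow>\<^sub>L real) \<Rightarrow> 'v \<times> ('v \<Rightarrow>\<^sub>L real)) set" where
  "refl_group B Vd A = generate (GL_on (ext_space Vd)) (reflection B Vd ` A)"

definition weyl_group ::
  "('v::euclidean_space \<Rightarrow> 'v \<Rightarrow> real) \<Rightarrow> 'v set \<Rightarrow> 'v set
     \<Rightarrow> ('v \<times> ('v \<Rightarrow>\<^sub>L real) \<Rightarrow> 'v \<times> ('v \<Rightarrow>\<^sub>L real)) set" where
  "weyl_group B Vd R = refl_group B Vd (nonisotropic B R)"

definition weyl_orbit ::
  "('v::euclidean_space \<Rightarrow> 'v \<Rightarrow> real) \<Rightarrow> 'v set \<Rightarrow> 'v set \<Rightarrow> 'v \<Rightarrow> 'v set" where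
  "weyl_orbit B Vd R \<alpha> = {\<beta>. \<exists>w\<in>weyl_group B Vd R. w (\<alpha>, 0) = (\<beta>, 0)}"

definition minimal_ears ::
  "('v::euclidean_space \<Rightarrow> 'v \<Rightarrow> real) \<Rightarrow> 'v set \<Rightarrow> 'v set \<Rightarrow> bool" where
  "minimal_ears B Vd R \<longleftrightarrow>
     \<not> (\<exists>\<alpha>\<in>nonisotropic B R.
          refl_group B Vd (nonisotropic B R - weyl_orbit B Vd R \<alpha>) = weyl_group B Vd R)"

end

theory Submission
  imports Defs
begin

text \<open>
  Write \<open>\<Lambda>\<close> for the lattice generated by \<open>S1\<close> and \<open>c\<close> for the square length of the short roots. The
  orbit of a short root under the Weyl group consists of all short roots whose \<open>S1\<close>-component lies in
  one coset of \<open>2\<Lambda>\<close>, so the question is which cosets can be omitted from \<open>S1\<close> without losing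
  reflections.

  An obstruction comes from characters of the Weyl group with values in the field with two elements.
  Call a vector of the extended space admissible if it pairs integrally with the short roots and
  evenly with the long ones. For admissible \<open>u\<close> and \<open>u'\<close> the number \<open>c / 2 * ((w u, u') - (u, u'))\<close>
  is an integer whose parity is additive in \<open>w\<close>; a reflection in a short root \<open>\<beta>\<close> contributes
  \<open>(u, \<beta>) (u', \<beta>)\<close>, and long reflections contribute nothing (\<open>quadratic_character_even\<close>). Admissible
  vectors realise all affine functions on \<open>\<Lambda> / 2\<Lambda>\<close>, hence all polynomials of degree at most two on
  \<open>\<Lambda> / 2\<Lambda>\<close> yield characters. If the indicator function of a coset agrees on \<open>S1\<close> with such a
  polynomial, then the reflections outside the orbit of that coset lie in the kernel of a character
  that does not vanish on the reflections in the orbit, and the orbit cannot be omitted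
  (\<open>short_not_removable\<close>). In a basis taken from \<open>S1\<close>, the cosets in \<open>S1\<close> form a family of subsets of
  \<open>{1..n}\<close> containing the empty set and the singletons. If at most three further sets occur, then
  every function on the family is a polynomial of degree at most two: affine functions take care of
  the small sets, and the edge sets of complete graphs on three different vertex sets are linearly
  independent modulo two, if these have at least two elements each (\<open>quadratic_interpolation\<close>). This settles condition (a), and condition (b)
  implies (a) because \<open>ind S1 + 1\<close> is at most \<open>2 ^ t\<close> and different from 8.

  In the remaining case of rank three, where \<open>S1\<close> is all of \<open>\<Lambda>\<close>, the indicator function of a point
  has degree three. Here the reflections at the eight corners of a cube of short roots satisfy a
  relation in which each of them occurs once (\<open>cube_relation\<close>), so one corner is redundant
  (\<open>short_removable\<close>).

  Long roots need no separate treatment: up to a similarity and up to doubling the short roots, a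
  root system of type \<open>B2\<close> is its own dual, with the roles of \<open>S1\<close> and \<open>S2\<close> exchanged
  (\<open>dual_b2_roots\<close>).
\<close>

section \<open>Reflection groups as sets of words\<close>

text \<open>
  The reflection without the restriction to the extended space: a linear map of the whole ambient
  space, so that words of reflections compose without domain conditions.
\<close>

definition refl_map ::
  "('v::euclidean_space \<Rightarrow> 'v \<Rightarrow> real) \<Rightarrow> 'v \<Rightarrow> 'v \<times> ('v \<Rightarrow>\<^sub>L real) \<Rightarrow> 'v \<times> ('v \<Rightarrow>\<^sub>L real)" where
  "refl_map B \<beta> u = u - ext_form B u (coroot B \<beta>, 0) *\<^sub>R (\<beta>, 0)"

definition refl_word ::
  "('v::euclidean_space \<Rightarrow> 'v \<Rightarrow> real) \<Rightarrow> 'v list \<Rightarrow> 'v \<times> ('v \<Rightarrow>\<^sub>L real) \<Rightarrow> 'v \<times> ('v \<Rightarrow>\<^sub>L real)" where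
  "refl_word B \<beta>s = foldr (\<lambda>\<beta> f. refl_map B \<beta> \<circ> f) \<beta>s id"

lemma refl_word_simps [simp]:
  "refl_word B [] u = u"
  "refl_word B (\<beta> # \<beta>s) u = refl_map B \<beta> (refl_word B \<beta>s u)"
  by (simp_all add: refl_word_def)

lemma refl_word_append [simp]:
  "refl_word B (\<beta>s @ \<gamma>s) u = refl_word B \<beta>s (refl_word B \<gamma>s u)"
  by (induction \<beta>s) auto

definition refl_orbit ::
  "('v::euclidean_space \<Rightarrow> 'v \<Rightarrow> real) \<Rightarrow> 'v set \<Rightarrow> 'v set \<Rightarrow> 'v \<Rightarrow> 'v set" where
  "refl_orbit B Vd Q \<alpha> = {\<beta>. \<exists>w\<in>refl_group B Vd Q. w (\<alpha>, 0) = (\<beta>, 0)}"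

text \<open>
  Stated for an arbitrary set \<open>Q\<close> of non-isotropic vectors rather than for a root system, because the
  passage to the dual root system doubles some of the roots.
\<close>

definition removable ::
  "('v::euclidean_space \<Rightarrow> 'v \<Rightarrow> real) \<Rightarrow> 'v set \<Rightarrow> 'v set \<Rightarrow> 'v \<Rightarrow> bool" where
  "removable B Vd Q \<alpha> \<longleftrightarrow>
     refl_group B Vd (Q - refl_orbit B Vd Q \<alpha>) = refl_group B Vd Q"

lemma minimal_ears_iff_no_removable:
  "minimal_ears B Vd R \<longleftrightarrow> \<not> (\<exists>\<alpha>\<in>nonisotropic B R. removable B Vd (nonisotropic B R) \<alpha>)"
  by (simp add: minimal_ears_def removable_def refl_orbit_def weyl_orbit_def weyl_group_def)

lemma mem_ext_space_iff: "u \<in> ext_space Vd \<longleftrightarrow> (\<forall>x\<in>Vd. blinfun_apply (snd u) x = 0)"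
  by (cases u) (simp add: ext_space_def)

lemma zero_mem_ext_space [simp]: "(v, 0) \<in> ext_space Vd"
  by (simp add: ext_space_def)

locale symmetric_form =
  fixes B :: "'v::euclidean_space \<Rightarrow> 'v \<Rightarrow> real"
  assumes bilinear: "bilinear B" and sym: "B x y = B y x"
begin

lemmas form_simps =
  bilinear_ladd[OF bilinear] bilinear_radd[OF bilinear]
  bilinear_lmul[OF bilinear] bilinear_rmul[OF bilinear]
  bilinear_lneg[OF bilinear] bilinear_rneg[OF bilinear]
  bilinear_lzero[OF bilinear] bilinear_rzero[OF bilinear]
  bilinear_lsub[OF bilinear] bilinear_rsub[OF bilinear]

lemma ext_form_sym: "ext_form B u v = ext_form B v u"
  by (simp add: ext_form_def sym)

lemma ext_form_simps:
  "ext_form B (u + u') v = ext_form B u v + ext_form B u' v"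
  "ext_form B (u - u') v = ext_form B u v - ext_form B u' v"
  "ext_form B (a *\<^sub>R u) v = a * ext_form B u v"
  "ext_form B v (u + u') = ext_form B v u + ext_form B v u'"
  "ext_form B v (u - u') = ext_form B v u - ext_form B v u'"
  "ext_form B v (a *\<^sub>R u) = a * ext_form B v u"
  by (simp_all add: ext_form_def form_simps blinfun.add_left blinfun.add_right blinfun.diff_left
      blinfun.diff_right blinfun.scaleR_left blinfun.scaleR_right algebra_simps)

lemma ext_form_root [simp]: "ext_form B (v, 0) (\<beta>, 0) = B v \<beta>"
  by (simp add: ext_form_def)

lemma refl_map_eq: "refl_map B \<beta> u = u - (2 / B \<beta> \<beta> * ext_form B u (\<beta>, 0)) *\<^sub>R (\<beta>, 0)"
proof -
  have "(coroot B \<beta>, 0) = (2 / B \<beta> \<beta>) *\<^sub>R (\<beta>, 0)"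
    by (simp add: coroot_def)
  then show ?thesis
    unfolding refl_map_def by (metis (no_types, lifting) ext_form_simps(6) mult.commute)
qed

lemma ext_form_refl_map:
  "ext_form B (refl_map B \<beta> u) v
     = ext_form B u v - 2 / B \<beta> \<beta> * ext_form B u (\<beta>, 0) * ext_form B v (\<beta>, 0)"
  unfolding refl_map_eq by (simp add: ext_form_simps ext_form_sym[of v] del: scaleR_Pair)

lemma refl_map_Pair:
  "refl_map B \<beta> (v, l) = (v - (2 / B \<beta> \<beta> * (B v \<beta> + blinfun_apply l \<beta>)) *\<^sub>R \<beta>, l)"
  by (simp add: refl_map_eq ext_form_def)

lemma refl_map_involution:
  assumes "B \<beta> \<beta> \<noteq> 0"
  shows "refl_map B \<beta> (refl_map B \<beta> u) = u"
proof (cases u)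
  case (Pair v l)
  let ?m = "2 / B \<beta> \<beta> * (B v \<beta> + blinfun_apply l \<beta>)"
  have "2 / B \<beta> \<beta> * (B (v - ?m *\<^sub>R \<beta>) \<beta> + blinfun_apply l \<beta>) = - ?m"
    using assms by (simp add: form_simps field_simps)
  then show ?thesis
    by (simp only: Pair refl_map_Pair) simp
qed

lemma refl_map_add: "refl_map B \<beta> (u + v) = refl_map B \<beta> u + refl_map B \<beta> v"
  by (simp add: refl_map_eq ext_form_simps distrib_left scaleR_left_distrib del: scaleR_Pair)

lemma refl_map_scaleR: "refl_map B \<beta> (a *\<^sub>R u) = a *\<^sub>R refl_map B \<beta> u"
  by (simp add: refl_map_eq ext_form_simps scaleR_right_diff_distrib mult.left_commute del: scaleR_Pair)

lemma refl_map_scaled_root: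
  assumes "a \<noteq> 0"
  shows "refl_map B (a *\<^sub>R \<beta>) = refl_map B \<beta>"
proof
  fix u show "refl_map B (a *\<^sub>R \<beta>) u = refl_map B \<beta> u"
    using assms
    by (cases u) (simp add: refl_map_Pair form_simps blinfun.scaleR_right divide_simps distrib_left)
qed

lemma snd_refl_word [simp]: "snd (refl_word B \<beta>s u) = snd u"
  by (induction \<beta>s) (simp_all add: refl_map_eq)

lemma refl_word_mem_ext_space:
  "u \<in> ext_space Vd \<Longrightarrow> refl_word B \<beta>s u \<in> ext_space Vd"
  by (simp add: mem_ext_space_iff)

lemma ext_space_subspace:
  "u \<in> ext_space Vd \<Longrightarrow> v \<in> ext_space Vd \<Longrightarrow> u + v \<in> ext_space Vd"
  "u \<in> ext_space Vd \<Longrightarrow> a *\<^sub>R u \<in> ext_space Vd"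
  by (auto simp: ext_space_def blinfun.add_left blinfun.scaleR_left)

lemma refl_word_rev:
  assumes "\<forall>\<beta>\<in>set \<beta>s. B \<beta> \<beta> \<noteq> 0"
  shows "refl_word B (rev \<beta>s) (refl_word B \<beta>s u) = u"
  using assms by (induction \<beta>s arbitrary: u) (simp_all add: refl_map_involution)

lemma refl_word_Bij:
  assumes "\<forall>\<beta>\<in>set \<beta>s. B \<beta> \<beta> \<noteq> 0"
  shows "restrict (refl_word B \<beta>s) (ext_space Vd) \<in> Bij (ext_space Vd)"
proof -
  have "bij_betw (refl_word B \<beta>s) (ext_space Vd) (ext_space Vd)"
    using refl_word_rev[of \<beta>s] refl_word_rev[of "rev \<beta>s"] assms
    by (intro bij_betwI[where g = "refl_word B (rev \<beta>s)"]) (auto intro: refl_word_mem_ext_space)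
  then show ?thesis
    by (simp add: Bij_def)
qed

lemma refl_word_linear:
  "refl_word B \<beta>s (u + v) = refl_word B \<beta>s u + refl_word B \<beta>s v"
  "refl_word B \<beta>s (a *\<^sub>R u) = a *\<^sub>R refl_word B \<beta>s u"
  by (induction \<beta>s) (simp_all add: refl_map_add refl_map_scaleR)

lemma refl_word_compose:
  "compose (ext_space Vd) (restrict (refl_word B \<beta>s) (ext_space Vd))
      (restrict (refl_word B \<gamma>s) (ext_space Vd))
   = restrict (refl_word B (\<beta>s @ \<gamma>s)) (ext_space Vd)"
  by (rule ext) (simp add: compose_def refl_word_mem_ext_space)

lemma reflection_eq_restrict: "reflection B Vd \<beta> = restrict (refl_word B [\<beta>]) (ext_space Vd)"
  by (rule ext) (simp add: reflection_def refl_map_def)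

text \<open>
  The inverse in the group is given by a definite description over its carrier. Associativity of
  composition shows directly that an involution is the only candidate.
\<close>

lemma inv_reflection:
  assumes "B \<beta> \<beta> \<noteq> 0"
  shows "inv\<^bsub>GL_on (ext_space Vd)\<^esub> (reflection B Vd \<beta>) = reflection B Vd \<beta>"
proof -
  let ?X = "ext_space Vd" and ?r = "reflection B Vd \<beta>"
  have rB: "?r \<in> Bij ?X"
    unfolding reflection_eq_restrict using assms by (intro refl_word_Bij) simp
  have rr: "compose ?X ?r ?r = (\<lambda>x\<in>?X. x)"
    unfolding reflection_eq_restrict refl_word_compose
    by (rule ext) (simp add: refl_map_involution assms)
  have rC: "?r \<in> carrier (GL_on ?X)"
    using rB refl_word_linear[of "[\<beta>]"] ext_space_subspace[where Vd = Vd]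
    by (simp add: GL_on_def reflection_eq_restrict)
  \<comment> \<open>a right inverse of an involution coincides with it\<close>
  have uniq: "y = ?r" if "y \<in> Bij ?X" "compose ?X ?r y = (\<lambda>x\<in>?X. x)" for y
  proof -
    have "y = compose ?X (compose ?X ?r ?r) y"
      unfolding rr using that by (metis Id_compose Bij_imp_extensional Bij_imp_funcset)
    also have "\<dots> = compose ?X ?r (compose ?X ?r y)"
      by (rule compose_assoc[OF Bij_imp_funcset[OF that(1)], symmetric])
    also have "\<dots> = ?r"
      unfolding that(2) using rB by (metis compose_Id Bij_imp_extensional Bij_imp_funcset)
    finally show ?thesis .
  qed
  show ?thesis
    unfolding m_inv_def
  proof (rule the_equality)
    show "?r \<in> carrier (GL_on ?X) \<and> ?r \<otimes>\<^bsub>GL_on ?X\<^esub> ?r = \<one>\<^bsub>GL_on ?X\<^esub>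
      \<and> ?r \<otimes>\<^bsub>GL_on ?X\<^esub> ?r = \<one>\<^bsub>GL_on ?X\<^esub>"
      using rC rB rr by (simp add: GL_on_def BijGroup_def)
    fix y assume "y \<in> carrier (GL_on ?X) \<and> ?r \<otimes>\<^bsub>GL_on ?X\<^esub> y = \<one>\<^bsub>GL_on ?X\<^esub>
      \<and> y \<otimes>\<^bsub>GL_on ?X\<^esub> ?r = \<one>\<^bsub>GL_on ?X\<^esub>"
    then show "y = ?r"
      using rB by (intro uniq) (auto simp: GL_on_def BijGroup_def)
  qed
qed

text \<open>
  Since every generator is its own inverse, the generated group consists of the words in the
  generators. All later arguments about the Weyl group are inductions over such words.
\<close>

lemma refl_group_eq_words:
  assumes A: "\<forall>\<beta>\<in>A. B \<beta> \<beta> \<noteq> 0"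
  shows "refl_group B Vd A = {restrict (refl_word B \<beta>s) (ext_space Vd) |\<beta>s. set \<beta>s \<subseteq> A}"
    (is "_ = ?W")
proof
  let ?X = "ext_space Vd"
  show "refl_group B Vd A \<subseteq> ?W"
    unfolding refl_group_def
  proof
    fix w assume "w \<in> generate (GL_on ?X) (reflection B Vd ` A)"
    then show "w \<in> ?W"
    proof induction
      case one
      have "\<one>\<^bsub>GL_on ?X\<^esub> = restrict (refl_word B []) ?X"
        by (rule ext) (simp add: GL_on_def BijGroup_def)
      then show ?case
        by (metis (mono_tags, lifting) empty_set empty_subsetI mem_Collect_eq)
    next
      case (incl h)
      then obtain \<beta> where "\<beta> \<in> A" "h = restrict (refl_word B [\<beta>]) ?X"
        by (auto simp only: reflection_eq_restrict)
      then show ?case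
        by (intro CollectI exI[of _ "[\<beta>]"]) auto
    next
      case (inv h)
      then obtain \<beta> where "\<beta> \<in> A" "h = reflection B Vd \<beta>"
        by blast
      then have "inv\<^bsub>GL_on ?X\<^esub> h = restrict (refl_word B [\<beta>]) ?X"
        using A inv_reflection[of \<beta> Vd] by (metis reflection_eq_restrict)
      then show ?case
        using \<open>\<beta> \<in> A\<close> by (intro CollectI exI[of _ "[\<beta>]"]) auto
    next
      case (eng g h)
      then obtain \<beta>s \<gamma>s where *: "set \<beta>s \<subseteq> A" "set \<gamma>s \<subseteq> A"
        "g = restrict (refl_word B \<beta>s) ?X" "h = restrict (refl_word B \<gamma>s) ?X"
        by blast
      have "g \<in> Bij ?X" "h \<in> Bij ?X"
        unfolding * by (rule refl_word_Bij; use A * in blast)+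
      then have "g \<otimes>\<^bsub>GL_on ?X\<^esub> h = restrict (refl_word B (\<beta>s @ \<gamma>s)) ?X"
        using refl_word_compose[of Vd \<beta>s \<gamma>s] by (simp add: GL_on_def BijGroup_def *)
      then show ?case
        using * by (intro CollectI exI[of _ "\<beta>s @ \<gamma>s"]) auto
    qed
  qed
  have "restrict (refl_word B \<beta>s) ?X \<in> refl_group B Vd A" if "set \<beta>s \<subseteq> A" for \<beta>s
    using that
  proof (induction \<beta>s)
    case Nil
    have "\<one>\<^bsub>GL_on ?X\<^esub> = restrict (refl_word B []) ?X"
      by (rule ext) (simp add: GL_on_def BijGroup_def)
    then show ?case
      unfolding refl_group_def by (metis generate.one)
  next
    case (Cons \<beta> \<beta>s)
    have "restrict (refl_word B [\<beta>]) ?X \<in> Bij ?X" "restrict (refl_word B \<beta>s) ?X \<in> Bij ?X"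
      by (rule refl_word_Bij; use A Cons.prems in auto)+
    then have "restrict (refl_word B (\<beta> # \<beta>s)) ?X
        = reflection B Vd \<beta> \<otimes>\<^bsub>GL_on ?X\<^esub> restrict (refl_word B \<beta>s) ?X"
      using refl_word_compose[of Vd "[\<beta>]" \<beta>s]
      by (simp add: GL_on_def BijGroup_def reflection_eq_restrict)
    then show ?case
      using Cons unfolding refl_group_def
      by (metis generate.eng generate.incl image_eqI list.set_intros(1) set_subset_Cons subset_code(1))
  qed
  then show "?W \<subseteq> refl_group B Vd A"
    by blast
qed

lemma refl_orbit_iff:
  assumes "\<forall>\<beta>\<in>Q. B \<beta> \<beta> \<noteq> 0"
  shows "\<beta> \<in> refl_orbit B Vd Q \<alpha> \<longleftrightarrow> (\<exists>\<beta>s. set \<beta>s \<subseteq> Q \<and> refl_word B \<beta>s (\<alpha>, 0) = (\<beta>, 0))"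
  unfolding refl_orbit_def refl_group_eq_words[OF assms] by fastforce

lemma removable_imp_word:
  assumes Q: "\<forall>\<beta>\<in>Q. B \<beta> \<beta> \<noteq> 0" and "removable B Vd Q \<alpha>" "\<alpha> \<in> Q"
  obtains \<beta>s where "set \<beta>s \<subseteq> Q - refl_orbit B Vd Q \<alpha>"
    "\<And>u. u \<in> ext_space Vd \<Longrightarrow> refl_word B \<beta>s u = refl_map B \<alpha> u"
proof -
  have "restrict (refl_word B [\<alpha>]) (ext_space Vd) \<in> refl_group B Vd Q"
    unfolding refl_group_eq_words[OF Q]
    using \<open>\<alpha> \<in> Q\<close> by (intro CollectI exI[of _ "[\<alpha>]"]) auto
  also have "\<dots> = refl_group B Vd (Q - refl_orbit B Vd Q \<alpha>)"
    using assms(2) by (simp add: removable_def)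
  also have "\<dots> = {restrict (refl_word B \<beta>s) (ext_space Vd) |\<beta>s.
      set \<beta>s \<subseteq> Q - refl_orbit B Vd Q \<alpha>}"
    by (rule refl_group_eq_words) (use Q in blast)
  finally obtain \<beta>s where *: "set \<beta>s \<subseteq> Q - refl_orbit B Vd Q \<alpha>"
    "restrict (refl_word B [\<alpha>]) (ext_space Vd) = restrict (refl_word B \<beta>s) (ext_space Vd)"
    by blast
  have "refl_word B \<beta>s u = refl_map B \<alpha> u" if "u \<in> ext_space Vd" for u
    using fun_cong[OF *(2), of u] that by simp
  then show thesis
    using that *(1) by blast
qed

text \<open>
  It suffices to express the reflections in omitted roots, since words can be substituted into words.
\<close>

lemma removableI_words:
  assumes Q: "\<forall>\<beta>\<in>Q. B \<beta> \<beta> \<noteq> 0"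
    and w: "\<And>\<beta>. \<beta> \<in> refl_orbit B Vd Q \<alpha> \<Longrightarrow> \<beta> \<in> Q \<Longrightarrow>
      \<exists>\<beta>s. set \<beta>s \<subseteq> Q - refl_orbit B Vd Q \<alpha> \<and> refl_word B \<beta>s = refl_map B \<beta>"
  shows "removable B Vd Q \<alpha>"
proof -
  let ?P = "Q - refl_orbit B Vd Q \<alpha>"
  have P: "\<forall>\<beta>\<in>?P. B \<beta> \<beta> \<noteq> 0"
    using Q by blast
  have "\<exists>\<gamma>s. set \<gamma>s \<subseteq> ?P \<and> refl_word B \<gamma>s = refl_word B \<beta>s" if "set \<beta>s \<subseteq> Q" for \<beta>s
    using that
  proof (induction \<beta>s)
    case Nil
    then show ?case by (intro exI[of _ "[]"]) simp
  next
    case (Cons \<beta> \<beta>s)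
    then obtain \<gamma>s where \<gamma>s: "set \<gamma>s \<subseteq> ?P" "refl_word B \<gamma>s = refl_word B \<beta>s"
      by auto
    obtain \<delta>s where \<delta>s: "set \<delta>s \<subseteq> ?P" "refl_word B \<delta>s = refl_map B \<beta>"
    proof (cases "\<beta> \<in> refl_orbit B Vd Q \<alpha>")
      case True
      then show thesis using w[of \<beta>] Cons.prems that by auto
    next
      case False
      show thesis
        by (rule that[of "[\<beta>]"]) (use False Cons.prems in auto)
    qed
    show ?case
      by (intro exI[of _ "\<delta>s @ \<gamma>s"] conjI ext) (use \<gamma>s \<delta>s in auto)
  qed
  then have "(\<exists>\<beta>s. w = restrict (refl_word B \<beta>s) (ext_space Vd) \<and> set \<beta>s \<subseteq> ?P)
      \<longleftrightarrow> (\<exists>\<beta>s. w = restrict (refl_word B \<beta>s) (ext_space Vd) \<and> set \<beta>s \<subseteq> Q)" for w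
    by (metis Diff_subset subset_trans)
  then show ?thesis
    unfolding removable_def refl_group_eq_words[OF P] refl_group_eq_words[OF Q] by simp
qed

end

context symmetric_form
begin

lemma refl_map_isotropic_shift:
  assumes "\<And>v. B v x = 0" "t = B v \<alpha> + blinfun_apply l \<alpha> + blinfun_apply l x"
  shows "refl_map B (\<alpha> + x) (v, l) = (v - (2 / B \<alpha> \<alpha> * t) *\<^sub>R (\<alpha> + x), l)"
proof -
  have "B x v = 0" for v using assms(1) by (simp add: sym)
  then show ?thesis
    using assms by (simp add: refl_map_Pair form_simps blinfun.add_right)
qed

text \<open>
  The products \<open>T x = w (\<alpha> + x) w \<alpha>\<close> for isotropic \<open>x\<close> satisfy \<open>T x T y = T (x + y)\<close> up to a central
  factor that is bilinear and alternating in \<open>x\<close> and \<open>y\<close>, and a product of an odd number of reflections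
  \<open>w (\<alpha> + x)\<close> is a product of the \<open>T x\<close> with alternating exponents, times \<open>w \<alpha>\<close>. The inclusion-exclusion
  identity \<open>a + b + d = (a + b) - a + (a + d) - b + (b + d) - d\<close> gives the correct translation part, and in
  this order of the terms the central factors cancel.
\<close>

lemma cube_relation:
  assumes \<alpha>: "B \<alpha> \<alpha> \<noteq> 0" and rad: "\<And>v. B v a = 0" "\<And>v. B v b = 0" "\<And>v. B v d = 0"
  shows "refl_word B [\<alpha> + (a + b), \<alpha> + a, \<alpha> + (a + d), \<alpha> + b, \<alpha> + (b + d), \<alpha> + d, \<alpha> + 0]
    = refl_map B (\<alpha> + (a + b + d))"
proof
  fix u :: "'v \<times> ('v \<Rightarrow>\<^sub>L real)"
  obtain v l where u: "u = (v, l)" by (cases u)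
  define k where "k = 2 / B \<alpha> \<alpha>"
  define s where "s = B v \<alpha> + blinfun_apply l \<alpha>"
  define p where "p = blinfun_apply l a"
  define q where "q = blinfun_apply l b"
  define r where "r = blinfun_apply l d"
  have rad': "B a v = 0" "B b v = 0" "B d v = 0" for v
    by (simp_all add: sym[of _ v] rad)
  have kB: "k * (x * B \<alpha> \<alpha>) = 2 * x" for x using \<alpha> by (simp add: k_def)
  have step: "refl_map B (\<alpha> + x) (v - k *\<^sub>R w, l) = (v - k *\<^sub>R (w + t *\<^sub>R (\<alpha> + x)), l)"
    if "\<And>v. B v x = 0" "t = s - k * B w \<alpha> + blinfun_apply l x" for x w t
  proof -
    have "t = B (v - k *\<^sub>R w) \<alpha> + blinfun_apply l \<alpha> + blinfun_apply l x"
      by (simp add: that(2) s_def form_simps)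
    then show ?thesis
      by (simp add: refl_map_isotropic_shift[OF that(1)] k_def algebra_simps)
  qed
  \<comment> \<open>after \<open>i\<close> reflections the first component is \<open>v - k *\<^sub>R wi\<close>; the coefficients come from evaluating the pairings \<open>Bi\<close> below\<close>
  define w1 where "w1 = s *\<^sub>R (\<alpha> + 0)"
  define w2 where "w2 = w1 + (r - s) *\<^sub>R (\<alpha> + d)"
  define w3 where "w3 = w2 + (s + q - r) *\<^sub>R (\<alpha> + (b + d))"
  define w4 where "w4 = w3 + (- s - q) *\<^sub>R (\<alpha> + b)"
  define w5 where "w5 = w4 + (s + p + r) *\<^sub>R (\<alpha> + (a + d))"
  define w6 where "w6 = w5 + (- s - p - r - r) *\<^sub>R (\<alpha> + a)"
  define w7 where "w7 = w6 + (s + p + q + r + r) *\<^sub>R (\<alpha> + (a + b))"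
  note rads = form_simps rad rad' blinfun.add_right p_def[symmetric] q_def[symmetric] r_def[symmetric]
  have B1: "B w1 \<alpha> = s * B \<alpha> \<alpha>" by (simp add: w1_def rads algebra_simps)
  have B2: "B w2 \<alpha> = r * B \<alpha> \<alpha>" by (simp add: w2_def rads B1 algebra_simps)
  have B3: "B w3 \<alpha> = (s + q) * B \<alpha> \<alpha>" by (simp add: w3_def rads B2 algebra_simps)
  have B4: "B w4 \<alpha> = 0 * B \<alpha> \<alpha>" by (simp add: w4_def rads B3 algebra_simps)
  have B5: "B w5 \<alpha> = (s + p + r) * B \<alpha> \<alpha>" by (simp add: w5_def rads B4 algebra_simps)
  have B6: "B w6 \<alpha> = (- r) * B \<alpha> \<alpha>" by (simp add: w6_def rads B5 algebra_simps)
  have S1: "refl_map B (\<alpha> + 0) (v, l) = (v - k *\<^sub>R w1, l)"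
    using step[of 0 s 0] by (simp add: w1_def rads)
  have S2: "refl_map B (\<alpha> + d) (v - k *\<^sub>R w1, l) = (v - k *\<^sub>R w2, l)"
    unfolding w2_def by (rule step) (simp_all add: rads B1 kB)
  have S3: "refl_map B (\<alpha> + (b + d)) (v - k *\<^sub>R w2, l) = (v - k *\<^sub>R w3, l)"
    unfolding w3_def by (rule step) (simp_all add: rads B2 kB)
  have S4: "refl_map B (\<alpha> + b) (v - k *\<^sub>R w3, l) = (v - k *\<^sub>R w4, l)"
    unfolding w4_def by (rule step) (simp_all add: rads B3 kB)
  have S5: "refl_map B (\<alpha> + (a + d)) (v - k *\<^sub>R w4, l) = (v - k *\<^sub>R w5, l)"
    unfolding w5_def by (rule step) (simp_all add: rads B4 kB)
  have S6: "refl_map B (\<alpha> + a) (v - k *\<^sub>R w5, l) = (v - k *\<^sub>R w6, l)"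
    unfolding w6_def by (rule step) (simp_all add: rads B5 kB)
  have S7: "refl_map B (\<alpha> + (a + b)) (v - k *\<^sub>R w6, l) = (v - k *\<^sub>R w7, l)"
    unfolding w7_def by (rule step) (simp_all add: rads B6 kB del: mult_minus_left minus_mult_left)
  have "w7 = (s + p + q + r) *\<^sub>R (\<alpha> + (a + b + d))"
    unfolding w7_def w6_def w5_def w4_def w3_def w2_def w1_def
    by (simp add: algebra_simps, simp only: mult_2_right scaleR_left_distrib)
  moreover have "refl_map B (\<alpha> + (a + b + d)) (v, l)
      = (v - k *\<^sub>R ((s + p + q + r) *\<^sub>R (\<alpha> + (a + b + d))), l)"
    using step[of "a + b + d" "s + p + q + r" 0] by (simp add: rads)
  ultimately show "refl_word B [\<alpha> + (a + b), \<alpha> + a, \<alpha> + (a + d), \<alpha> + b, \<alpha> + (b + d), \<alpha> + d, \<alpha> + 0] u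
      = refl_map B (\<alpha> + (a + b + d)) u"
    by (simp only: u refl_word_simps S1 S2 S3 S4 S5 S6 S7)
qed

lemma refl_word_norm:
  assumes "\<forall>\<gamma>\<in>set \<gamma>s. B \<gamma> \<gamma> \<noteq> 0" "snd u = 0"
  shows "B (fst (refl_word B \<gamma>s u)) (fst (refl_word B \<gamma>s u)) = B (fst u) (fst u)"
  using assms(1)
proof (induction \<gamma>s)
  case (Cons \<gamma> \<gamma>s)
  obtain v where v: "refl_word B \<gamma>s u = (v, 0)"
    using assms(2) snd_refl_word[of \<gamma>s u] by (metis prod.collapse)
  have "B (v - (2 / B \<gamma> \<gamma> * B v \<gamma>) *\<^sub>R \<gamma>) (v - (2 / B \<gamma> \<gamma> * B v \<gamma>) *\<^sub>R \<gamma>) = B v v"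
    using Cons.prems by (simp add: form_simps sym[of \<gamma> v] field_simps)
  then show ?case using Cons v by (simp add: refl_map_Pair)
qed simp

lemma refl_orbit_norm:
  assumes "\<forall>\<gamma>\<in>Q. B \<gamma> \<gamma> \<noteq> 0" "\<beta> \<in> refl_orbit B Vd Q \<alpha>"
  shows "B \<beta> \<beta> = B \<alpha> \<alpha>"
  using assms refl_word_norm[of _ "(\<alpha>, 0)"] unfolding refl_orbit_iff[OF assms(1)]
  by (metis fst_conv snd_conv subsetD)

text \<open>
  Doubling a root does not change its reflection. As orbits preserve the form, the orbit of a root in \<open>A\<close>
  meets neither \<open>C\<close> nor its double, so that exactly the same reflections are omitted on both sides.
\<close>

lemma removable_rescale:
  assumes A: "\<And>\<beta>. \<beta> \<in> A \<Longrightarrow> B \<beta> \<beta> = m" and C: "\<And>\<beta>. \<beta> \<in> C \<Longrightarrow> B \<beta> \<beta> = m'"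
    and m: "m \<noteq> 0" "m' \<noteq> 0" "m' \<noteq> m" "4 * m' \<noteq> m" and "\<alpha> \<in> A"
  shows "removable B Vd (A \<union> (\<lambda>x. 2 *\<^sub>R x) ` C) \<alpha> \<longleftrightarrow> removable B Vd (A \<union> C) \<alpha>"
proof -
  let ?C2 = "(\<lambda>x. 2 *\<^sub>R x) ` C"
  have refl2: "reflection B Vd (2 *\<^sub>R \<beta>) = reflection B Vd \<beta>" for \<beta>
    by (rule ext) (simp add: reflection_eq_restrict refl_map_scaled_root)
  have grp: "refl_group B Vd (A' \<union> ?C2) = refl_group B Vd (A' \<union> C)" for A'
    unfolding refl_group_def by (simp add: image_Un image_image refl2)
  have orb: "refl_orbit B Vd (A \<union> ?C2) \<alpha> = refl_orbit B Vd (A \<union> C) \<alpha>"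
    unfolding refl_orbit_def grp ..
  have norm: "B \<beta> \<beta> = m" if "\<beta> \<in> refl_orbit B Vd (A \<union> C) \<alpha>" for \<beta>
    using refl_orbit_norm[OF _ that] A C m \<open>\<alpha> \<in> A\<close> by auto
  have "(A \<union> C) - refl_orbit B Vd (A \<union> C) \<alpha> = (A - refl_orbit B Vd (A \<union> C) \<alpha>) \<union> C"
    using norm C m by auto
  moreover have "(A \<union> ?C2) - refl_orbit B Vd (A \<union> C) \<alpha> = (A - refl_orbit B Vd (A \<union> C) \<alpha>) \<union> ?C2"
    using norm[of "2 *\<^sub>R _"] C m by (auto simp: form_simps)
  ultimately show ?thesis
    unfolding removable_def orb by (simp add: grp)
qed

end

section \<open>Bases of semilattices\<close>

text \<open>
  The integral span of a finite set, in explicit form: in contrast to \<open>group_closure\<close> it gives access to the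
  coefficients.
\<close>

definition zspan :: "'v::real_vector set \<Rightarrow> 'v set" where
  "zspan A = {\<Sum>b\<in>A. of_int (c b) *\<^sub>R b | c :: 'v \<Rightarrow> int. True}"

lemma zspan_sumI: "(\<Sum>b\<in>A. of_int (c b) *\<^sub>R b) \<in> zspan A"
  unfolding zspan_def by blast

lemma zspanE:
  assumes "x \<in> zspan A"
  obtains c :: "_ \<Rightarrow> int" where "x = (\<Sum>b\<in>A. of_int (c b) *\<^sub>R b)"
  using assms unfolding zspan_def by blast

lemma zspan_zero [simp]: "0 \<in> zspan A"
  using zspan_sumI[of "\<lambda>_. 0" A] by simp

lemma zspan_diff: "x \<in> zspan A \<Longrightarrow> y \<in> zspan A \<Longrightarrow> x - y \<in> zspan A"
proof (elim zspanE)
  fix c d :: "'a \<Rightarrow> int"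
  assume "x = (\<Sum>b\<in>A. of_int (c b) *\<^sub>R b)" "y = (\<Sum>b\<in>A. of_int (d b) *\<^sub>R b)"
  then have "x - y = (\<Sum>b\<in>A. of_int (c b - d b) *\<^sub>R b)"
    by (simp add: scaleR_left_diff_distrib sum_subtractf)
  then show ?thesis by (metis zspan_sumI)
qed

lemma zspan_scale: "x \<in> zspan A \<Longrightarrow> of_int k *\<^sub>R x \<in> zspan A"
proof (elim zspanE)
  fix c :: "'a \<Rightarrow> int"
  assume "x = (\<Sum>b\<in>A. of_int (c b) *\<^sub>R b)"
  then have "of_int k *\<^sub>R x = (\<Sum>b\<in>A. of_int (k * c b) *\<^sub>R b)"
    by (simp add: scaleR_sum_right)
  then show ?thesis by (metis zspan_sumI)
qed

lemma zspan_add: "x \<in> zspan A \<Longrightarrow> y \<in> zspan A \<Longrightarrow> x + y \<in> zspan A"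
  using zspan_diff[of x A "- y"] zspan_diff[of 0 A y] by simp

lemma zspan_base:
  assumes "finite A" "b \<in> A"
  shows "b \<in> zspan A"
proof -
  have "(\<Sum>x\<in>A. of_int (of_bool (x = b)) *\<^sub>R x) = (\<Sum>x\<in>A. if x = b then x else 0)"
    by (rule sum.cong) auto
  also have "\<dots> = b" using assms by (simp add: sum.delta)
  finally show ?thesis by (metis zspan_sumI)
qed

lemma zspan_insert:
  assumes "finite A" "g \<notin> A"
  shows "x \<in> zspan (insert g A) \<longleftrightarrow> (\<exists>k::int. x - of_int k *\<^sub>R g \<in> zspan A)"
proof
  assume "x \<in> zspan (insert g A)"
  then obtain c :: "'a \<Rightarrow> int" where "x = (\<Sum>b\<in>insert g A. of_int (c b) *\<^sub>R b)"
    by (rule zspanE)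
  then have "x - of_int (c g) *\<^sub>R g = (\<Sum>b\<in>A. of_int (c b) *\<^sub>R b)"
    using assms by simp
  then show "\<exists>k::int. x - of_int k *\<^sub>R g \<in> zspan A" by (metis zspan_sumI)
next
  assume "\<exists>k::int. x - of_int k *\<^sub>R g \<in> zspan A"
  then obtain k and c :: "'a \<Rightarrow> int" where c: "x - of_int k *\<^sub>R g = (\<Sum>b\<in>A. of_int (c b) *\<^sub>R b)"
    by (auto elim: zspanE)
  have "(\<Sum>b\<in>insert g A. of_int ((c(g := k)) b) *\<^sub>R b)
      = of_int k *\<^sub>R g + (\<Sum>b\<in>A. of_int ((c(g := k)) b) *\<^sub>R b)"
    using assms by simp
  also have "(\<Sum>b\<in>A. of_int ((c(g := k)) b) *\<^sub>R b) = (\<Sum>b\<in>A. of_int (c b) *\<^sub>R b)"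
    using assms by (intro sum.cong) auto
  also have "of_int k *\<^sub>R g + (\<Sum>b\<in>A. of_int (c b) *\<^sub>R b) = x"
    using c by (simp add: algebra_simps)
  finally show "x \<in> zspan (insert g A)" by (metis zspan_sumI)
qed

lemma zspan_subset_span: "zspan A \<subseteq> span A"
  by (auto simp: zspan_def intro: span_sum span_scale span_base)

lemma zspan_subset_subgroup:
  assumes L: "0 \<in> L" "\<And>x y. x \<in> L \<Longrightarrow> y \<in> L \<Longrightarrow> x - y \<in> L" and A: "finite A" "A \<subseteq> L"
  shows "zspan A \<subseteq> L"
  using A
proof (induction A)
  case empty
  then show ?case using L by (auto simp: zspan_def)
next
  case (insert g A)
  have add: "x + y \<in> L" if "x \<in> L" "y \<in> L" for x y
    using L(2)[OF that(1) L(2)[OF L(1) that(2)]] by simp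
  have nat: "real n *\<^sub>R g \<in> L" for n
    using insert.prems L(1) add by (induction n) (auto simp: algebra_simps)
  have int: "of_int k *\<^sub>R g \<in> L" for k
    using nat[of "nat k"] L(2)[OF L(1) nat[of "nat (- k)"]] by (cases "k \<ge> 0") auto
  show ?case
  proof
    fix x assume "x \<in> zspan (insert g A)"
    then obtain k where "x - of_int k *\<^sub>R g \<in> zspan A"
      using zspan_insert insert.hyps by blast
    then show "x \<in> L"
      using insert add[OF _ int[of k], of "x - of_int k *\<^sub>R g"] by auto
  qed
qed

lemma group_closure_subset_subgroup:
  assumes L: "0 \<in> L" "\<And>x y. x \<in> L \<Longrightarrow> y \<in> L \<Longrightarrow> x - y \<in> L" and "S \<subseteq> L"
  shows "group_closure S \<subseteq> L"
proof
  fix x assume "x \<in> group_closure S"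
  then show "x \<in> L" by induction (use assms in auto)
qed

lemma group_closure_superset: "S \<subseteq> group_closure S"
  by (auto intro: group_closure.base)

lemma finite_bounded_subgroup:
  fixes L :: "'v::euclidean_space set"
  assumes diff: "\<And>x y. x \<in> L \<Longrightarrow> y \<in> L \<Longrightarrow> x - y \<in> L"
    and e: "e > 0" "\<And>x. x \<in> L \<Longrightarrow> norm x < e \<Longrightarrow> x = 0"
  shows "finite {x \<in> L. norm x \<le> r}"
proof -
  have "\<not> z islimpt L" for z
  proof (rule discrete_imp_not_islimpt[OF e(1)])
    fix x y assume "x \<in> L" "y \<in> L" "dist y x < e"
    then show "y = x" using e(2)[of "y - x"] diff by (auto simp: dist_norm)
  qed
  then have "finite (L \<inter> cball 0 r)"
    using finite_not_islimpt_in_compact[of "cball 0 r" L] by (auto simp: Int_commute)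
  then show ?thesis by (rule finite_subset[rotated]) auto
qed

text \<open>
  Induction on the dimension. Let \<open>\<phi>\<close> be the coordinate of a new direction \<open>a\<close>. Reducing modulo the
  lattice already found brings every element with \<open>0 < \<phi> x \<le> 1\<close> into a fixed ball, so by discreteness \<open>\<phi>\<close>
  takes only finitely many values there. An element \<open>g\<close> with the smallest of these values completes the
  basis, by division with remainder.
\<close>

lemma discrete_subgroup_zbasis:
  fixes L :: "'v::euclidean_space set"
  assumes L: "0 \<in> L" "\<And>x y. x \<in> L \<Longrightarrow> y \<in> L \<Longrightarrow> x - y \<in> L"
    and e: "e > 0" "\<And>x. x \<in> L \<Longrightarrow> norm x < e \<Longrightarrow> x = 0"
    and A: "finite A" "independent A" "A \<subseteq> L"
  shows "\<exists>C. finite C \<and> independent C \<and> span C = span A \<and> L \<inter> span A = zspan C"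
  using A
proof (induction A)
  case empty
  then show ?case
    using L(1) by (intro exI[of _ "{}"]) (auto simp: zspan_def independent_empty)
next
  case (insert a A)
  then obtain C where C: "finite C" "independent C" "span C = span A" "L \<inter> span A = zspan C"
    by (auto dest: independent_mono)
  have add: "x + y \<in> L" if "x \<in> L" "y \<in> L" for x y
    using L(2)[OF that(1) L(2)[OF L(1) that(2)]] by simp
  have scale: "of_int k *\<^sub>R x \<in> L" if "x \<in> L" for k x
    using zspan_subset_subgroup[OF L, of "{x}"] zspan_scale[OF zspan_base, of "{x}" x k] that by auto
  have aA: "a \<notin> span A"
    using insert.prems insert.hyps by (auto simp: independent_insert)
  obtain \<phi> where \<phi>: "linear \<phi>" "\<forall>x\<in>insert a A. \<phi> x = (if x = a then 1 else 0 :: real)"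
    using linear_independent_extend[OF insert.prems(1), of "\<lambda>x. if x = a then 1 else 0"] by blast
  have \<phi>0: "\<phi> x = 0" if "x \<in> span A" for x
  proof (rule linear_eq_0_on_span[OF \<phi>(1) _ that])
    fix y assume "y \<in> A"
    then show "\<phi> y = 0" using \<phi>(2) insert.hyps by auto
  qed
  have dec: "x - \<phi> x *\<^sub>R a \<in> span A" if x: "x \<in> span (insert a A)" for x
  proof -
    obtain k where k: "x - k *\<^sub>R a \<in> span A" using span_breakdown_eq x by blast
    have "\<phi> (x - k *\<^sub>R a) = 0" using \<phi>0 k by blast
    then have "\<phi> x = k" using \<phi> by (simp add: linear_diff linear_scale)
    then show ?thesis using k by simp
  qed
  define L' where "L' = L \<inter> span (insert a A)"
  define T where "T = \<phi> ` {x \<in> L'. 0 < \<phi> x \<and> \<phi> x \<le> 1}"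
  define r where "r = norm a + (\<Sum>b\<in>C. norm b)"
  have "T \<subseteq> \<phi> ` {x \<in> L. norm x \<le> r}"
  proof
    fix t assume "t \<in> T"
    then obtain x where x: "x \<in> L'" "0 < \<phi> x" "\<phi> x \<le> 1" "t = \<phi> x" by (auto simp: T_def)
    then have "x - \<phi> x *\<^sub>R a \<in> span C" using dec C by (auto simp: L'_def)
    then obtain u where u: "x - \<phi> x *\<^sub>R a = (\<Sum>b\<in>C. u b *\<^sub>R b)"
      using C(1) by (auto simp: span_finite)
    define y where "y = (\<Sum>b\<in>C. of_int \<lfloor>u b\<rfloor> *\<^sub>R b)"
    have yz: "y \<in> zspan C" unfolding y_def by (rule zspan_sumI)
    then have y: "y \<in> L" "y \<in> span A" using C(4) by auto
    have "x - y = \<phi> x *\<^sub>R a + (\<Sum>b\<in>C. frac (u b) *\<^sub>R b)"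
      using u by (simp add: y_def frac_def scaleR_left_diff_distrib sum_subtractf algebra_simps)
    also have "norm \<dots> \<le> norm (\<phi> x *\<^sub>R a) + norm (\<Sum>b\<in>C. frac (u b) *\<^sub>R b)"
      by (rule norm_triangle_ineq)
    also have "\<dots> \<le> r"
      unfolding r_def
    proof (intro add_mono order.trans[OF norm_sum] sum_mono)
      show "norm (\<phi> x *\<^sub>R a) \<le> norm a"
        using x by (simp add: mult_left_le_one_le)
      show "norm (frac (u b) *\<^sub>R b) \<le> norm b" for b
        using frac_lt_1[of "u b"] by (simp add: mult_left_le_one_le)
    qed
    finally have "norm (x - y) \<le> r" .
    moreover have "x - y \<in> L" using x y L by (auto simp: L'_def)
    moreover have "\<phi> (x - y) = t" using x \<phi>0[OF y(2)] \<phi>(1) by (simp add: linear_diff)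
    ultimately show "t \<in> \<phi> ` {x \<in> L. norm x \<le> r}" by force
  qed
  then have finT: "finite T"
    using finite_bounded_subgroup[OF L(2) e] by (meson finite_imageI finite_subset)
  have "a \<in> L'" using insert.prems by (auto simp: L'_def span_base)
  then have "1 \<in> T" using \<phi>(2) by (force simp: T_def)
  then have "Min T \<in> T" and minT: "\<And>t. t \<in> T \<Longrightarrow> Min T \<le> t"
    using finT by (auto intro: Min_in)
  then obtain g where g: "g \<in> L'" "0 < \<phi> g" "\<phi> g \<le> 1" "Min T = \<phi> g"
    by (auto simp: T_def)
  have gA: "g \<notin> span A" using \<phi>0 g by auto
  then have gC: "g \<notin> C" using C span_base by blast
  have ind: "independent (insert g C)"
    using gA C by (auto simp: independent_insert)
  have "a \<in> span (insert g C)"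
  proof -
    have "a = (1 / \<phi> g) *\<^sub>R g - (1 / \<phi> g) *\<^sub>R (g - \<phi> g *\<^sub>R a)"
      using g by (simp add: algebra_simps)
    moreover have "g - \<phi> g *\<^sub>R a \<in> span (insert g C)"
      using dec[of g] g C span_mono[of C "insert g C"] by (auto simp: L'_def)
    ultimately show ?thesis
      by (metis insertI1 span_base span_diff span_scale)
  qed
  moreover have "A \<subseteq> span (insert g C)"
    using C span_mono[of C "insert g C"] span_superset by blast
  moreover have "insert g C \<subseteq> span (insert a A)"
    using g C span_mono[of A "insert a A"] span_superset[of C] by (auto simp: L'_def)
  ultimately have sp: "span (insert g C) = span (insert a A)"
    by (intro span_eq[THEN iffD2]) auto
  have "L' \<subseteq> zspan (insert g C)"
  proof
    fix x assume x: "x \<in> L'"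
    define k where "k = \<lfloor>\<phi> x / \<phi> g\<rfloor>"
    define y where "y = x - of_int k *\<^sub>R g"
    have y: "y \<in> L'"
      using x g L(2) scale by (auto simp: y_def L'_def intro: span_diff span_scale)
    have \<phi>y: "\<phi> y = \<phi> x - of_int k * \<phi> g"
      using \<phi>(1) by (simp add: y_def linear_diff linear_scale)
    have "of_int k \<le> \<phi> x / \<phi> g" "\<phi> x / \<phi> g < of_int k + 1"
      unfolding k_def by linarith+
    then have "0 \<le> \<phi> y" "\<phi> y < \<phi> g"
      using g(2) by (simp_all add: \<phi>y field_simps)
    moreover have "\<not> 0 < \<phi> y"
    proof
      assume "0 < \<phi> y"
      then have "\<phi> y \<in> T" using y g \<open>\<phi> y < \<phi> g\<close> by (auto simp: T_def)
      then show False using minT g \<open>\<phi> y < \<phi> g\<close> by force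
    qed
    ultimately have "\<phi> y = 0" by linarith
    then have "y \<in> L \<inter> span A" using dec[of y] y by (auto simp: L'_def)
    then show "x \<in> zspan (insert g C)"
      using zspan_insert[OF C(1) gC] C(4) by (auto simp: y_def)
  qed
  moreover have "zspan (insert g C) \<subseteq> L'"
  proof -
    have "insert g C \<subseteq> L" using g C zspan_base[OF C(1)] by (auto simp: L'_def)
    then have "zspan (insert g C) \<subseteq> L"
      using zspan_subset_subgroup[OF L] C(1) by blast
    then show ?thesis using zspan_subset_span sp by (auto simp: L'_def)
  qed
  ultimately show ?case
    using C(1) ind sp by (intro exI[of _ "insert g C"]) (auto simp: L'_def)
qed

text \<open>
  The defining condition allows translations by twice a generator of the lattice; they can be iterated, so
  that \<open>S\<close> is a union of cosets of twice its lattice.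
\<close>

lemma semilattice_add_double:
  assumes S: "semilattice_in U S" and "x \<in> S" "y \<in> group_closure S"
  shows "x + 2 *\<^sub>R y \<in> S"
proof -
  have base: "x + 2 *\<^sub>R y \<in> S" "x - 2 *\<^sub>R y \<in> S" if "x \<in> S" "y \<in> S" for x y
    using S that unfolding semilattice_in_def by blast+
  have "0 \<in> S" using S unfolding semilattice_in_def by blast
  have "\<forall>x\<in>S. x + 2 *\<^sub>R y \<in> S \<and> x - 2 *\<^sub>R y \<in> S"
    using assms(3)
  proof induction
    case (base s)
    then show ?case using \<open>0 \<in> S\<close> \<open>\<And>y x. x \<in> S \<Longrightarrow> y \<in> S \<Longrightarrow> x + 2 *\<^sub>R y \<in> S\<close>
        \<open>\<And>y x. x \<in> S \<Longrightarrow> y \<in> S \<Longrightarrow> x - 2 *\<^sub>R y \<in> S\<close> by auto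
  next
    case (diff s t)
    show ?case
    proof
      fix x assume "x \<in> S"
      then have "(x - 2 *\<^sub>R t) + 2 *\<^sub>R s \<in> S" "(x + 2 *\<^sub>R t) - 2 *\<^sub>R s \<in> S"
        using diff.IH by blast+
      then show "x + 2 *\<^sub>R (s - t) \<in> S \<and> x - 2 *\<^sub>R (s - t) \<in> S"
        by (simp add: algebra_simps)
    qed
  qed
  then show ?thesis using assms(2) by blast
qed

lemma semilattice_zero: "semilattice_in U S \<Longrightarrow> 0 \<in> S"
  by (simp add: semilattice_in_def)

lemma lattice_discrete:
  assumes S: "semilattice_in U S"
  obtains e where "e > 0" "\<And>x. x \<in> group_closure S \<Longrightarrow> norm x < e \<Longrightarrow> x = 0"
proof -
  have "0 isolated_in S" using S by (auto simp: semilattice_in_def discrete_def)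
  then obtain d where d: "d > 0" "\<And>y. y \<in> S \<Longrightarrow> dist 0 y < d \<Longrightarrow> y = 0"
    by (rule isolated_inE_dist) blast
  have "x = 0" if "x \<in> group_closure S" "norm x < d / 2" for x
    using d(2)[of "2 *\<^sub>R x"] semilattice_add_double[OF S semilattice_zero[OF S] that(1)] that(2)
    by simp
  then show thesis using that[of "d / 2"] d(1) by simp
qed

lemma lattice_zbasis:
  assumes S: "semilattice_in U S"
  obtains C where "finite C" "independent C" "span C = U" "group_closure S = zspan C"
proof -
  obtain e where e: "e > 0" "\<And>x. x \<in> group_closure S \<Longrightarrow> norm x < e \<Longrightarrow> x = 0"
    using lattice_discrete[OF S] by blast
  obtain A where A: "A \<subseteq> S" "independent A" "S \<subseteq> span A"
    using maximal_independent_subset by blast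
  have U: "span A = U"
    using A S span_mono[of A S] span_minimal[OF A(3)] unfolding semilattice_in_def by simp
  have "group_closure S \<subseteq> U"
    unfolding U[symmetric] by (rule group_closure_subset_subgroup) (use A span_diff span_zero in auto)
  moreover have "\<exists>C. finite C \<and> independent C \<and> span C = span A \<and> group_closure S \<inter> span A = zspan C"
    by (rule discrete_subgroup_zbasis[of "group_closure S" e A])
      (use e A group_closure_superset[of S] independent_imp_finite in \<open>auto intro: group_closure.diff\<close>)
  then obtain C where "finite C" "independent C" "span C = span A"
    "group_closure S \<inter> span A = zspan C"
    by blast
  ultimately show thesis using that[of C] U by (simp add: Int_absorb2)
qed

lemma zspan_coeff_unique:
  assumes "finite C" "independent C"
    and "(\<Sum>b\<in>C. of_int (c b) *\<^sub>R b) = (\<Sum>b\<in>C. of_int (d b) *\<^sub>R b)" "b \<in> C"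
  shows "c b = (d b :: int)"
proof -
  have "(\<Sum>b\<in>C. of_int (c b - d b) *\<^sub>R b) = 0"
    using assms(3) by (simp add: scaleR_left_diff_distrib sum_subtractf)
  then have "of_int (c b - d b) = (0 :: real)"
    using independentD[OF assms(2,1) subset_refl, of "\<lambda>b. of_int (c b - d b)" b] assms(4) by simp
  then show ?thesis by simp
qed

text \<open>
  As \<open>S\<close> generates the lattice, some \<open>s \<in> S\<close> has an odd coefficient at a basis vector \<open>b\<close> outside \<open>S\<close>.
  Subtracting twice a lattice vector makes all coefficients of \<open>s\<close> equal to 0 or 1 without leaving \<open>S\<close>. The
  coefficient at \<open>b\<close> is then 1, so the result can replace \<open>b\<close> in the basis.
\<close>

lemma exchange_into_semilattice:
  assumes S: "semilattice_in U S"
    and C: "finite C" "independent C" "group_closure S = zspan C" "\<not> C \<subseteq> S"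
  obtains C' where "finite C'" "independent C'" "group_closure S = zspan C'"
    "card C' = card C" "card (C \<inter> S) < card (C' \<inter> S)"
proof -
  \<comment> \<open>the lattice vectors with even coefficients outside \<open>S\<close>; if \<open>M\<close> contained \<open>S\<close>, it would be the whole lattice\<close>
  define M where "M = {\<Sum>b\<in>C. of_int (c b) *\<^sub>R b | c :: 'a \<Rightarrow> int. \<forall>b\<in>C - S. even (c b)}"
  obtain s and c :: "'a \<Rightarrow> int" and b where s: "s \<in> S" "s = (\<Sum>b\<in>C. of_int (c b) *\<^sub>R b)"
    and b: "b \<in> C" "b \<notin> S" "odd (c b)"
  proof (rule ccontr)
    assume "\<not> thesis"
    then have no: "\<And>s c b. s \<in> S \<Longrightarrow> s = (\<Sum>b\<in>C. of_int (c b) *\<^sub>R b) \<Longrightarrow> b \<in> C \<Longrightarrow>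
        b \<notin> S \<Longrightarrow> even (c b)"
      using that by blast
    have "S \<subseteq> M"
    proof
      fix s assume "s \<in> S"
      then have "s \<in> zspan C" using group_closure_superset C(3) by blast
      then obtain c :: "'a \<Rightarrow> int" where "s = (\<Sum>b\<in>C. of_int (c b) *\<^sub>R b)" by (rule zspanE)
      then show "s \<in> M" using no[OF \<open>s \<in> S\<close>] unfolding M_def by blast
    qed
    moreover have "0 \<in> M" unfolding M_def by (auto intro: exI[of _ "\<lambda>_. 0"])
    moreover have "x - y \<in> M" if x: "x \<in> M" and y: "y \<in> M" for x y
    proof -
      obtain c d :: "'a \<Rightarrow> int"
        where *: "x = (\<Sum>b\<in>C. of_int (c b) *\<^sub>R b)" "\<forall>b\<in>C - S. even (c b)"
          "y = (\<Sum>b\<in>C. of_int (d b) *\<^sub>R b)" "\<forall>b\<in>C - S. even (d b)"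
        using x y unfolding M_def by blast
      have "x - y = (\<Sum>b\<in>C. of_int (c b - d b) *\<^sub>R b)"
        by (simp add: * scaleR_left_diff_distrib sum_subtractf)
      moreover have "\<forall>b\<in>C - S. even (c b - d b)" using * by auto
      ultimately show ?thesis
        unfolding M_def mem_Collect_eq by (intro exI[of _ "\<lambda>b. c b - d b"]) simp
    qed
    ultimately have LM: "group_closure S \<subseteq> M" by (intro group_closure_subset_subgroup)
    obtain b where b: "b \<in> C" "b \<notin> S" using C(4) by blast
    then obtain c :: "'a \<Rightarrow> int" where c: "b = (\<Sum>b\<in>C. of_int (c b) *\<^sub>R b)" "\<forall>b\<in>C - S. even (c b)"
      using LM zspan_base[OF C(1) b(1)] C(3) unfolding M_def by blast
    have "(\<Sum>x\<in>C. of_int (of_bool (x = b)) *\<^sub>R x) = (\<Sum>x\<in>C. if x = b then x else 0)"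
      by (rule sum.cong) auto
    also have "\<dots> = b" using b C by (simp add: sum.delta)
    finally have "of_bool (b = b) = c b"
      using zspan_coeff_unique[OF C(1,2), of "\<lambda>x. of_bool (x = b)" c b] c(1) b by simp
    then show False using c(2) b by (metis Diff_iff odd_one of_bool_eq(2))
  qed
  define s' where "s' = (\<Sum>b\<in>C. of_int (c b mod 2) *\<^sub>R b)"
  define m where "m = (\<Sum>b\<in>C - {b}. of_int (c b mod 2) *\<^sub>R b)"
  have "s' = s + 2 *\<^sub>R (\<Sum>b\<in>C. of_int (- (c b div 2)) *\<^sub>R b)"
    unfolding s'_def s(2) scaleR_sum_right sum.distrib[symmetric]
  proof (rule sum.cong)
    fix x
    have "c x mod 2 = c x + 2 * (- (c x div 2))" by presburger
    then have "real_of_int (c x mod 2) = of_int (c x) + 2 * of_int (- (c x div 2))"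
      by (metis of_int_add of_int_mult of_int_numeral)
    then show "of_int (c x mod 2) *\<^sub>R x = of_int (c x) *\<^sub>R x + 2 *\<^sub>R of_int (- (c x div 2)) *\<^sub>R x"
      by (simp only: scaleR_left_distrib scaleR_scaleR)
  qed simp
  then have s'S: "s' \<in> S"
    using semilattice_add_double[OF S s(1)] zspan_sumI C(3) by metis
  have s'm: "s' = b + m"
    using C(1) b by (simp add: s'_def m_def sum.remove odd_iff_mod_2_eq_one)
  have m: "m \<in> zspan (C - {b})" unfolding m_def by (rule zspan_sumI)
  have bspan: "b \<notin> span (C - {b})"
    using C(2) b(1) by (metis dependent_def)
  have s'span: "s' \<notin> span (C - {b})"
  proof
    assume "s' \<in> span (C - {b})"
    then have "s' - m \<in> span (C - {b})" using m zspan_subset_span span_diff by blast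
    then show False using bspan s'm by simp
  qed
  have s'n: "s' \<notin> C - {b}" using s'span span_base[of s' "C - {b}"] by blast
  define C' where "C' = insert s' (C - {b})"
  show thesis
  proof (rule that[of C'])
    show "finite C'" using C by (simp add: C'_def)
    show "independent C'"
      unfolding C'_def using s'span independent_mono[OF C(2), of "C - {b}"]
      by (auto simp: independent_insert)
    show "card C' = card C"
      unfolding C'_def using card.remove[OF C(1) b(1)] s'n C(1)
      by (metis card_insert_disjoint finite_Diff)
    have "x \<in> zspan C \<longleftrightarrow> x \<in> zspan C'" for x
    proof -
      have "x - of_int k *\<^sub>R b \<in> zspan (C - {b}) \<longleftrightarrow> x - of_int k *\<^sub>R s' \<in> zspan (C - {b})" for k
      proof -
        have "x - of_int k *\<^sub>R s' = (x - of_int k *\<^sub>R b) - of_int k *\<^sub>R m"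
          by (simp add: s'm algebra_simps)
        then show ?thesis
          by (metis add_diff_cancel diff_add_cancel m zspan_add zspan_diff zspan_scale)
      qed
      then show ?thesis
        using zspan_insert[of "C - {b}" b x] zspan_insert[of "C - {b}" s' x] C(1) b(1) s'n
        by (simp add: C'_def insert_absorb)
    qed
    then show "group_closure S = zspan C'" using C(3) by blast
    have "C' \<inter> S = insert s' (C \<inter> S)" using s'S b by (auto simp: C'_def)
    moreover have "s' \<notin> C \<inter> S" using s'n b by blast
    ultimately show "card (C \<inter> S) < card (C' \<inter> S)" using C(1) by simp
  qed
qed

lemma semilattice_zbasis:
  assumes S: "semilattice_in U S"
  obtains C where "finite C" "independent C" "group_closure S = zspan C" "C \<subseteq> S" "card C = dim U"
proof -
  define P where "P C \<longleftrightarrow> finite C \<and> independent C \<and> group_closure S = zspan C \<and> card C = dim U" for C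
  obtain C0 where "P C0"
    using lattice_zbasis[OF S] dim_span_eq_card_independent unfolding P_def by metis
  moreover have "card (C \<inter> S) < Suc (dim U)" if "P C" for C
    using that card_mono[of C "C \<inter> S"] by (auto simp: P_def)
  ultimately have "\<exists>C. P C \<and> (\<forall>C'. P C' \<longrightarrow> card (C' \<inter> S) \<le> card (C \<inter> S))"
    by (intro ex_has_greatest_nat[of P C0 _ "Suc (dim U)"]) auto
  then obtain C where C: "P C" "\<And>C'. P C' \<Longrightarrow> card (C' \<inter> S) \<le> card (C \<inter> S)"
    by metis
  have "C \<subseteq> S"
  proof (rule ccontr)
    assume "\<not> C \<subseteq> S"
    then obtain C' where "P C'" "card (C \<inter> S) < card (C' \<inter> S)"
      using exchange_into_semilattice[OF S, of C] C(1) unfolding P_def by metis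
    then show False using C(2) by fastforce
  qed
  then show thesis using that C(1) unfolding P_def by blast
qed

lemma int_basis_exists:
  assumes S: "semilattice_in U S"
  shows "\<exists>n \<sigma>. int_basis_from S n \<sigma>"
proof -
  obtain C where C: "finite C" "independent C" "group_closure S = zspan C" "C \<subseteq> S" "card C = dim U"
    by (rule semilattice_zbasis[OF S])
  obtain h where h: "bij_betw h {1..card C} C"
    using ex_bij_betw_nat_finite_1[OF C(1)] by blast
  have sum: "(\<Sum>b\<in>C. of_int (c b) *\<^sub>R b) = (\<Sum>r\<in>{1..card C}. of_int (c (h r)) *\<^sub>R h r)"
    for c :: "'a \<Rightarrow> int"
    by (rule sum.reindex_bij_betw[OF h, symmetric])
  have inv: "(\<Sum>r\<in>{1..card C}. of_int (c r) *\<^sub>R h r)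
      = (\<Sum>b\<in>C. of_int (c (inv_into {1..card C} h b)) *\<^sub>R b)" for c :: "nat \<Rightarrow> int"
    unfolding sum by (rule sum.cong) (use h in \<open>auto simp: bij_betw_def\<close>)
  have "int_basis_from S (card C) h"
    unfolding int_basis_from_def
  proof (intro conjI allI impI)
    show "h ` {1..card C} \<subseteq> S" using h C by (simp add: bij_betw_def)
    show "group_closure S = {\<Sum>r\<in>{1..card C}. of_int (c r) *\<^sub>R h r |c. True}"
    proof (intro equalityI subsetI)
      fix x assume "x \<in> group_closure S"
      then obtain c :: "'a \<Rightarrow> int" where "x = (\<Sum>b\<in>C. of_int (c b) *\<^sub>R b)"
        unfolding C(3) by (rule zspanE)
      then show "x \<in> {\<Sum>r\<in>{1..card C}. of_int (c r) *\<^sub>R h r |c. True}"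
        unfolding sum mem_Collect_eq by (intro exI[of _ "\<lambda>r. c (h r)"]) simp
    next
      fix x assume "x \<in> {\<Sum>r\<in>{1..card C}. of_int (c r) *\<^sub>R h r |c. True}"
      then obtain c :: "nat \<Rightarrow> int" where "x = (\<Sum>r\<in>{1..card C}. of_int (c r) *\<^sub>R h r)"
        by blast
      then show "x \<in> group_closure S"
        unfolding inv C(3) by (simp only: zspan_sumI)
    qed
    fix c :: "nat \<Rightarrow> int" assume "(\<Sum>r\<in>{1..card C}. of_int (c r) *\<^sub>R h r) = 0"
    then have *: "(\<Sum>b\<in>C. of_int (c (inv_into {1..card C} h b)) *\<^sub>R b) = (\<Sum>b\<in>C. of_int 0 *\<^sub>R b)"
      using inv[of c] by simp
    show "\<forall>r\<in>{1..card C}. c r = 0"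
    proof
      fix r assume r: "r \<in> {1..card C}"
      then have "h r \<in> C" using h by (auto simp: bij_betw_def)
      then have "c (inv_into {1..card C} h (h r)) = 0"
        using zspan_coeff_unique[OF C(1,2) *] by blast
      then show "c r = 0" using h r by (simp add: bij_betw_def)
    qed
  qed
  then show ?thesis by blast
qed

lemma int_basis_sum_mem:
  assumes "int_basis_from S n \<sigma>"
  shows "(\<Sum>r\<in>{1..n}. of_int (c r) *\<^sub>R \<sigma> r) \<in> group_closure S"
  using assms unfolding int_basis_from_def by blast

text \<open>
  Replacing the coefficients by their remainders modulo two changes the vector by twice a lattice vector,
  which does not affect membership in \<open>S\<close>.
\<close>

lemma int_basis_mem_iff:
  assumes S: "semilattice_in U S" and \<sigma>: "int_basis_from S n \<sigma>"
  shows "(\<Sum>r\<in>{1..n}. of_int (c r) *\<^sub>R \<sigma> r) \<in> S \<longleftrightarrow> {r\<in>{1..n}. odd (c r)} \<in> supp S n \<sigma>"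
proof -
  let ?J = "{r\<in>{1..n}. odd (c r)}"
  let ?x = "\<Sum>r\<in>{1..n}. of_int (c r) *\<^sub>R \<sigma> r" and ?y = "\<Sum>r\<in>{1..n}. of_int (c r div 2) *\<^sub>R \<sigma> r"
  have y: "?y \<in> group_closure S" "- ?y \<in> group_closure S"
    using int_basis_sum_mem[OF \<sigma>, of "\<lambda>r. c r div 2"] by simp_all
  have "(\<Sum>r\<in>?J. \<sigma> r) = (\<Sum>r\<in>{1..n}. of_int (c r mod 2) *\<^sub>R \<sigma> r)"
    by (rule sum.mono_neutral_cong_left) (auto simp: odd_iff_mod_2_eq_one)
  moreover have "?x = (\<Sum>r\<in>{1..n}. of_int (c r mod 2) *\<^sub>R \<sigma> r) + 2 *\<^sub>R ?y"
    unfolding scaleR_sum_right sum.distrib[symmetric]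
  proof (rule sum.cong)
    fix r
    have "c r = c r mod 2 + 2 * (c r div 2)" by presburger
    then have "real_of_int (c r) = of_int (c r mod 2) + 2 * of_int (c r div 2)"
      by (metis of_int_add of_int_mult of_int_numeral)
    then show "of_int (c r) *\<^sub>R \<sigma> r = of_int (c r mod 2) *\<^sub>R \<sigma> r + 2 *\<^sub>R of_int (c r div 2) *\<^sub>R \<sigma> r"
      by (simp only: scaleR_left_distrib scaleR_scaleR)
  qed simp
  ultimately have x: "?x = (\<Sum>r\<in>?J. \<sigma> r) + 2 *\<^sub>R ?y" by simp
  have "?x \<in> S \<longleftrightarrow> (\<Sum>r\<in>?J. \<sigma> r) \<in> S"
  proof
    assume "?x \<in> S"
    then have "?x + 2 *\<^sub>R (- ?y) \<in> S" using semilattice_add_double[OF S] y by blast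
    then show "(\<Sum>r\<in>?J. \<sigma> r) \<in> S" unfolding x by simp
  next
    assume "(\<Sum>r\<in>?J. \<sigma> r) \<in> S"
    then show "?x \<in> S" unfolding x using semilattice_add_double[OF S] y by blast
  qed
  then show ?thesis by (auto simp: supp_def)
qed

text \<open>
  Counting the subset sums of a basis modulo twice the lattice in two ways bounds the number of vectors
  of any integral basis by the dimension. It is a spanning set, so it has exactly that size and is linearly
  independent over the reals.
\<close>

lemma int_basis_size:
  assumes S: "semilattice_in U S" and \<sigma>: "int_basis_from S n \<sigma>"
  shows "n = dim U" "inj_on \<sigma> {1..n}" "independent (\<sigma> ` {1..n})"
proof -
  have gen: "group_closure S = {\<Sum>r\<in>{1..n}. of_int (c r) *\<^sub>R \<sigma> r | c. True}"
    and ind: "\<And>c :: nat \<Rightarrow> int. (\<Sum>r\<in>{1..n}. of_int (c r) *\<^sub>R \<sigma> r) = 0 \<Longrightarrow> \<forall>r\<in>{1..n}. c r = 0"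
    and \<sigma>S: "\<sigma> ` {1..n} \<subseteq> S"
    using \<sigma> by (auto simp: int_basis_from_def)
  obtain C where C: "finite C" "independent C" "group_closure S = zspan C" "C \<subseteq> S" "card C = dim U"
    by (rule semilattice_zbasis[OF S])
  have "\<exists>c. (\<Sum>r\<in>J. \<sigma> r) = (\<Sum>b\<in>C. of_int (c b) *\<^sub>R b)" if "J \<subseteq> {1..n}" for J
  proof -
    have "(\<Sum>r\<in>J. \<sigma> r) = (\<Sum>r\<in>{1..n}. of_int (of_bool (r \<in> J)) *\<^sub>R \<sigma> r)"
      by (rule sum.mono_neutral_cong_left) (use that in auto)
    also have "\<dots> \<in> zspan C"
      unfolding C(3)[symmetric] by (rule int_basis_sum_mem[OF \<sigma>, of "\<lambda>r. of_bool (r \<in> J)"])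
    finally show ?thesis by (auto elim: zspanE)
  qed
  then obtain c :: "nat set \<Rightarrow> 'a \<Rightarrow> int"
    where c: "\<And>J. J \<subseteq> {1..n} \<Longrightarrow> (\<Sum>r\<in>J. \<sigma> r) = (\<Sum>b\<in>C. of_int (c J b) *\<^sub>R b)"
    by metis
  have "inj_on (\<lambda>J. {b\<in>C. odd (c J b)}) (Pow {1..n})"
  proof (rule inj_onI)
    fix I J assume IJ: "I \<in> Pow {1..n}" "J \<in> Pow {1..n}" "{b\<in>C. odd (c I b)} = {b\<in>C. odd (c J b)}"
    have "(\<Sum>b\<in>C. of_int ((c I b - c J b) div 2) *\<^sub>R b) \<in> group_closure S"
      unfolding C(3) by (rule zspan_sumI)
    then obtain d :: "nat \<Rightarrow> int" where d: "(\<Sum>b\<in>C. of_int ((c I b - c J b) div 2) *\<^sub>R b)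
        = (\<Sum>r\<in>{1..n}. of_int (d r) *\<^sub>R \<sigma> r)"
      unfolding gen by blast
    have sb: "(\<Sum>r\<in>{1..n}. of_int (of_bool (r \<in> K)) *\<^sub>R \<sigma> r) = (\<Sum>r\<in>K. \<sigma> r)"
      if "K \<subseteq> {1..n}" for K
      by (rule sum.mono_neutral_cong_right) (use that in auto)
    have "(\<Sum>r\<in>I. \<sigma> r) - (\<Sum>r\<in>J. \<sigma> r) = (\<Sum>b\<in>C. of_int (c I b - c J b) *\<^sub>R b)"
      using c[of I] c[of J] IJ by (simp add: scaleR_left_diff_distrib sum_subtractf)
    also have "\<dots> = 2 *\<^sub>R (\<Sum>b\<in>C. of_int ((c I b - c J b) div 2) *\<^sub>R b)"
      unfolding scaleR_sum_right
    proof (rule sum.cong)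
      fix b assume "b \<in> C"
      then have "odd (c I b) = odd (c J b)" using IJ(3) by blast
      then have "c I b - c J b = 2 * ((c I b - c J b) div 2)" by presburger
      then have "real_of_int (c I b - c J b) = 2 * of_int ((c I b - c J b) div 2)"
        by (metis of_int_mult of_int_numeral)
      then show "of_int (c I b - c J b) *\<^sub>R b = 2 *\<^sub>R of_int ((c I b - c J b) div 2) *\<^sub>R b"
        by (simp only: scaleR_scaleR)
    qed simp
    finally have "(\<Sum>r\<in>I. \<sigma> r) - (\<Sum>r\<in>J. \<sigma> r) = 2 *\<^sub>R (\<Sum>r\<in>{1..n}. of_int (d r) *\<^sub>R \<sigma> r)"
      unfolding d .
    then have "(\<Sum>r\<in>{1..n}. of_int (of_bool (r \<in> I) - of_bool (r \<in> J) - 2 * d r) *\<^sub>R \<sigma> r) = 0"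
      using sb[of I] sb[of J] IJ(1,2)
      by (simp add: scaleR_left_diff_distrib sum_subtractf scaleR_sum_right)
    then have z: "\<forall>r\<in>{1..n}. of_bool (r \<in> I) - of_bool (r \<in> J) - 2 * d r = 0" by (rule ind)
    have "r \<in> I \<longleftrightarrow> r \<in> J" if "r \<in> {1..n}" for r
    proof -
      have "(of_bool (r \<in> I) :: int) - of_bool (r \<in> J) = 2 * d r" using z that by simp
      then have "even ((of_bool (r \<in> I) :: int) - of_bool (r \<in> J))" by simp
      then show ?thesis by (cases "r \<in> I"; cases "r \<in> J") auto
    qed
    then show "I = J" using IJ(1,2) by blast
  qed
  then have "card (Pow {1..n}) \<le> card (Pow C)"
    by (rule card_inj_on_le) (use C(1) in auto)
  then have le: "n \<le> dim U" using C by (simp add: card_Pow)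
  have sub: "U \<subseteq> span (\<sigma> ` {1..n})"
  proof -
    have "S \<subseteq> span (\<sigma> ` {1..n})"
    proof
      fix x assume "x \<in> S"
      then have "x \<in> group_closure S" using group_closure_superset by blast
      then obtain c :: "nat \<Rightarrow> int" where "x = (\<Sum>r\<in>{1..n}. of_int (c r) *\<^sub>R \<sigma> r)"
        unfolding gen by blast
      then show "x \<in> span (\<sigma> ` {1..n})" by (auto intro!: span_sum span_scale intro: span_base)
    qed
    then show ?thesis using S span_minimal[of S "span (\<sigma> ` {1..n})"] by (auto simp: semilattice_in_def)
  qed
  have "\<sigma> ` {1..n} \<subseteq> U" using \<sigma>S S by (auto simp: semilattice_in_def)
  have "dim U \<le> card (\<sigma> ` {1..n})" using dim_le_card[OF sub] by simp
  moreover have "card (\<sigma> ` {1..n}) \<le> n" using card_image_le[of "{1..n}" \<sigma>] by simp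
  ultimately have eq: "card (\<sigma> ` {1..n}) = n" "n = dim U" using le by linarith+
  then show "n = dim U" by blast
  show "inj_on \<sigma> {1..n}" by (rule eq_card_imp_inj_on) (use eq in auto)
  show "independent (\<sigma> ` {1..n})"
    using card_le_dim_spanning[OF \<open>\<sigma> ` {1..n} \<subseteq> U\<close> sub] eq by simp
qed

text \<open>
  The index is defined by a choice of a basis and its size. The existence of a basis in \<open>S\<close> makes the choice
  effective, and the size is forced.
\<close>

lemma ind_eq_card_supp:
  assumes S: "semilattice_in U S"
  obtains \<sigma> where "int_basis_from S (dim U) \<sigma>" "ind S + 1 = card (supp S (dim U) \<sigma>)"
proof -
  obtain n \<sigma> where *: "int_basis_from S n \<sigma>" "ind S = card (supp S n \<sigma>) - 1"
    using someI_ex[of "\<lambda>k. \<exists>n \<sigma>. int_basis_from S n \<sigma> \<and> k = card (supp S n \<sigma>) - 1"]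
      int_basis_exists[OF S] unfolding ind_def by blast
  have "finite (supp S n \<sigma>)" "{} \<in> supp S n \<sigma>"
    using semilattice_zero[OF S] by (auto simp: supp_def intro: finite_subset[of _ "Pow {1..n}"])
  then have "card (supp S n \<sigma>) > 0" by (auto simp: card_gt_0_iff)
  then show thesis using that[of \<sigma>] * int_basis_size(1)[OF S *(1)] by simp
qed

section \<open>Quadratic interpolation modulo two\<close>

definition small_sets :: "nat \<Rightarrow> nat set set" where
  "small_sets n = {e. e \<subseteq> {1..n} \<and> card e \<le> 2}"

text \<open>
  The value at the indicator vector of \<open>J\<close> of the polynomial whose coefficient at the monomial
  \<open>\<Prod>k\<in>e. x k\<close> is \<open>b e\<close>, for \<open>e\<close> with at most two elements. Only its parity will matter.
\<close>

definition quad_eval :: "nat \<Rightarrow> (nat set \<Rightarrow> int) \<Rightarrow> nat set \<Rightarrow> int" where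
  "quad_eval n b J = (\<Sum>e\<in>small_sets n. b e * of_bool (e \<subseteq> J))"

lemma finite_small_sets [simp]: "finite (small_sets n)"
  by (rule finite_subset[of _ "Pow {1..n}"]) (auto simp: small_sets_def)

text \<open>
  A monomial of degree at most two is the product of the variables at the smallest and the largest index of
  its support; for a singleton the two coincide, which is harmless since \<open>x\<^sup>2\<close> and \<open>x\<close> have the same parity.
\<close>

lemma small_set_cases:
  assumes "e \<in> small_sets n" "e \<noteq> {}"
  shows "Min e \<in> {1..n}" "Max e \<in> {1..n}" "e = {Min e, Max e}"
proof -
  have fin: "finite e" using assms by (auto simp: small_sets_def intro: finite_subset)
  then have mm: "Min e \<in> e" "Max e \<in> e" using assms by auto
  then show "Min e \<in> {1..n}" "Max e \<in> {1..n}" using assms by (auto simp: small_sets_def)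
  have "card e = 1 \<or> card e = 2"
    using assms fin card_0_eq[OF fin] unfolding small_sets_def mem_Collect_eq by linarith
  then show "e = {Min e, Max e}"
  proof
    assume "card e = 1"
    then obtain k where "e = {k}" by (rule card_1_singletonE)
    then show ?thesis by simp
  next
    assume "card e = 2"
    then obtain k l where "e = {k, l}" "k \<noteq> l" by (auto simp: card_2_iff)
    then show ?thesis by (cases "k < l") auto
  qed
qed

lemma quad_eval_add: "quad_eval n (\<lambda>e. b e + b' e) J = quad_eval n b J + quad_eval n b' J"
  by (simp add: quad_eval_def distrib_right sum.distrib)

lemma quad_eval_single:
  "e \<in> small_sets n \<Longrightarrow> quad_eval n (\<lambda>x. of_bool (x = e)) J = of_bool (e \<subseteq> J)"
  by (simp add: quad_eval_def of_bool_def if_distrib[of "\<lambda>x. x * _"] sum.delta cong: if_cong)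

lemma quad_eval_on_small:
  assumes "J \<subseteq> {1..n}" "card J \<le> 1"
  shows "quad_eval n b J = (if J = {} then b {} else b {} + b J)"
proof -
  have fin: "finite J" using assms(1) finite_subset by blast
  have "quad_eval n b J = (\<Sum>e\<in>Pow J. b e)"
    unfolding quad_eval_def
  proof (rule sum.mono_neutral_cong_right)
    have "card e \<le> 2" if "e \<subseteq> J" for e
      using card_mono[OF fin that] assms(2) by linarith
    then show "Pow J \<subseteq> small_sets n"
      using assms by (auto simp: small_sets_def)
  qed auto
  also have "\<dots> = (if J = {} then b {} else b {} + b J)"
  proof (cases "J = {}")
    case False
    then have "card J = 1" using assms(2) fin by (metis card_0_eq le_antisym less_one not_less)
    then obtain k where "J = {k}" by (rule card_1_singletonE)
    then show ?thesis by (simp add: Pow_insert)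
  qed simp
  finally show ?thesis .
qed

lemma edge_in_small_sets: "x \<in> {1..n} \<Longrightarrow> y \<in> {1..n} \<Longrightarrow> {x, y} \<in> small_sets n"
  by (auto simp: small_sets_def card_insert_if)

text \<open>
  If an edge of the complete graph on \<open>P\<close> lies in neither \<open>Q\<close> nor \<open>R\<close>, that edge will do. Otherwise \<open>P\<close> is
  contained in one of the two sets, since a complete graph is not a union of two smaller ones; then edges
  leading out of \<open>P\<close> are added in order to cancel an edge of \<open>P\<close> in \<open>Q\<close> and in \<open>R\<close>.
\<close>

lemma cliques_separate:
  assumes sub: "P \<subseteq> {1..n}" "Q \<subseteq> {1..n}" "R \<subseteq> {1..n}"
    and P2: "card P \<ge> 2" and "Q \<noteq> P" "R \<noteq> P"
  obtains b where "\<And>e. card e \<noteq> 2 \<Longrightarrow> b e = 0"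
    "odd (quad_eval n b P)" "even (quad_eval n b Q)" "even (quad_eval n b R)"
proof -
  define edge where "edge x y = (\<lambda>e. of_bool (e = {x, y}) :: int)" for x y :: nat
  have ev: "quad_eval n (edge x y) J = of_bool ({x, y} \<subseteq> J)" if "x \<in> {1..n}" "y \<in> {1..n}" for x y J
    unfolding edge_def using edge_in_small_sets[OF that] by (rule quad_eval_single)
  have e2: "edge x y e = 0" if "x \<noteq> y" "card e \<noteq> 2" for x y e
    using that by (auto simp: edge_def)
  have other: "\<exists>x\<in>P. x \<noteq> a" if "a \<in> P" for a
  proof (rule ccontr)
    assume "\<not> ?thesis"
    then have "P \<subseteq> {a}" by blast
    then have "card P \<le> card {a}" by (intro card_mono) auto
    then show False using P2 by simp
  qed
  \<comment> \<open>the witness when one of the two sets contains \<open>P\<close> and the other does not\<close>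
  have one: "\<exists>b. (\<forall>e. card e \<noteq> 2 \<longrightarrow> b e = 0) \<and> odd (quad_eval n b P)
      \<and> even (quad_eval n b Q) \<and> even (quad_eval n b R)"
    if QR: "Q \<subseteq> {1..n}" "P \<subset> Q" "\<not> P \<subseteq> R" for Q R
  proof -
    obtain q where q: "q \<in> Q" "q \<notin> P" using QR by blast
    obtain a where a: "a \<in> P" "a \<notin> R" using QR by blast
    obtain x where x: "x \<in> P" "x \<noteq> a"
      using other[OF a(1)] by blast
    have n: "a \<in> {1..n}" "x \<in> {1..n}" "q \<in> {1..n}" using a x q QR sub(1) by auto
    have "\<not> {q, a} \<subseteq> P" "{a, x} \<subseteq> P" "{a, x} \<subseteq> Q" "{q, a} \<subseteq> Q"
      "\<not> {a, x} \<subseteq> R" "\<not> {q, a} \<subseteq> R" "q \<noteq> a"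
      using a x q QR by auto
    then show ?thesis
      using x(2) by (intro exI[of _ "\<lambda>e. edge a x e + edge q a e"])
        (simp add: quad_eval_add ev[OF n(1,2)] ev[OF n(3,1)] e2 del: insert_subset)
  qed
  have "\<exists>b. (\<forall>e. card e \<noteq> 2 \<longrightarrow> b e = 0) \<and> odd (quad_eval n b P)
      \<and> even (quad_eval n b Q) \<and> even (quad_eval n b R)"
  proof (cases "P \<subseteq> Q"; cases "P \<subseteq> R")
    assume "P \<subseteq> Q" "\<not> P \<subseteq> R"
    then show ?thesis using one[of Q R] sub \<open>Q \<noteq> P\<close> by blast
  next
    assume "\<not> P \<subseteq> Q" "P \<subseteq> R"
    then show ?thesis using one[of R Q] sub \<open>R \<noteq> P\<close> by blast
  next
    assume "\<not> P \<subseteq> Q" "\<not> P \<subseteq> R"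
    then obtain a a' where a: "a \<in> P" "a \<notin> Q" "a' \<in> P" "a' \<notin> R" by blast
    obtain x where x: "x \<in> P" "x \<noteq> a"
      using other[OF a(1)] by blast
    \<comment> \<open>if \<open>a\<close> is missing from both sets, any second vertex gives a suitable edge\<close>
    define y where "y = (if a' = a then x else a')"
    have y: "y \<noteq> a" "y \<in> P" "{a, y} \<subseteq> P" "\<not> {a, y} \<subseteq> Q" "\<not> {a, y} \<subseteq> R"
      using a x by (auto simp: y_def)
    have n: "a \<in> {1..n}" "y \<in> {1..n}" using a y sub by auto
    show ?thesis
      by (intro exI[of _ "edge a y"]) (use y in \<open>simp add: ev[OF n] e2 del: insert_subset\<close>)
  next
    assume PQ: "P \<subseteq> Q" and PR: "P \<subseteq> R"
    obtain a where a: "a \<in> P" using P2 by fastforce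
    obtain x where x: "x \<in> P" "x \<noteq> a"
      using other[OF a] by blast
    obtain q where q: "q \<in> Q" "q \<notin> P" using PQ \<open>Q \<noteq> P\<close> by blast
    obtain r where r: "r \<in> R" "r \<notin> P" using PR \<open>R \<noteq> P\<close> by blast
    have n: "a \<in> {1..n}" "x \<in> {1..n}" "q \<in> {1..n}" "r \<in> {1..n}" using a x q r sub by auto
    show ?thesis
    proof (cases "\<exists>s. s \<in> Q \<inter> R - P")
      case True
      then obtain s where s: "s \<in> Q" "s \<in> R" "s \<notin> P" by blast
      have sn: "s \<in> {1..n}" using s sub by blast
      have "{a, x} \<subseteq> P" "{a, x} \<subseteq> Q" "{a, x} \<subseteq> R" "s \<noteq> a"
        "\<not> {s, a} \<subseteq> P" "{s, a} \<subseteq> Q" "{s, a} \<subseteq> R"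
        using a x s PQ PR by auto
      then show ?thesis
        using x(2) by (intro exI[of _ "\<lambda>e. edge a x e + edge s a e"])
          (simp add: quad_eval_add ev[OF n(1,2)] ev[OF sn n(1)] e2 del: insert_subset)
    next
      case False
      then have "{a, x} \<subseteq> P" "{a, x} \<subseteq> Q" "{a, x} \<subseteq> R" "q \<noteq> a" "r \<noteq> a"
        "\<not> {q, a} \<subseteq> P" "{q, a} \<subseteq> Q" "\<not> {q, a} \<subseteq> R"
        "\<not> {r, a} \<subseteq> P" "\<not> {r, a} \<subseteq> Q" "{r, a} \<subseteq> R"
        using a x q r PQ PR by auto
      then show ?thesis
        using x(2) by (intro exI[of _ "\<lambda>e. edge a x e + (edge q a e + edge r a e)"])
          (simp add: quad_eval_add ev[OF n(1,2)] ev[OF n(3,1)] ev[OF n(4,1)] e2 del: insert_subset)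
    qed
  qed
  then show thesis using that by blast
qed

text \<open>
  An affine polynomial can prescribe the values on the sets with at most one element, and purely quadratic
  polynomials, which vanish on those, correct the values on the at most three remaining sets.
\<close>

lemma quadratic_interpolation:
  assumes F: "F \<subseteq> Pow {1..n}" and base: "{} \<in> F" "\<And>k. k \<in> {1..n} \<Longrightarrow> {k} \<in> F"
    and card: "card F \<le> n + 4"
  obtains b where "\<And>J. J \<in> F \<Longrightarrow> odd (quad_eval n b J) \<longleftrightarrow> J = K"
proof -
  define X where "X = {J\<in>F. card J \<ge> 2}"
  have finF: "finite F" using F finite_subset by blast
  then have finX: "finite X" by (simp add: X_def)
  have fJ: "finite J" if "J \<in> F" for J using that F finite_subset by blast
  let ?small = "insert {} ((\<lambda>k. {k}) ` {1..n})"
  have "card ?small = n + 1"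
    by (subst card_insert_disjoint) (auto simp: card_image inj_on_def)
  moreover have "?small \<subseteq> F - X" using base by (auto simp: X_def)
  ultimately have "n + 1 \<le> card (F - X)"
    using finF by (metis card_mono finite_Diff)
  moreover have "card (F - X) = card F - card X" "card X \<le> card F"
    using finF by (auto simp: X_def intro!: card_Diff_subset card_mono)
  ultimately have cX: "card X \<le> 3" using card by linarith
  have delta: "\<exists>b. (\<forall>e. card e \<noteq> 2 \<longrightarrow> b e = 0) \<and> (\<forall>J\<in>X. odd (quad_eval n b J) \<longleftrightarrow> J = P)"
    if P: "P \<in> X" for P
  proof -
    have c: "card (X - {P}) \<le> 2" using cX P finX by simp
    obtain Q R where QR: "Q \<in> F" "R \<in> F" "Q \<noteq> P" "R \<noteq> P" "X \<subseteq> {P, Q, R}"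
    proof (cases "X - {P} = {}")
      case True
      moreover have "{} \<noteq> P" using P by (auto simp: X_def)
      ultimately show thesis using that[of "{}" "{}"] base by auto
    next
      case False
      then obtain Q where Q: "Q \<in> X" "Q \<noteq> P" by blast
      have "card (X - {P} - {Q}) \<le> 1" using c Q finX by simp
      then have one: "\<forall>J\<in>X - {P} - {Q}. \<forall>R\<in>X - {P} - {Q}. J = R"
        using finX card_le_Suc0_iff_eq[of "X - {P} - {Q}"] by (metis One_nat_def finite_Diff)
      obtain R where "X - {P} - {Q} \<subseteq> {R}" "R \<in> X - {P}"
      proof (cases "X - {P} - {Q} = {}")
        case True
        then show thesis using that[of Q] Q by blast
      next
        case False
        then obtain R where "R \<in> X - {P} - {Q}" by blast
        then show thesis using that[of R] one by blast
      qed
      then show thesis using that[of Q R] Q by (auto simp: X_def)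
    qed
    obtain b where "\<And>e. card e \<noteq> 2 \<Longrightarrow> b e = 0"
      "odd (quad_eval n b P)" "even (quad_eval n b Q)" "even (quad_eval n b R)"
    proof (rule cliques_separate[of P n Q R])
      show "P \<subseteq> {1..n}" "Q \<subseteq> {1..n}" "R \<subseteq> {1..n}" "2 \<le> card P" "Q \<noteq> P" "R \<noteq> P"
        using P QR F by (auto simp: X_def)
    qed blast
    then show ?thesis
      using QR by (intro exI[of _ b]) auto
  qed
  have interp: "\<exists>b. (\<forall>e. card e \<noteq> 2 \<longrightarrow> b e = 0) \<and> (\<forall>J\<in>X. odd (quad_eval n b J) \<longleftrightarrow> J \<in> Y)"
    if "finite Y" "Y \<subseteq> X" for Y
    using that
  proof (induction Y)
    case empty
    show ?case by (intro exI[of _ "\<lambda>_. 0"]) (simp add: quad_eval_def)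
  next
    case (insert P Y)
    then obtain b b' where "\<forall>e. card e \<noteq> 2 \<longrightarrow> b e = 0" "\<forall>J\<in>X. odd (quad_eval n b J) \<longleftrightarrow> J \<in> Y"
      "\<forall>e. card e \<noteq> 2 \<longrightarrow> b' e = 0" "\<forall>J\<in>X. odd (quad_eval n b' J) \<longleftrightarrow> J = P"
      using delta[of P] by auto
    then show ?case
      using insert.hyps by (intro exI[of _ "\<lambda>e. b e + b' e"]) (auto simp: quad_eval_add)
  qed
  \<comment> \<open>an affine function with the right values on the sets with at most one element\<close>
  define a where "a e = (of_bool (card e \<le> 1) * (if e = {} then of_bool (K = {})
      else of_bool (K = {}) + of_bool (K = e)) :: int)" for e
  obtain b where b: "\<forall>e. card e \<noteq> 2 \<longrightarrow> b e = 0"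
    "\<forall>J\<in>X. odd (quad_eval n b J) \<longleftrightarrow> J \<in> {J\<in>X. odd (quad_eval n a J) \<noteq> (J = K)}"
    using interp[of "{J\<in>X. odd (quad_eval n a J) \<noteq> (J = K)}"] finX by auto
  have "odd (quad_eval n (\<lambda>e. a e + b e) J) \<longleftrightarrow> J = K" if J: "J \<in> F" for J
  proof (cases "J \<in> X")
    case True
    then show ?thesis using b(2) by (auto simp: quad_eval_add)
  next
    case False
    then have c: "card J \<le> 1" "J \<subseteq> {1..n}" using J F by (auto simp: X_def)
    have "card {} \<noteq> (2::nat)" "card J \<noteq> 2" using c by auto
    then have "b {} = 0" "b J = 0" using b(1) by blast+
    then have "quad_eval n b J = 0"
      using quad_eval_on_small[OF c(2,1), of b] by (cases "J = {}") simp_all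
    moreover have "quad_eval n a J = (if J = {} then a {} else a {} + a J)"
      using c by (intro quad_eval_on_small)
    moreover have "odd (if J = {} then a {} else a {} + a J) \<longleftrightarrow> J = K"
      using c(1) unfolding a_def by (cases "J = {}"; cases "K = {}"; cases "K = J") simp_all
    ultimately show ?thesis
      unfolding quad_eval_add by simp
  qed
  then show thesis using that by blast
qed

section \<open>Parity of real numbers\<close>

text \<open>
  Parities occur for values of a real bilinear form that happen to be integers.
\<close>

definition even_real :: "real \<Rightarrow> bool" where
  "even_real x \<longleftrightarrow> (\<exists>k::int. x = 2 * of_int k)"

lemma even_real_of_int [simp]: "even_real (of_int k) \<longleftrightarrow> even k"
proof
  assume "even_real (of_int k)"
  then obtain j :: int where "real_of_int k = 2 * of_int j" by (auto simp: even_real_def)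
  then have "k = 2 * j" by linarith
  then show "even k" by simp
qed (auto simp: even_real_def elim!: evenE)

lemma even_real_zero [simp]: "even_real 0"
  using even_real_of_int[of 0] by (simp del: even_real_of_int)

lemma even_real_add: "even_real x \<Longrightarrow> even_real y \<Longrightarrow> even_real (x + y)"
  unfolding even_real_def by (metis distrib_left of_int_add)

lemma even_real_mult: "even_real x \<Longrightarrow> y \<in> \<int> \<Longrightarrow> even_real (x * y)"
  unfolding even_real_def by (metis Ints_cases mult.assoc of_int_mult)

lemma even_real_minus: "even_real x \<Longrightarrow> even_real (- x)"
  using even_real_mult[of x "-1"] by simp

lemma even_real_diff: "even_real x \<Longrightarrow> even_real y \<Longrightarrow> even_real (x - y)"
  using even_real_add[of x "- y"] even_real_minus[of y] by simp

lemma even_real_Ints: "even_real x \<Longrightarrow> x \<in> \<int>"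
  by (auto simp: even_real_def)

lemma even_real_double: "x \<in> \<int> \<Longrightarrow> even_real (2 * x)"
  by (auto simp: even_real_def elim!: Ints_cases)

lemma even_real_sum: "(\<And>i. i \<in> I \<Longrightarrow> even_real (f i)) \<Longrightarrow> even_real (\<Sum>i\<in>I. f i)"
  by (induction I rule: infinite_finite_induct) (auto intro: even_real_add)

lemma even_real_2: "even_real 2" "even_real (- 2)"
  using even_real_of_int[of 2] even_real_minus[of 2] by (simp_all del: even_real_of_int)

lemma even_real_half_mult: "even_real x \<Longrightarrow> even_real y \<Longrightarrow> even_real (1 / 2 * (x * y))"
  using even_real_mult[of x "y / 2"] by (auto simp: even_real_def)

lemma even_real_cong: "even_real (x - y) \<Longrightarrow> even_real x \<longleftrightarrow> even_real y"
  using even_real_diff[of x "x - y"] even_real_add[of "x - y" y] by auto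

section \<open>Characters of the Weyl group\<close>

text \<open>
  The roots in coordinates. The arguments below concern the orbits of short roots, which are governed by
  \<open>S1\<close>; long roots are reached by interpreting the locale a second time for the dual root system, in which
  \<open>S2\<close> and \<open>2 S1\<close> take the places of \<open>S1\<close> and \<open>S2\<close>.
\<close>

locale b2_roots = symmetric_form B for B :: "'v::euclidean_space \<Rightarrow> 'v \<Rightarrow> real" +
  fixes Vd V1 V2 :: "'v set" and c :: real and e1 e2 :: 'v and S1 S2 :: "'v set"
  assumes c: "c > 0" "B e1 e1 = c" "B e2 e2 = c" "B e1 e2 = 0"
    and eVd: "e1 \<in> Vd" "e2 \<in> Vd"
    and subspaces: "subspace Vd" "subspace V1" "subspace V2"
    and radical: "x \<in> V1 \<union> V2 \<Longrightarrow> B v x = 0"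
    and direct: "d \<in> Vd \<Longrightarrow> x \<in> V1 \<Longrightarrow> y \<in> V2 \<Longrightarrow> d + x + y = 0 \<Longrightarrow> x = 0 \<and> y = 0"
    and S1: "semilattice_in V1 S1" and S2: "S2 \<subseteq> V2" "0 \<in> S2"
begin

definition short0 :: "'v set" where "short0 = {e1, - e1, e2, - e2}"

definition long0 :: "'v set" where "long0 = {e1 + e2, e1 - e2, - e1 + e2, - e1 - e2}"

definition short_roots :: "'v set" where
  "short_roots = {\<delta> + x + y | \<delta> x y. \<delta> \<in> short0 \<and> x \<in> S1 \<and> y \<in> group_closure S2}"

definition long_roots :: "'v set" where
  "long_roots = {\<gamma> + 2 *\<^sub>R x + y | \<gamma> x y. \<gamma> \<in> long0 \<and> x \<in> group_closure S1 \<and> y \<in> S2}"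

lemma lattice_subset: "group_closure S1 \<subseteq> V1" "group_closure S2 \<subseteq> V2"
proof -
  have "S1 \<subseteq> V1" using S1 by (simp add: semilattice_in_def)
  then show "group_closure S1 \<subseteq> V1"
    using subspaces by (intro group_closure_subset_subgroup) (auto intro: subspace_diff subspace_0)
  show "group_closure S2 \<subseteq> V2"
    using subspaces S2 by (intro group_closure_subset_subgroup) (auto intro: subspace_diff subspace_0)
qed

lemma radical_right: "x \<in> V1 \<Longrightarrow> B v x = 0" "x \<in> V2 \<Longrightarrow> B v x = 0"
  using radical by blast+

lemma radical_left: "x \<in> V1 \<Longrightarrow> B x v = 0" "x \<in> V2 \<Longrightarrow> B x v = 0"
  using radical_right[of x v] sym by simp_all

lemma short_rootE:
  assumes "\<beta> \<in> short_roots"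
  obtains \<delta> x y where "\<beta> = \<delta> + x + y" "\<delta> \<in> short0" "x \<in> S1" "y \<in> group_closure S2"
    "x \<in> V1" "y \<in> V2" "\<And>v. B v \<beta> = B v \<delta>" "\<And>v. B \<beta> v = B \<delta> v"
proof -
  obtain \<delta> x y where *: "\<beta> = \<delta> + x + y" "\<delta> \<in> short0" "x \<in> S1" "y \<in> group_closure S2"
    using assms unfolding short_roots_def by blast
  moreover have "x \<in> V1" "y \<in> V2"
    using * lattice_subset group_closure_superset[of S1] by blast+
  ultimately show thesis
    using that[of \<delta> x y] by (simp add: form_simps radical_right radical_left)
qed

lemma long_rootE:
  assumes "\<beta> \<in> long_roots"
  obtains \<gamma> x y where "\<beta> = \<gamma> + 2 *\<^sub>R x + y" "\<gamma> \<in> long0" "x \<in> group_closure S1" "y \<in> S2"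
    "x \<in> V1" "y \<in> V2" "\<And>v. B v \<beta> = B v \<gamma>" "\<And>v. B \<beta> v = B \<gamma> v"
proof -
  obtain \<gamma> x y where *: "\<beta> = \<gamma> + 2 *\<^sub>R x + y" "\<gamma> \<in> long0" "x \<in> group_closure S1" "y \<in> S2"
    using assms unfolding long_roots_def by blast
  moreover have "x \<in> V1" "y \<in> V2"
    using * lattice_subset S2 by blast+
  ultimately show thesis
    using that[of \<gamma> x y] by (simp add: form_simps radical_right radical_left)
qed

lemma e2e1: "B e2 e1 = 0" using c sym by metis

lemma norm_short: "\<beta> \<in> short_roots \<Longrightarrow> B \<beta> \<beta> = c"
proof (elim short_rootE)
  fix \<delta> assume "\<delta> \<in> short0" "\<And>v. B v \<beta> = B v \<delta>" "\<And>v. B \<beta> v = B \<delta> v"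
  then show "B \<beta> \<beta> = c" by (simp only:) (auto simp: short0_def form_simps c)
qed

lemma norm_long: "\<beta> \<in> long_roots \<Longrightarrow> B \<beta> \<beta> = 2 * c"
proof (elim long_rootE)
  fix \<gamma> assume "\<gamma> \<in> long0" "\<And>v. B v \<beta> = B v \<gamma>" "\<And>v. B \<beta> v = B \<gamma> v"
  then show "B \<beta> \<beta> = 2 * c" by (simp only:) (auto simp: long0_def form_simps c e2e1)
qed

lemma nonisotropic_roots: "\<forall>\<beta>\<in>short_roots \<union> long_roots. B \<beta> \<beta> \<noteq> 0"
  using norm_short norm_long c(1) by force

lemma form_Ints:
  assumes "\<beta> \<in> short_roots \<union> long_roots" "\<gamma> \<in> short_roots \<union> long_roots"
  shows "B \<gamma> \<beta> / c \<in> \<int>"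
proof -
  obtain \<delta> where \<delta>: "\<delta> \<in> short0 \<union> long0" "\<And>v. B v \<beta> = B v \<delta>"
    using assms(1) by (metis long_rootE short_rootE UnE UnI1 UnI2)
  obtain \<delta>' where \<delta>': "\<delta>' \<in> short0 \<union> long0" "\<And>v. B \<gamma> v = B \<delta>' v"
    using assms(2) by (metis long_rootE short_rootE UnE UnI1 UnI2)
  show ?thesis
    using \<delta>(1) \<delta>'(1) c by (auto simp: \<delta>(2) \<delta>'(2) short0_def long0_def form_simps e2e1)
qed

lemma form_long_even:
  assumes "\<beta> \<in> long_roots" "\<gamma> \<in> long_roots"
  shows "even_real (B \<gamma> \<beta> / c)"
proof -
  obtain \<delta> where \<delta>: "\<delta> \<in> long0" "\<And>v. B v \<beta> = B v \<delta>"
    using assms(1) by (metis long_rootE)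
  obtain \<delta>' where \<delta>': "\<delta>' \<in> long0" "\<And>v. B \<gamma> v = B \<delta>' v"
    using assms(2) by (metis long_rootE)
  show ?thesis
    using \<delta>(1) \<delta>'(1) c by (auto simp: \<delta>(2) \<delta>'(2) long0_def form_simps e2e1 even_real_2)
qed

text \<open>
  The numbers \<open>2 / B \<gamma> \<gamma> * B \<gamma> \<beta>\<close> are the Cartan integers of type \<open>B2\<close>.
\<close>

lemma cartan_Ints:
  assumes "\<gamma> \<in> short_roots \<union> long_roots" "\<beta> \<in> short_roots \<union> long_roots"
  shows "2 / B \<gamma> \<gamma> * B \<gamma> \<beta> \<in> \<int>" "\<gamma> \<in> short_roots \<or> \<beta> \<in> long_roots \<Longrightarrow> even_real (2 / B \<gamma> \<gamma> * B \<gamma> \<beta>)"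
proof -
  have I: "B \<gamma> \<beta> / c \<in> \<int>" using form_Ints assms by blast
  have sh: "even_real (2 / B \<gamma> \<gamma> * B \<gamma> \<beta>)" if "\<gamma> \<in> short_roots"
    using even_real_double[OF I] norm_short[OF that] by simp
  have lg: "2 / B \<gamma> \<gamma> * B \<gamma> \<beta> = B \<gamma> \<beta> / c" if "\<gamma> \<in> long_roots"
    using norm_long[OF that] by simp
  show "2 / B \<gamma> \<gamma> * B \<gamma> \<beta> \<in> \<int>" using sh lg I assms even_real_Ints by (metis UnE)
  show "even_real (2 / B \<gamma> \<gamma> * B \<gamma> \<beta>)" if "\<gamma> \<in> short_roots \<or> \<beta> \<in> long_roots"
    using that sh lg form_long_even assms by (metis UnE)
qed

definition admissible :: "'v \<times> ('v \<Rightarrow>\<^sub>L real) \<Rightarrow> bool" where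
  "admissible u \<longleftrightarrow> (\<forall>\<beta>\<in>short_roots. ext_form B u (\<beta>, 0) \<in> \<int>) \<and> (\<forall>\<beta>\<in>long_roots. even_real (ext_form B u (\<beta>, 0)))"

text \<open>
  A reflection in \<open>\<gamma>\<close> changes the pairing of \<open>u\<close> with \<open>\<beta>\<close> by the product of \<open>(u, \<gamma>)\<close> and a Cartan
  integer. The second factor is even for short \<open>\<gamma>\<close>, the first one for long \<open>\<gamma>\<close>. Hence pairings
  with short roots are invariant modulo two.
\<close>

lemma refl_word_admissible:
  assumes u: "admissible u" and "set \<gamma>s \<subseteq> short_roots \<union> long_roots"
  shows "admissible (refl_word B \<gamma>s u) \<and>
    (\<forall>\<beta>\<in>short_roots. even_real (ext_form B (refl_word B \<gamma>s u) (\<beta>, 0) - ext_form B u (\<beta>, 0)))"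
  using assms(2)
proof (induction \<gamma>s)
  case Nil
  then show ?case using u by simp
next
  case (Cons \<gamma> \<gamma>s)
  let ?w = "refl_word B \<gamma>s u"
  have w: "admissible ?w"
    "\<forall>\<beta>\<in>short_roots. even_real (ext_form B ?w (\<beta>, 0) - ext_form B u (\<beta>, 0))"
    using Cons by auto
  have \<gamma>: "\<gamma> \<in> short_roots \<union> long_roots" using Cons.prems by simp
  have eq: "ext_form B (refl_map B \<gamma> ?w) (\<beta>, 0)
      = ext_form B ?w (\<beta>, 0) - ext_form B ?w (\<gamma>, 0) * (2 / B \<gamma> \<gamma> * B \<gamma> \<beta>)" for \<beta>
    by (simp add: ext_form_refl_map sym[of \<gamma> \<beta>])
  have ev: "even_real (ext_form B ?w (\<gamma>, 0) * (2 / B \<gamma> \<gamma> * B \<gamma> \<beta>))" if "\<beta> \<in> short_roots \<union> long_roots" for \<beta>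
  proof (cases "\<gamma> \<in> short_roots")
    case True
    then have "ext_form B ?w (\<gamma>, 0) \<in> \<int>" using w(1) by (simp add: admissible_def)
    then show ?thesis
      using even_real_mult[OF cartan_Ints(2)[OF \<gamma> that]] True by (metis mult.commute)
  next
    case False
    then have "even_real (ext_form B ?w (\<gamma>, 0))" using w(1) \<gamma> by (simp add: admissible_def)
    then show ?thesis by (rule even_real_mult) (rule cartan_Ints(1)[OF \<gamma> that])
  qed
  have "ext_form B (refl_map B \<gamma> ?w) (\<beta>, 0) \<in> \<int>" if "\<beta> \<in> short_roots" for \<beta>
    using w(1) that ev[of \<beta>] unfolding eq by (auto simp: admissible_def intro: even_real_Ints)
  moreover have "even_real (ext_form B (refl_map B \<gamma> ?w) (\<beta>, 0))" if "\<beta> \<in> long_roots" for \<beta>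
    using w(1) that ev[of \<beta>] unfolding eq by (auto simp: admissible_def intro: even_real_diff)
  moreover have "even_real (ext_form B (refl_map B \<gamma> ?w) (\<beta>, 0) - ext_form B u (\<beta>, 0))"
    if "\<beta> \<in> short_roots" for \<beta>
    using even_real_diff[OF w(2)[rule_format, OF that] ev[of \<beta>]] that unfolding eq
    by (simp add: algebra_simps)
  ultimately show ?case by (simp add: admissible_def)
qed

text \<open>
  The characters of the Weyl group. Multiplying a word \<open>w\<close> from the left by the reflection in \<open>\<gamma>\<close> changes
  \<open>c / 2 * (w u, u')\<close> by \<open>c / (\<gamma>, \<gamma>) * (w u, \<gamma>) (u', \<gamma>)\<close>. For short \<open>\<gamma>\<close> the fraction is 1 and \<open>(w u, \<gamma>)\<close> may be
  replaced by \<open>(u, \<gamma>)\<close> modulo two; for long \<open>\<gamma>\<close> the fraction is one half, and both pairings are even.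
\<close>

lemma quadratic_character_even:
  fixes b :: "'i \<Rightarrow> int"
  assumes adm: "\<And>i. i \<in> I \<Longrightarrow> admissible (u i)" "\<And>i. i \<in> I \<Longrightarrow> admissible (u' i)"
    and "set \<gamma>s \<subseteq> short_roots \<union> long_roots"
    and "\<And>\<gamma>. \<gamma> \<in> set \<gamma>s \<Longrightarrow> \<gamma> \<in> short_roots \<Longrightarrow>
      even_real (\<Sum>i\<in>I. of_int (b i) * (ext_form B (u i) (\<gamma>, 0) * ext_form B (u' i) (\<gamma>, 0)))"
  shows "even_real (\<Sum>i\<in>I. of_int (b i) *
      (c / 2 * (ext_form B (refl_word B \<gamma>s (u i)) (u' i) - ext_form B (u i) (u' i))))"
  using assms(3,4)
proof (induction \<gamma>s)
  case Nil
  then show ?case by simp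
next
  case (Cons \<gamma> \<gamma>s)
  let ?w = "\<lambda>i. refl_word B \<gamma>s (u i)"
  let ?p = "\<lambda>v. ext_form B v (\<gamma>, 0)"
  have IH: "even_real (\<Sum>i\<in>I. of_int (b i) *
      (c / 2 * (ext_form B (?w i) (u' i) - ext_form B (u i) (u' i))))"
    by (rule Cons.IH) (use Cons.prems in auto)
  have \<gamma>: "\<gamma> \<in> short_roots \<union> long_roots" using Cons.prems by simp
  have w: "admissible (?w i)" "\<gamma> \<in> short_roots \<Longrightarrow> even_real (?p (?w i) - ?p (u i))" if "i \<in> I" for i
    using refl_word_admissible[OF adm(1)[OF that], of \<gamma>s] Cons.prems by auto
  have step: "even_real (\<Sum>i\<in>I. of_int (b i) * (c / B \<gamma> \<gamma> * (?p (?w i) * ?p (u' i))))"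
  proof (cases "\<gamma> \<in> short_roots")
    case True
    have "even_real (\<Sum>i\<in>I. (?p (?w i) - ?p (u i)) * (of_int (b i) * ?p (u' i)))"
    proof (rule even_real_sum)
      fix i assume i: "i \<in> I"
      then have "?p (u' i) \<in> \<int>" using adm(2) True by (simp add: admissible_def)
      then show "even_real ((?p (?w i) - ?p (u i)) * (of_int (b i) * ?p (u' i)))"
        by (intro even_real_mult w(2)[OF i True]) simp
    qed
    moreover have "even_real (\<Sum>i\<in>I. of_int (b i) * (?p (u i) * ?p (u' i)))"
      using Cons.prems True by simp
    ultimately have "even_real ((\<Sum>i\<in>I. (?p (?w i) - ?p (u i)) * (of_int (b i) * ?p (u' i)))
        + (\<Sum>i\<in>I. of_int (b i) * (?p (u i) * ?p (u' i))))"
      by (rule even_real_add)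
    also have "(\<Sum>i\<in>I. (?p (?w i) - ?p (u i)) * (of_int (b i) * ?p (u' i)))
        + (\<Sum>i\<in>I. of_int (b i) * (?p (u i) * ?p (u' i)))
        = (\<Sum>i\<in>I. of_int (b i) * (c / B \<gamma> \<gamma> * (?p (?w i) * ?p (u' i))))"
      unfolding sum.distrib[symmetric]
      by (rule sum.cong) (use norm_short[OF True] c(1) in \<open>simp_all add: algebra_simps\<close>)
    finally show ?thesis .
  next
    case False
    then have \<gamma>L: "\<gamma> \<in> long_roots" using \<gamma> by blast
    show ?thesis
    proof (rule even_real_sum)
      fix i assume i: "i \<in> I"
      have "even_real (?p (?w i))" "even_real (?p (u' i))"
        using w(1)[OF i] adm(2)[OF i] \<gamma>L by (simp_all add: admissible_def)
      then have "even_real (1 / 2 * (?p (?w i) * ?p (u' i)) * of_int (b i))"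
        by (intro even_real_mult even_real_half_mult) simp_all
      then show "even_real (of_int (b i) * (c / B \<gamma> \<gamma> * (?p (?w i) * ?p (u' i))))"
        using norm_long[OF \<gamma>L] c(1) by (simp add: mult.commute)
    qed
  qed
  have "(\<Sum>i\<in>I. of_int (b i) *
      (c / 2 * (ext_form B (refl_word B (\<gamma> # \<gamma>s) (u i)) (u' i) - ext_form B (u i) (u' i))))
    = (\<Sum>i\<in>I. of_int (b i) * (c / 2 * (ext_form B (?w i) (u' i) - ext_form B (u i) (u' i))))
      - (\<Sum>i\<in>I. of_int (b i) * (c / B \<gamma> \<gamma> * (?p (?w i) * ?p (u' i))))"
    unfolding sum_subtractf[symmetric]
    by (rule sum.cong) (simp_all add: ext_form_refl_map algebra_simps)
  then show ?case using even_real_diff[OF IH step] by simp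
qed

text \<open>
  The coordinates with respect to a basis of the first lattice, as elements of the extended space. The
  \<open>k\<close>-th one is a multiple of the inner product with the component of \<open>\<sigma> k\<close> orthogonal to everything on which it
  should vanish.
\<close>

lemma dual_functionals:
  assumes \<sigma>: "int_basis_from S1 n \<sigma>"
  obtains \<xi> :: "nat \<Rightarrow> 'v \<Rightarrow>\<^sub>L real"
  where "\<And>k x. k \<in> {1..n} \<Longrightarrow> x \<in> Vd \<union> V2 \<Longrightarrow> blinfun_apply (\<xi> k) x = 0"
    "\<And>k j. k \<in> {1..n} \<Longrightarrow> j \<in> {1..n} \<Longrightarrow> blinfun_apply (\<xi> k) (\<sigma> j) = of_bool (j = k)"
proof -
  have \<sigma>V: "\<sigma> ` {1..n} \<subseteq> V1"
  proof -
    have "\<sigma> ` {1..n} \<subseteq> S1" using \<sigma> by (simp add: int_basis_from_def)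
    then show ?thesis using lattice_subset(1) group_closure_superset[of S1] by blast
  qed
  have "\<exists>f :: 'v \<Rightarrow>\<^sub>L real. (\<forall>x\<in>Vd \<union> V2. blinfun_apply f x = 0)
      \<and> (\<forall>j\<in>{1..n}. blinfun_apply f (\<sigma> j) = of_bool (j = k))" if k: "k \<in> {1..n}" for k
  proof -
    define T where "T = \<sigma> ` ({1..n} - {k})"
    define U where "U = span (Vd \<union> (V2 \<union> T))"
    have inj: "inj_on \<sigma> {1..n}" using int_basis_size(2)[OF S1 \<sigma>] .
    have "T = \<sigma> ` {1..n} - {\<sigma> k}"
      using inj_on_image_set_diff[OF inj, of "{1..n}" "{k}"] k unfolding T_def by simp
    moreover have "\<sigma> k \<in> \<sigma> ` {1..n}" using k by (rule imageI)
    ultimately have kT: "\<sigma> k \<notin> span T"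
      using int_basis_size(3)[OF S1 \<sigma>] by (metis dependent_def)
    have "\<sigma> k \<notin> U"
    proof
      assume "\<sigma> k \<in> U"
      then obtain d y s where dys: "d \<in> Vd" "y \<in> V2" "s \<in> span T" "\<sigma> k = d + (y + s)"
        using span_eq_iff[THEN iffD2, OF subspaces(1)] span_eq_iff[THEN iffD2, OF subspaces(3)]
        by (auto simp: U_def span_Un)
      have "s \<in> V1" using dys(3) span_minimal[of T V1] subspaces \<sigma>V by (auto simp: T_def)
      moreover have "\<sigma> k \<in> V1" using \<sigma>V k by blast
      ultimately have "s - \<sigma> k \<in> V1" by (rule subspace_diff[OF subspaces(2)])
      moreover have "d + (s - \<sigma> k) + y = 0" using dys(4) by (simp add: algebra_simps)
      ultimately have "s - \<sigma> k = 0" using direct dys by blast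
      then show False using kT dys(3) by simp
    qed
    obtain y z where yz: "y \<in> span U" "\<And>w. w \<in> span U \<Longrightarrow> orthogonal z w" "\<sigma> k = y + z"
      using orthogonal_subspace_decomp_exists[of U "\<sigma> k"] by metis
    have zU: "z \<bullet> w = 0" if "w \<in> U" for w
      using yz(2)[OF span_base[OF that]] by (simp add: orthogonal_def)
    have "y \<in> U" using yz(1) unfolding U_def span_span .
    then have zk: "z \<bullet> \<sigma> k = z \<bullet> z" using zU[of y] by (simp add: yz(3) inner_add_right)
    have "z \<noteq> 0" using \<open>y \<in> U\<close> \<open>\<sigma> k \<notin> U\<close> yz(3) by auto
    define f where "f = blinfun_inner_right ((1 / (z \<bullet> z)) *\<^sub>R z)"
    have f: "blinfun_apply f x = (z \<bullet> x) / (z \<bullet> z)" for x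
      by (simp add: f_def)
    have "\<forall>x\<in>Vd \<union> V2. blinfun_apply f x = 0"
      using zU by (auto simp: f U_def span_base)
    moreover have "blinfun_apply f (\<sigma> j) = of_bool (j = k)" if "j \<in> {1..n}" for j
    proof (cases "j = k")
      case True
      then show ?thesis using zk \<open>z \<noteq> 0\<close> by (simp add: f)
    next
      case False
      then have "\<sigma> j \<in> U" using that by (auto simp: U_def T_def intro: span_base)
      then show ?thesis using False zU by (simp add: f)
    qed
    ultimately show ?thesis by blast
  qed
  then have "\<exists>\<xi> :: nat \<Rightarrow> 'v \<Rightarrow>\<^sub>L real. \<forall>k\<in>{1..n}. (\<forall>x\<in>Vd \<union> V2. blinfun_apply (\<xi> k) x = 0)
      \<and> (\<forall>j\<in>{1..n}. blinfun_apply (\<xi> k) (\<sigma> j) = of_bool (j = k))"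
    by (intro bchoice) blast
  then show thesis using that by blast
qed

end

section \<open>Orbits of short roots\<close>

text \<open>
  Used for reachability under the Weyl group: translations that are available for generators add up to all
  translations by the group that they generate.
\<close>

lemma group_closure_translation:
  fixes S :: "'v::real_vector set"
  assumes refl: "\<And>z. R z z" and trans: "\<And>x y z. R x y \<Longrightarrow> R y z \<Longrightarrow> R x z"
    and step: "\<And>z s. s \<in> S \<Longrightarrow> R z (z + k *\<^sub>R s) \<and> R z (z - k *\<^sub>R s)"
    and m: "m \<in> group_closure S"
  shows "R z (z + k *\<^sub>R m)"
proof -
  have "\<forall>z. R z (z + k *\<^sub>R m) \<and> R z (z - k *\<^sub>R m)"
    using m
  proof induction
    case (base s)
    then show ?case using refl step by auto
  next
    case (diff s t)
    show ?case
    proof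
      fix z
      have "R z (z + k *\<^sub>R s)" "R (z + k *\<^sub>R s) (z + k *\<^sub>R s - k *\<^sub>R t)"
        "R z (z - k *\<^sub>R s)" "R (z - k *\<^sub>R s) (z - k *\<^sub>R s + k *\<^sub>R t)"
        using diff.IH by blast+
      then have "R z (z + k *\<^sub>R s - k *\<^sub>R t)" "R z (z - k *\<^sub>R s + k *\<^sub>R t)"
        using trans by blast+
      then show "R z (z + k *\<^sub>R (s - t)) \<and> R z (z - k *\<^sub>R (s - t))"
        by (simp add: algebra_simps)
    qed
  qed
  then show ?thesis by blast
qed

context b2_roots
begin

definition linked :: "'v \<Rightarrow> 'v \<Rightarrow> bool" where
  "linked \<alpha> \<beta> \<longleftrightarrow> (\<exists>\<gamma>s. set \<gamma>s \<subseteq> short_roots \<union> long_roots \<and> refl_word B \<gamma>s (\<alpha>, 0) = (\<beta>, 0))"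

lemma linked_iff_orbit: "linked \<alpha> \<beta> \<longleftrightarrow> \<beta> \<in> refl_orbit B Vd (short_roots \<union> long_roots) \<alpha>"
  unfolding linked_def refl_orbit_iff[OF nonisotropic_roots] ..

lemma linked_refl: "linked \<alpha> \<alpha>"
  unfolding linked_def by (intro exI[of _ "[]"]) simp

lemma linked_trans:
  assumes "linked \<alpha> \<beta>" "linked \<beta> \<gamma>" shows "linked \<alpha> \<gamma>"
proof -
  obtain xs ys where "set xs \<subseteq> short_roots \<union> long_roots" "refl_word B xs (\<alpha>, 0) = (\<beta>, 0)"
    "set ys \<subseteq> short_roots \<union> long_roots" "refl_word B ys (\<beta>, 0) = (\<gamma>, 0)"
    using assms unfolding linked_def by blast
  then show ?thesis unfolding linked_def by (intro exI[of _ "ys @ xs"]) simp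
qed

lemma linked_step:
  assumes "\<gamma> \<in> short_roots \<union> long_roots" shows "linked \<beta> (\<beta> - (2 / B \<gamma> \<gamma> * B \<beta> \<gamma>) *\<^sub>R \<gamma>)"
  unfolding linked_def using assms by (intro exI[of _ "[\<gamma>]"]) (simp add: refl_map_Pair)

text \<open>
  Two reflections in parallel short roots compose to a translation by twice a vector of \<open>S1\<close>; these are the
  single steps, stated for an arbitrary isotropic \<open>z\<close>.
\<close>

lemma short_step:
  assumes \<delta>: "\<delta> \<in> short0" and s: "s \<in> S1" and z: "\<And>v. B v z = 0"
  shows "linked (\<delta> + z) (- \<delta> + z - 2 *\<^sub>R s)" "linked (- \<delta> + z) (\<delta> + z + 2 *\<^sub>R s)"
proof -
  have sV: "s \<in> V1" using s lattice_subset(1) group_closure_superset[of S1] by blast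
  have "\<delta> + s + 0 \<in> short_roots" unfolding short_roots_def using \<delta> s zero_in_group_closure by blast
  then have \<gamma>: "\<delta> + s \<in> short_roots" by simp
  have zl: "B z v = 0" for v using z[of v] by (simp add: sym)
  have \<delta>c: "B \<delta> \<delta> = c" using \<delta> c by (auto simp: short0_def form_simps)
  have n: "B (\<delta> + s) (\<delta> + s) = c" "B (\<delta> + z) (\<delta> + s) = c" "B (- \<delta> + z) (\<delta> + s) = - c"
    by (simp_all add: form_simps radical_right(1)[OF sV] radical_left(1)[OF sV] zl \<delta>c)
  have k: "2 / c * c = 2" "2 / c * - c = - 2" using c(1) by simp_all
  have "\<delta> + z - 2 *\<^sub>R (\<delta> + s) = - \<delta> + z - 2 *\<^sub>R s"
    "- \<delta> + z - (- 2) *\<^sub>R (\<delta> + s) = \<delta> + z + 2 *\<^sub>R s"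
    by (simp_all add: algebra_simps scaleR_2)
  note eq = this
  show "linked (\<delta> + z) (- \<delta> + z - 2 *\<^sub>R s)"
    using linked_step[of "\<delta> + s" "\<delta> + z"] \<gamma> unfolding n k eq by blast
  show "linked (- \<delta> + z) (\<delta> + z + 2 *\<^sub>R s)"
    using linked_step[of "\<delta> + s" "- \<delta> + z"] \<gamma> unfolding n k eq by blast
qed

text \<open>
  For orthogonal short roots \<open>\<delta>\<close> and \<open>\<delta>'\<close> the difference is a long root, whose reflection exchanges them.
  Two such steps compose to a translation by a vector of \<open>S2\<close>.
\<close>

lemma long_step:
  assumes \<delta>: "\<delta> \<in> short0" "\<delta>' \<in> short0" "B \<delta> \<delta>' = 0" and s: "s \<in> S2" and z: "\<And>v. B v z = 0"
  shows "linked (\<delta> + z) (\<delta>' + z - s)" "linked (\<delta>' + z) (\<delta> + z + s)"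
proof -
  have sV: "s \<in> V2" using s S2 by blast
  have c0: "c \<noteq> 0" using c(1) by simp
  have "\<delta> - \<delta>' \<in> long0"
    using \<delta> c c0 by (auto simp: short0_def long0_def form_simps e2e1)
  then have "\<delta> - \<delta>' + 2 *\<^sub>R 0 + s \<in> long_roots"
    unfolding long_roots_def using s zero_in_group_closure[of S1] by blast
  then have \<gamma>: "\<delta> - \<delta>' + s \<in> long_roots" by simp
  have zl: "B z v = 0" for v using z[of v] by (simp add: sym)
  have \<delta>c: "B \<delta> \<delta> = c" "B \<delta>' \<delta>' = c" "B \<delta>' \<delta> = 0"
    using \<delta> c sym[of \<delta> \<delta>'] by (auto simp: short0_def form_simps)
  have n: "B (\<delta> - \<delta>' + s) (\<delta> - \<delta>' + s) = 2 * c" "B (\<delta> + z) (\<delta> - \<delta>' + s) = c"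
    "B (\<delta>' + z) (\<delta> - \<delta>' + s) = - c"
    using \<delta>(3) by (simp_all add: form_simps radical_right(2)[OF sV]
        radical_left(2)[OF sV] zl \<delta>c)
  have k: "2 / (2 * c) * c = 1" "2 / (2 * c) * - c = - 1" using c0 by simp_all
  have "\<delta> + z - 1 *\<^sub>R (\<delta> - \<delta>' + s) = \<delta>' + z - s"
    "\<delta>' + z - (- 1) *\<^sub>R (\<delta> - \<delta>' + s) = \<delta> + z + s"
    by (simp_all add: algebra_simps)
  note eq = this
  show "linked (\<delta> + z) (\<delta>' + z - s)"
    using linked_step[of "\<delta> - \<delta>' + s" "\<delta> + z"] \<gamma> unfolding n k eq by blast
  show "linked (\<delta>' + z) (\<delta> + z + s)"
    using linked_step[of "\<delta> - \<delta>' + s" "\<delta>' + z"] \<gamma> unfolding n k eq by blast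
qed

lemma short0_cases:
  assumes "\<delta> \<in> short0" "\<delta>' \<in> short0"
  shows "\<delta>' = \<delta> \<or> \<delta>' = - \<delta> \<or> B \<delta> \<delta>' = 0"
proof -
  have same: "\<delta>' = \<delta> \<or> \<delta>' = - \<delta>" if "\<delta> \<in> {e, - e}" "\<delta>' \<in> {e, - e}" for e
    using that by auto
  have other: "B \<delta> \<delta>' = 0" if "\<delta> \<in> {e, - e}" "\<delta>' \<in> {f, - f}" "B e f = 0" for e f
    using that by (auto simp: form_simps)
  show ?thesis
    using assms same[of e1] same[of e2] other[of e1 e2] other[of e2 e1] c(4) e2e1
    unfolding short0_def by blast
qed

text \<open>
  The finite part, the position of the \<open>S1\<close>-component within its class modulo twice the lattice, and the
  \<open>S2\<close>-component can be adjusted one after the other.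
\<close>

lemma short_orbit_contains:
  assumes \<delta>: "\<delta> \<in> short0" "\<delta>' \<in> short0" and x: "x \<in> S1" "m \<in> group_closure S1"
    and y: "y \<in> group_closure S2" "y' \<in> group_closure S2"
  shows "linked (\<delta> + x + y) (\<delta>' + (x + 2 *\<^sub>R m) + y')"
proof -
  have rad_x: "x \<in> V1" using x lattice_subset(1) group_closure_superset[of S1] by blast
  have rad: "B v (x + y) = 0" "B v (x + y + 2 *\<^sub>R m) = 0" for v
    using rad_x x y lattice_subset by (auto simp: form_simps radical_right subset_iff)
  have "0 \<in> S1" using S1 by (rule semilattice_zero)
  have zero_in: "0 \<in> S1" "0 \<in> S2" using \<open>0 \<in> S1\<close> S2 by auto
  have "linked (\<delta> + (x + y)) (\<delta>' + (x + y))"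
  proof -
    consider "\<delta>' = \<delta>" | "\<delta>' = - \<delta>" | "B \<delta> \<delta>' = 0"
      using short0_cases[OF \<delta>] by blast
    then show ?thesis
    proof cases
      case 1
      then show ?thesis by (simp add: linked_refl)
    next
      case 2
      then show ?thesis using short_step(1)[OF \<delta>(1) zero_in(1) rad(1)] by simp
    next
      case 3
      then show ?thesis using long_step(1)[OF \<delta> 3 zero_in(2) rad(1)] by simp
    qed
  qed
  moreover have "linked (\<delta>' + (x + y)) (\<delta>' + (x + y + 2 *\<^sub>R m))"
  proof -
    define R where "R z w \<longleftrightarrow> ((\<forall>v. B v z = 0) \<longrightarrow> (\<forall>v. B v w = 0) \<and> linked (\<delta>' + z) (\<delta>' + w))"
      for z w
    have "R (x + y) (x + y + 2 *\<^sub>R m)"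
    proof (rule group_closure_translation[of R])
      show "R z z" for z by (simp add: R_def linked_refl)
      show "R a d" if "R a b" "R b d" for a b d
        using that unfolding R_def by (metis linked_trans)
      fix z s assume s: "s \<in> S1"
      then have sV: "s \<in> V1" using lattice_subset(1) group_closure_superset[of S1] by blast
      show "R z (z + 2 *\<^sub>R s) \<and> R z (z - 2 *\<^sub>R s)"
      proof (cases "\<forall>v. B v z = 0")
        case True
        then have z: "B v z = 0" for v by blast
        have z2: "B v (z - 2 *\<^sub>R s) = 0" "B v (z + 2 *\<^sub>R s) = 0" for v
          using z sV by (simp_all add: form_simps radical_right)
        have "linked (\<delta>' + z) (- \<delta>' + (z - 2 *\<^sub>R s))"
          using short_step(1)[OF \<delta>(2) s z] by (simp add: algebra_simps)
        moreover have "linked (- \<delta>' + (z - 2 *\<^sub>R s)) (\<delta>' + (z - 2 *\<^sub>R s))"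
          using short_step(2)[OF \<delta>(2) zero_in(1) z2(1)] by simp
        moreover have "linked (\<delta>' + z) (- \<delta>' + z)"
          using short_step(1)[OF \<delta>(2) zero_in(1) z] by simp
        moreover have "linked (- \<delta>' + z) (\<delta>' + (z + 2 *\<^sub>R s))"
          using short_step(2)[OF \<delta>(2) s z] by (simp add: algebra_simps)
        ultimately show ?thesis
          using z2 unfolding R_def by (metis linked_trans)
      next
        case False
        then show ?thesis unfolding R_def by blast
      qed
    qed (use x in auto)
    then show ?thesis using rad(1) by (simp add: R_def)
  qed
  moreover have "linked (\<delta>' + (x + y + 2 *\<^sub>R m)) (\<delta>' + (x + y + 2 *\<^sub>R m + 1 *\<^sub>R (y' - y)))"
  proof -
    obtain \<epsilon> where \<epsilon>: "\<epsilon> \<in> short0" "B \<delta>' \<epsilon> = 0"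
    proof (cases "\<delta>' \<in> {e1, - e1}")
      case True
      then show thesis using that[of e2] c by (auto simp: short0_def form_simps)
    next
      case False
      then show thesis using that[of e1] \<delta>(2) e2e1 by (auto simp: short0_def form_simps)
    qed
    define R where "R z w \<longleftrightarrow> ((\<forall>v. B v z = 0) \<longrightarrow> (\<forall>v. B v w = 0) \<and> linked (\<delta>' + z) (\<delta>' + w))"
      for z w
    have "R (x + y + 2 *\<^sub>R m) (x + y + 2 *\<^sub>R m + 1 *\<^sub>R (y' - y))"
    proof (rule group_closure_translation[of R])
      show "R z z" for z by (simp add: R_def linked_refl)
      show "R a d" if "R a b" "R b d" for a b d
        using that unfolding R_def by (metis linked_trans)
      show "y' - y \<in> group_closure S2" using y by (simp add: group_closure.diff)
      fix z s assume s: "s \<in> S2"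
      then have sV: "s \<in> V2" using S2 by blast
      show "R z (z + 1 *\<^sub>R s) \<and> R z (z - 1 *\<^sub>R s)"
      proof (cases "\<forall>v. B v z = 0")
        case True
        then have z: "B v z = 0" for v by blast
        have z2: "B v (z - s) = 0" "B v (z + s) = 0" for v
          using z sV by (simp_all add: form_simps radical_right)
        have "linked (\<delta>' + z) (\<epsilon> + (z - s))"
          using long_step(1)[OF \<delta>(2) \<epsilon> s z] by (simp add: algebra_simps)
        moreover have "linked (\<epsilon> + (z - s)) (\<delta>' + (z - s))"
          using long_step(2)[OF \<delta>(2) \<epsilon> zero_in(2) z2(1)] by simp
        moreover have "linked (\<delta>' + z) (\<epsilon> + z)"
          using long_step(1)[OF \<delta>(2) \<epsilon> zero_in(2) z] by simp
        moreover have "linked (\<epsilon> + z) (\<delta>' + (z + s))"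
          using long_step(2)[OF \<delta>(2) \<epsilon> s z] by (simp add: algebra_simps)
        ultimately have "linked (\<delta>' + z) (\<delta>' + (z - s))" "linked (\<delta>' + z) (\<delta>' + (z + s))"
          by (metis linked_trans)+
        then show ?thesis
          using z2 unfolding R_def by simp
      next
        case False
        then show ?thesis unfolding R_def by blast
      qed
    qed
    then show ?thesis using rad(2) unfolding R_def by blast
  qed
  ultimately have "linked (\<delta> + (x + y)) (\<delta>' + (x + y + 2 *\<^sub>R m + 1 *\<^sub>R (y' - y)))"
    by (metis linked_trans)
  then show ?thesis by (simp add: algebra_simps)
qed

end

section \<open>Removable and non-removable short roots\<close>

context b2_roots
begin

lemma finite_part_mem: "short0 \<subseteq> Vd" "long0 \<subseteq> Vd"
  using eVd subspace_neg[OF subspaces(1)] subspace_add[OF subspaces(1)] subspace_diff[OF subspaces(1)]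
  unfolding short0_def long0_def by (simp_all)

lemma functional_root:
  assumes "\<And>x. x \<in> Vd \<union> V2 \<Longrightarrow> blinfun_apply f x = 0" "d \<in> Vd" "y \<in> V2"
  shows "blinfun_apply f (d + x + y) = blinfun_apply f x"
  using assms by (simp add: blinfun.add_right)

lemma int_basis_coordinates:
  assumes \<sigma>: "int_basis_from S1 n \<sigma>"
  obtains z :: "'v \<Rightarrow> nat \<Rightarrow> int"
  where "\<And>x. x \<in> group_closure S1 \<Longrightarrow> (\<Sum>r\<in>{1..n}. of_int (z x r) *\<^sub>R \<sigma> r) = x"
proof -
  have gen: "group_closure S1 = {\<Sum>r\<in>{1..n}. of_int (c r) *\<^sub>R \<sigma> r | c. True}"
    using \<sigma> unfolding int_basis_from_def by blast
  have "\<exists>z :: nat \<Rightarrow> int. (\<Sum>r\<in>{1..n}. of_int (z r) *\<^sub>R \<sigma> r) = x" if "x \<in> group_closure S1" for x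
    using that unfolding gen by blast
  then have "\<exists>z :: 'v \<Rightarrow> nat \<Rightarrow> int. \<forall>x\<in>group_closure S1. (\<Sum>r\<in>{1..n}. of_int (z x r) *\<^sub>R \<sigma> r) = x"
    by (intro bchoice) blast
  then show thesis using that by blast
qed

lemma functional_coordinate:
  fixes f :: "'v \<Rightarrow>\<^sub>L real" and z :: "nat \<Rightarrow> int"
  assumes "\<And>j. j \<in> {1..n} \<Longrightarrow> blinfun_apply f (\<sigma> j) = of_bool (j = k)" "k \<in> {1..n}"
  shows "blinfun_apply f (\<Sum>r\<in>{1..n}. of_int (z r) *\<^sub>R \<sigma> r) = of_int (z k)"
proof -
  have "blinfun_apply f (\<Sum>r\<in>{1..n}. of_int (z r) *\<^sub>R \<sigma> r) = (\<Sum>r\<in>{1..n}. if r = k then of_int (z r) else 0)"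
    unfolding blinfun.sum_right
    by (rule sum.cong) (simp_all add: blinfun.scaleR_right assms(1))
  also have "\<dots> = of_int (z k)" using assms(2) by (simp add: sum.delta)
  finally show ?thesis .
qed

text \<open>
  Let the coset of the root \<open>\<alpha>\<close> have the indicator polynomial \<open>b\<close>. The associated character is trivial on
  all reflections outside the orbit of \<open>\<alpha>\<close>, since a short root with the same class as \<open>\<alpha>\<close> lies in that orbit, but it
  is not trivial on the reflection in \<open>\<alpha>\<close>. The constant 1 among the affine functions is realised by \<open>p\<close>, which
  pairs to 1 or -1 with every short root.
\<close>

lemma short_not_removable:
  assumes \<sigma>: "int_basis_from S1 n \<sigma>" and few: "card (supp S1 n \<sigma>) \<le> n + 4" and \<alpha>: "\<alpha> \<in> short_roots"
  shows "\<not> removable B Vd (short_roots \<union> long_roots) \<alpha>"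
proof
  assume rem: "removable B Vd (short_roots \<union> long_roots) \<alpha>"
  obtain \<xi> :: "nat \<Rightarrow> 'v \<Rightarrow>\<^sub>L real"
    where \<xi>: "\<And>k x. k \<in> {1..n} \<Longrightarrow> x \<in> Vd \<union> V2 \<Longrightarrow> blinfun_apply (\<xi> k) x = 0"
      "\<And>k j. k \<in> {1..n} \<Longrightarrow> j \<in> {1..n} \<Longrightarrow> blinfun_apply (\<xi> k) (\<sigma> j) = of_bool (j = k)"
    by (rule dual_functionals[OF \<sigma>]) (rule that; blast)
  obtain z :: "'v \<Rightarrow> nat \<Rightarrow> int"
    where z: "\<And>x. x \<in> group_closure S1 \<Longrightarrow> (\<Sum>r\<in>{1..n}. of_int (z x r) *\<^sub>R \<sigma> r) = x"
    by (rule int_basis_coordinates[OF \<sigma>]) (rule that; simp)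
  have \<xi>z: "blinfun_apply (\<xi> k) x = of_int (z x k)" if "k \<in> {1..n}" "x \<in> group_closure S1" for k x
    using functional_coordinate[of n "\<xi> k" \<sigma> k "z x"] \<xi>(2) that z[OF that(2)] by simp
  have S1L: "x \<in> group_closure S1" if "x \<in> S1" for x
    using that group_closure_superset by blast
  define J where "J x = {r\<in>{1..n}. odd (z x r)}" for x
  have Jsupp: "J x \<in> supp S1 n \<sigma>" if "x \<in> S1" for x
    using int_basis_mem_iff[OF S1 \<sigma>, of "z x"] z[OF S1L[OF that]] that by (simp add: J_def)
  obtain \<delta>0 x0 y0 where \<alpha>0: "\<alpha> = \<delta>0 + x0 + y0" "\<delta>0 \<in> short0" "x0 \<in> S1" "y0 \<in> group_closure S2"
    using \<alpha> by (rule short_rootE)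
  obtain b where b: "\<And>K. K \<in> supp S1 n \<sigma> \<Longrightarrow> odd (quad_eval n b K) \<longleftrightarrow> K = J x0"
  proof (rule quadratic_interpolation[of "supp S1 n \<sigma>" n])
    show "supp S1 n \<sigma> \<subseteq> Pow {1..n}" "{} \<in> supp S1 n \<sigma>"
      using semilattice_zero[OF S1] by (auto simp: supp_def)
    show "{k} \<in> supp S1 n \<sigma>" if "k \<in> {1..n}" for k
      using \<sigma> that by (auto simp: supp_def int_basis_from_def)
  qed (use few in auto)
  \<comment> \<open>the vectors realising the two affine factors of the monomial \<open>e\<close>; the empty monomial is \<open>1 * 1\<close>\<close>
  define p where "p = (1 / c) *\<^sub>R (e1 + e2)"
  define u where "u e = (if e = {} then (p, 0) else (0, \<xi> (Min e)))" for e
  define u' where "u' e = (if e = {} then (p, 0) else (0, \<xi> (Max e)))" for e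
  have p_short: "B p \<delta> = 1 \<or> B p \<delta> = - 1" if "\<delta> \<in> short0" for \<delta>
    using that c by (auto simp: p_def short0_def form_simps e2e1)
  have p_long: "B p \<gamma> = 2 \<or> B p \<gamma> = 0 \<or> B p \<gamma> = - 2" if "\<gamma> \<in> long0" for \<gamma>
    using that c by (auto simp: p_def long0_def form_simps e2e1)
  have \<xi>_short: "blinfun_apply (\<xi> k) (\<delta> + x + y) = of_int (z x k)"
    if "k \<in> {1..n}" "\<delta> \<in> short0" "x \<in> S1" "y \<in> group_closure S2" for k \<delta> x y
  proof -
    have "\<delta> \<in> Vd" "y \<in> V2" using that finite_part_mem lattice_subset by blast+
    then show ?thesis
      using functional_root[OF \<xi>(1)[OF that(1)]] \<xi>z[OF that(1) S1L[OF that(3)]] by simp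
  qed
  have \<xi>_adm: "admissible (0, \<xi> k)" if k: "k \<in> {1..n}" for k
    unfolding admissible_def
  proof (intro conjI ballI)
    fix \<beta> assume "\<beta> \<in> short_roots"
    then obtain \<delta> x y where "\<beta> = \<delta> + x + y" "\<delta> \<in> short0" "x \<in> S1" "y \<in> group_closure S2"
      by (rule short_rootE)
    then show "ext_form B (0, \<xi> k) (\<beta>, 0) \<in> \<int>"
      using \<xi>_short[OF k] by (simp add: ext_form_def form_simps)
  next
    fix \<beta> assume "\<beta> \<in> long_roots"
    then obtain \<gamma> x y where \<beta>: "\<beta> = \<gamma> + 2 *\<^sub>R x + y" "\<gamma> \<in> long0" "x \<in> group_closure S1" "y \<in> S2"
      by (rule long_rootE)
    have "\<gamma> \<in> Vd" "y \<in> V2" using \<beta> finite_part_mem S2 by blast+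
    then have "blinfun_apply (\<xi> k) \<beta> = 2 * of_int (z x k)"
      unfolding \<beta>(1) using functional_root[OF \<xi>(1)[OF k]] \<xi>z[OF k \<beta>(3)]
      by (simp add: blinfun.scaleR_right)
    then show "even_real (ext_form B (0, \<xi> k) (\<beta>, 0))"
      by (auto simp: ext_form_def form_simps even_real_def)
  qed
  have p_adm: "admissible (p, 0)"
    unfolding admissible_def
  proof (intro conjI ballI)
    fix \<beta> assume "\<beta> \<in> short_roots"
    then obtain \<delta> where "\<delta> \<in> short0" "\<And>v. B v \<beta> = B v \<delta>" by (metis short_rootE)
    then show "ext_form B (p, 0) (\<beta>, 0) \<in> \<int>" using p_short by fastforce
  next
    fix \<beta> assume "\<beta> \<in> long_roots"
    then obtain \<gamma> where "\<gamma> \<in> long0" "\<And>v. B v \<beta> = B v \<gamma>" by (metis long_rootE)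
    then show "even_real (ext_form B (p, 0) (\<beta>, 0))" using p_long[of \<gamma>] even_real_2 by auto
  qed
  have adm: "admissible (u e)" "admissible (u' e)" if "e \<in> small_sets n" for e
    using \<xi>_adm p_adm small_set_cases[OF that] by (auto simp: u_def u'_def)
  have u_ext: "u e \<in> ext_space Vd" if "e \<in> small_sets n" for e
    using small_set_cases[OF that] \<xi>(1) by (auto simp: u_def mem_ext_space_iff)
  have term_parity: "even_real (ext_form B (u e) (\<delta> + x + y, 0) * ext_form B (u' e) (\<delta> + x + y, 0)
      - of_bool (e \<subseteq> J x))"
    if \<beta>: "\<delta> \<in> short0" "x \<in> S1" "y \<in> group_closure S2" and e: "e \<in> small_sets n" for \<delta> x y e
  proof (cases "e = {}")
    case True
    have "\<delta> + x + y \<in> short_roots" using \<beta> unfolding short_roots_def by blast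
    have xy: "x \<in> V1" "y \<in> V2" using \<beta> lattice_subset S1L by blast+
    have "B p (\<delta> + x + y) = B p \<delta>"
      by (simp add: form_simps radical_right(1)[OF xy(1)] radical_right(2)[OF xy(2)])
    then show ?thesis using True p_short[OF \<beta>(1)] by (auto simp: u_def u'_def)
  next
    case False
    note mM = small_set_cases[OF e False]
    have "ext_form B (u e) (\<delta> + x + y, 0) * ext_form B (u' e) (\<delta> + x + y, 0)
        = of_int (z x (Min e) * z x (Max e))"
      using False \<xi>_short[OF mM(1) \<beta>] \<xi>_short[OF mM(2) \<beta>]
      by (simp add: u_def u'_def ext_form_def form_simps)
    moreover have "e \<subseteq> J x \<longleftrightarrow> odd (z x (Min e) * z x (Max e))"
    proof -
      have "e \<subseteq> J x \<longleftrightarrow> Min e \<in> J x \<and> Max e \<in> J x" by (subst mM(3)) simp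
      then show ?thesis using mM(1,2) by (simp add: J_def)
    qed
    ultimately have "ext_form B (u e) (\<delta> + x + y, 0) * ext_form B (u' e) (\<delta> + x + y, 0) - of_bool (e \<subseteq> J x)
        = of_int (z x (Min e) * z x (Max e) - of_bool (odd (z x (Min e) * z x (Max e))))"
      by simp
    also have "even_real \<dots>" unfolding even_real_of_int by simp
    finally show ?thesis .
  qed
  have parity: "even_real (\<Sum>e\<in>small_sets n. of_int (b e) *
      (ext_form B (u e) (\<delta> + x + y, 0) * ext_form B (u' e) (\<delta> + x + y, 0)))
      \<longleftrightarrow> even (quad_eval n b (J x))"
    if \<beta>: "\<delta> \<in> short0" "x \<in> S1" "y \<in> group_closure S2" for \<delta> x y
  proof -
    have "even_real (\<Sum>e\<in>small_sets n. (ext_form B (u e) (\<delta> + x + y, 0) * ext_form B (u' e) (\<delta> + x + y, 0)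
        - of_bool (e \<subseteq> J x)) * of_int (b e))"
      by (intro even_real_sum even_real_mult term_parity \<beta>) simp_all
    also have "(\<Sum>e\<in>small_sets n. (ext_form B (u e) (\<delta> + x + y, 0) * ext_form B (u' e) (\<delta> + x + y, 0)
        - of_bool (e \<subseteq> J x)) * of_int (b e))
      = (\<Sum>e\<in>small_sets n. of_int (b e) *
          (ext_form B (u e) (\<delta> + x + y, 0) * ext_form B (u' e) (\<delta> + x + y, 0)))
        - of_int (quad_eval n b (J x))"
      unfolding quad_eval_def of_int_sum sum_subtractf[symmetric]
      by (rule sum.cong) (simp_all add: algebra_simps)
    finally show ?thesis
      by (rule even_real_cong[THEN trans]) simp
  qed
  obtain \<beta>s where \<beta>s: "set \<beta>s \<subseteq> short_roots \<union> long_roots - refl_orbit B Vd (short_roots \<union> long_roots) \<alpha>"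
    "\<And>u. u \<in> ext_space Vd \<Longrightarrow> refl_word B \<beta>s u = refl_map B \<alpha> u"
    using removable_imp_word[OF nonisotropic_roots rem] \<alpha> by blast
  have "even_real (\<Sum>e\<in>small_sets n. of_int (b e) *
      (c / 2 * (ext_form B (refl_word B \<beta>s (u e)) (u' e) - ext_form B (u e) (u' e))))"
  proof (rule quadratic_character_even[OF adm])
    show "set \<beta>s \<subseteq> short_roots \<union> long_roots" using \<beta>s(1) by blast
    fix \<gamma> assume \<gamma>: "\<gamma> \<in> set \<beta>s" "\<gamma> \<in> short_roots"
    obtain \<delta> x y where xy: "\<gamma> = \<delta> + x + y" "\<delta> \<in> short0" "x \<in> S1" "y \<in> group_closure S2"
      using \<gamma>(2) by (rule short_rootE)
    have "J x \<noteq> J x0"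
    proof
      assume J: "J x = J x0"
      define m where "m = (\<Sum>r\<in>{1..n}. of_int ((z x r - z x0 r) div 2) *\<^sub>R \<sigma> r)"
      have "m \<in> group_closure S1" unfolding m_def by (rule int_basis_sum_mem[OF \<sigma>])
      have "x - x0 = (\<Sum>r\<in>{1..n}. of_int (z x r) *\<^sub>R \<sigma> r) - (\<Sum>r\<in>{1..n}. of_int (z x0 r) *\<^sub>R \<sigma> r)"
        using z[OF S1L[OF xy(3)]] z[OF S1L[OF \<alpha>0(3)]] by simp
      also have "\<dots> = 2 *\<^sub>R m"
        unfolding m_def scaleR_sum_right sum_subtractf[symmetric]
      proof (rule sum.cong)
        fix r assume "r \<in> {1..n}"
        then have "odd (z x r) \<longleftrightarrow> odd (z x0 r)" using J unfolding J_def by blast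
        then have "z x r - z x0 r = 2 * ((z x r - z x0 r) div 2)" by presburger
        then have "real_of_int (z x r) - of_int (z x0 r) = 2 * of_int ((z x r - z x0 r) div 2)"
          by (metis of_int_diff of_int_mult of_int_numeral)
        then show "of_int (z x r) *\<^sub>R \<sigma> r - of_int (z x0 r) *\<^sub>R \<sigma> r
            = 2 *\<^sub>R of_int ((z x r - z x0 r) div 2) *\<^sub>R \<sigma> r"
          by (simp only: scaleR_left_diff_distrib[symmetric] scaleR_scaleR)
      qed simp
      finally have "x = x0 + 2 *\<^sub>R m" by (simp add: algebra_simps)
      then have "linked \<alpha> \<gamma>"
        using short_orbit_contains[OF \<alpha>0(2) xy(2) \<alpha>0(3) \<open>m \<in> group_closure S1\<close> \<alpha>0(4) xy(4)]
        by (simp add: \<alpha>0(1) xy(1))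
      then show False using \<beta>s(1) \<gamma>(1) linked_iff_orbit by blast
    qed
    then have "even (quad_eval n b (J x))" using b[OF Jsupp[OF xy(3)]] by blast
    then show "even_real (\<Sum>e\<in>small_sets n. of_int (b e) * (ext_form B (u e) (\<gamma>, 0) * ext_form B (u' e) (\<gamma>, 0)))"
      using parity[OF xy(2-4)] xy(1) by simp
  qed
  also have "(\<Sum>e\<in>small_sets n. of_int (b e) *
      (c / 2 * (ext_form B (refl_word B \<beta>s (u e)) (u' e) - ext_form B (u e) (u' e))))
    = - (\<Sum>e\<in>small_sets n. of_int (b e) * (ext_form B (u e) (\<alpha>, 0) * ext_form B (u' e) (\<alpha>, 0)))"
    unfolding sum_negf[symmetric]
    by (rule sum.cong) (use c(1) in \<open>simp_all add: \<beta>s(2) u_ext ext_form_refl_map norm_short[OF \<alpha>]\<close>)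
  finally have "even_real (\<Sum>e\<in>small_sets n. of_int (b e) * (ext_form B (u e) (\<alpha>, 0) * ext_form B (u' e) (\<alpha>, 0)))"
    using even_real_minus by fastforce
  then have "even (quad_eval n b (J x0))" using parity[OF \<alpha>0(2-4)] \<alpha>0(1) by simp
  then show False using b[OF Jsupp[OF \<alpha>0(3)]] by blast
qed

text \<open>
  Roots in the orbit of \<open>e1\<close> have even coordinates. Such a root is one corner of a cube of short roots with edges
  \<open>\<sigma> 1\<close>, \<open>\<sigma> 2\<close>, \<open>\<sigma> 3\<close>, all of which are roots because \<open>S1\<close> is the full lattice. The other seven corners
  have an odd coordinate, so they lie outside the orbit, and their reflections generate the one in the given root.
\<close>

lemma short_removable:
  assumes \<sigma>: "int_basis_from S1 3 \<sigma>" and full: "supp S1 3 \<sigma> = Pow {1..3}"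
  shows "e1 \<in> short_roots" "removable B Vd (short_roots \<union> long_roots) e1"
proof -
  have "e1 + 0 + 0 \<in> short_roots"
    unfolding short_roots_def using semilattice_zero[OF S1] zero_in_group_closure[of S2]
    by (intro CollectI exI[of _ e1] exI[of _ 0]) (simp add: short0_def)
  then show e1Sh: "e1 \<in> short_roots" by simp
  obtain \<xi> :: "nat \<Rightarrow> 'v \<Rightarrow>\<^sub>L real"
    where \<xi>: "\<And>k x. k \<in> {1..3} \<Longrightarrow> x \<in> Vd \<union> V2 \<Longrightarrow> blinfun_apply (\<xi> k) x = 0"
      "\<And>k j. k \<in> {1..3} \<Longrightarrow> j \<in> {1..3} \<Longrightarrow> blinfun_apply (\<xi> k) (\<sigma> j) = of_bool (j = k)"
    by (rule dual_functionals[OF \<sigma>]) (rule that; blast)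
  obtain z :: "'v \<Rightarrow> nat \<Rightarrow> int"
    where z: "\<And>x. x \<in> group_closure S1 \<Longrightarrow> (\<Sum>r\<in>{1..3}. of_int (z x r) *\<^sub>R \<sigma> r) = x"
    by (rule int_basis_coordinates[OF \<sigma>]) (rule that; simp)
  have \<xi>z: "blinfun_apply (\<xi> k) x = of_int (z x k)" if "k \<in> {1..3}" "x \<in> group_closure S1" for k x
    using functional_coordinate[of 3 "\<xi> k" \<sigma> k "z x"] \<xi>(2) that z[OF that(2)] by simp
  have LS: "x \<in> S1" if "x \<in> group_closure S1" for x
  proof -
    have "{r\<in>{1..3}. odd (z x r)} \<in> supp S1 3 \<sigma>" unfolding full by blast
    then show ?thesis using int_basis_mem_iff[OF S1 \<sigma>, of "z x"] z[OF that] by simp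
  qed
  have S1L: "x \<in> group_closure S1" if "x \<in> S1" for x
    using that group_closure_superset by blast
  have \<xi>_short: "blinfun_apply (\<xi> k) \<beta> \<in> \<int>" if k: "k \<in> {1..3}" and root: "\<beta> \<in> short_roots" for k \<beta>
  proof -
    obtain \<delta> x y where \<beta>: "\<beta> = \<delta> + x + y" "\<delta> \<in> short0" "x \<in> S1" "y \<in> group_closure S2"
      using root by (rule short_rootE)
    have "\<delta> \<in> Vd" "y \<in> V2" using \<beta> finite_part_mem lattice_subset by blast+
    then have "blinfun_apply (\<xi> k) \<beta> = of_int (z x k)"
      unfolding \<beta>(1) using functional_root[OF \<xi>(1)[OF k]] \<xi>z[OF k S1L[OF \<beta>(3)]] by simp
    then show ?thesis by simp
  qed
  have \<xi>_long: "even_real (blinfun_apply (\<xi> k) \<beta>)" if k: "k \<in> {1..3}" and root: "\<beta> \<in> long_roots" for k \<beta>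
  proof -
    obtain \<gamma> x y where \<beta>: "\<beta> = \<gamma> + 2 *\<^sub>R x + y" "\<gamma> \<in> long0" "x \<in> group_closure S1" "y \<in> S2"
      using root by (rule long_rootE)
    have "\<gamma> \<in> Vd" "y \<in> V2" using \<beta> finite_part_mem S2 by blast+
    then have "blinfun_apply (\<xi> k) \<beta> = 2 * of_int (z x k)"
      unfolding \<beta>(1) using functional_root[OF \<xi>(1)[OF k]] \<xi>z[OF k \<beta>(3)]
      by (simp add: blinfun.scaleR_right)
    then show ?thesis by (simp add: even_real_double)
  qed
  \<comment> \<open>integrality of the pairings is carried along, since it makes the coefficient of a reflection integral, and even for short roots\<close>
  have orbit: "(\<forall>\<beta>\<in>short_roots \<union> long_roots. B v \<beta> / c \<in> \<int>) \<and> (\<forall>k\<in>{1..3}. even_real (blinfun_apply (\<xi> k) v))"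
    if "set \<gamma>s \<subseteq> short_roots \<union> long_roots" "refl_word B \<gamma>s (e1, 0) = (v, 0)" for \<gamma>s v
    using that
  proof (induction \<gamma>s arbitrary: v)
    case Nil
    then have "v = e1" by simp
    then show ?case
      using form_Ints[OF _ UnI1[OF e1Sh]] \<xi>(1) eVd by simp
  next
    case (Cons \<gamma> \<gamma>s)
    obtain w where w: "refl_word B \<gamma>s (e1, 0) = (w, 0)"
      using snd_refl_word[of \<gamma>s "(e1, 0)"] by (metis prod.collapse snd_conv)
    define m where "m = 2 / B \<gamma> \<gamma> * B w \<gamma>"
    have v: "v = w - m *\<^sub>R \<gamma>"
      using Cons.prems(2) by (simp add: w refl_map_Pair m_def)
    have \<gamma>: "\<gamma> \<in> short_roots \<union> long_roots" using Cons.prems by simp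
    have IH: "\<forall>\<beta>\<in>short_roots \<union> long_roots. B w \<beta> / c \<in> \<int>" "\<forall>k\<in>{1..3}. even_real (blinfun_apply (\<xi> k) w)"
      using Cons.IH[OF _ w] Cons.prems by auto
    have m: "m \<in> \<int>" "\<gamma> \<in> short_roots \<Longrightarrow> even_real m"
    proof -
      have sh: "even_real m" if "\<gamma> \<in> short_roots"
        using even_real_double[of "B w \<gamma> / c"] IH(1) that norm_short[OF that] by (simp add: m_def)
      moreover have "m \<in> \<int>" if "\<gamma> \<in> long_roots"
        using IH(1) that norm_long[OF that] by (simp add: m_def)
      ultimately show "m \<in> \<int>" "\<gamma> \<in> short_roots \<Longrightarrow> even_real m" using \<gamma> even_real_Ints by blast+
    qed
    have "B v \<beta> / c \<in> \<int>" if "\<beta> \<in> short_roots \<union> long_roots" for \<beta>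
    proof -
      have "B v \<beta> / c = B w \<beta> / c - m * (B \<gamma> \<beta> / c)"
        by (simp add: v form_simps diff_divide_distrib)
      also have "\<dots> \<in> \<int>"
        by (intro Ints_diff Ints_mult m(1) form_Ints[OF that \<gamma>] IH(1)[rule_format, OF that])
      finally show ?thesis .
    qed
    moreover have "even_real (blinfun_apply (\<xi> k) v)" if k: "k \<in> {1..3}" for k
    proof -
      have "even_real (m * blinfun_apply (\<xi> k) \<gamma>)"
      proof (cases "\<gamma> \<in> short_roots")
        case True
        then show ?thesis using even_real_mult m(2) \<xi>_short[OF k True] by blast
      next
        case False
        then show ?thesis using even_real_mult[OF \<xi>_long[OF k] m(1)] \<gamma> by (metis UnE mult.commute)
      qed
      then show ?thesis
        using IH(2) k unfolding v blinfun.diff_right blinfun.scaleR_right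
        by (simp add: even_real_diff)
    qed
    ultimately show ?case by blast
  qed
  have orbit_even: "even_real (blinfun_apply (\<xi> k) v)"
    if "v \<in> refl_orbit B Vd (short_roots \<union> long_roots) e1" "k \<in> {1..3}" for v k
    using that orbit unfolding linked_iff_orbit[symmetric] linked_def by blast
  show "removable B Vd (short_roots \<union> long_roots) e1"
  proof (rule removableI_words[OF nonisotropic_roots])
    fix \<beta> assume \<beta>: "\<beta> \<in> refl_orbit B Vd (short_roots \<union> long_roots) e1" "\<beta> \<in> short_roots \<union> long_roots"
    have "B \<beta> \<beta> = c"
      using refl_orbit_norm[OF nonisotropic_roots \<beta>(1)] c(2) by simp
    then have "\<beta> \<notin> long_roots" using norm_long[of \<beta>] c(1) by auto
    then have "\<beta> \<in> short_roots" using \<beta>(2) by blast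
    then obtain \<delta> x y where xy: "\<beta> = \<delta> + x + y" "\<delta> \<in> short0" "x \<in> S1" "y \<in> group_closure S2"
      by (rule short_rootE)
    \<comment> \<open>\<open>\<alpha>\<close> is the corner opposite to \<open>\<beta>\<close>\<close>
    define s where "s = \<sigma> 1 + \<sigma> 2 + \<sigma> 3"
    define \<alpha> where "\<alpha> = \<delta> + (x - s) + y"
    have \<sigma>L: "\<sigma> 1 \<in> group_closure S1" "\<sigma> 2 \<in> group_closure S1" "\<sigma> 3 \<in> group_closure S1"
    proof -
      have "\<sigma> ` {1..3} \<subseteq> S1" using \<sigma> unfolding int_basis_from_def by (rule conjunct1)
      then have "\<sigma> k \<in> group_closure S1" if "k \<in> {1..3}" for k using S1L that by blast
      then show "\<sigma> 1 \<in> group_closure S1" "\<sigma> 2 \<in> group_closure S1" "\<sigma> 3 \<in> group_closure S1"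
        by simp_all
    qed
    have \<sigma>V: "B v (\<sigma> 1) = 0" "B v (\<sigma> 2) = 0" "B v (\<sigma> 3) = 0" for v
      using \<sigma>L lattice_subset(1) radical_right(1) by blast+
    have sL: "s \<in> group_closure S1"
      unfolding s_def by (intro group_closure_add \<sigma>L)
    \<comment> \<open>a corner of the cube other than \<open>\<beta>\<close> misses some \<open>\<sigma> k\<close>, hence has odd \<open>k\<close>-th coordinate\<close>
    have corner: "\<alpha> + t \<in> short_roots \<union> long_roots - refl_orbit B Vd (short_roots \<union> long_roots) e1"
      if t: "t \<in> group_closure S1" and k: "k \<in> {1..3}" "blinfun_apply (\<xi> k) t = 0" for t k
    proof -
      have eq: "\<alpha> + t = \<delta> + (x - s + t) + y" by (simp add: \<alpha>_def algebra_simps)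
      have "x - s + t \<in> S1"
        by (rule LS[OF group_closure_add[OF group_closure.diff[OF S1L[OF xy(3)] sL] t]])
      then have "\<alpha> + t \<in> short_roots" unfolding eq short_roots_def using xy by blast
      moreover have "\<not> even_real (blinfun_apply (\<xi> k) (\<alpha> + t))"
      proof
        assume "even_real (blinfun_apply (\<xi> k) (\<alpha> + t))"
        moreover have "\<alpha> + t = \<beta> - s + t" by (simp add: \<alpha>_def xy algebra_simps)
        moreover have "blinfun_apply (\<xi> k) s = 1"
          using k(1) unfolding s_def blinfun.add_right
          by (subst (1 2 3) \<xi>(2)) (auto simp: of_bool_def)
        ultimately have "even_real (blinfun_apply (\<xi> k) \<beta> - 1)"
          using k(2) by (simp add: blinfun.add_right blinfun.diff_right)
        from even_real_diff[OF orbit_even[OF \<beta>(1) k(1)] this] have "even_real 1" by simp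
        then show False using even_real_of_int[of 1] by simp
      qed
      then have "\<alpha> + t \<notin> refl_orbit B Vd (short_roots \<union> long_roots) e1" using orbit_even k(1) by blast
      ultimately show ?thesis by blast
    qed
    have \<alpha>_short: "\<alpha> \<in> short_roots"
      using LS[OF group_closure.diff[OF S1L[OF xy(3)] sL]] xy unfolding \<alpha>_def short_roots_def by blast
    have "B \<alpha> \<alpha> \<noteq> 0" using norm_short[OF \<alpha>_short] c(1) by simp
    note cube = cube_relation[OF this \<sigma>V]
    have "\<alpha> + (\<sigma> 1 + \<sigma> 2 + \<sigma> 3) = \<beta>" by (simp add: \<alpha>_def s_def xy)
    then have "refl_word B [\<alpha> + (\<sigma> 1 + \<sigma> 2), \<alpha> + \<sigma> 1, \<alpha> + (\<sigma> 1 + \<sigma> 3), \<alpha> + \<sigma> 2,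
        \<alpha> + (\<sigma> 2 + \<sigma> 3), \<alpha> + \<sigma> 3, \<alpha> + 0] = refl_map B \<beta>"
      using cube by simp
    moreover have "set [\<alpha> + (\<sigma> 1 + \<sigma> 2), \<alpha> + \<sigma> 1, \<alpha> + (\<sigma> 1 + \<sigma> 3), \<alpha> + \<sigma> 2,
        \<alpha> + (\<sigma> 2 + \<sigma> 3), \<alpha> + \<sigma> 3, \<alpha> + 0] \<subseteq> short_roots \<union> long_roots - refl_orbit B Vd (short_roots \<union> long_roots) e1"
    proof -
      have "blinfun_apply (\<xi> 3) (\<sigma> 1 + \<sigma> 2) = 0" "blinfun_apply (\<xi> 2) (\<sigma> 1) = 0"
        "blinfun_apply (\<xi> 2) (\<sigma> 1 + \<sigma> 3) = 0" "blinfun_apply (\<xi> 1) (\<sigma> 2) = 0"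
        "blinfun_apply (\<xi> 1) (\<sigma> 2 + \<sigma> 3) = 0" "blinfun_apply (\<xi> 1) (\<sigma> 3) = 0"
        "blinfun_apply (\<xi> 1) 0 = 0"
        by (simp_all add: blinfun.add_right \<xi>(2))
      then have "\<alpha> + (\<sigma> 1 + \<sigma> 2) \<in> short_roots \<union> long_roots - refl_orbit B Vd (short_roots \<union> long_roots) e1"
        "\<alpha> + \<sigma> 1 \<in> short_roots \<union> long_roots - refl_orbit B Vd (short_roots \<union> long_roots) e1"
        "\<alpha> + (\<sigma> 1 + \<sigma> 3) \<in> short_roots \<union> long_roots - refl_orbit B Vd (short_roots \<union> long_roots) e1"
        "\<alpha> + \<sigma> 2 \<in> short_roots \<union> long_roots - refl_orbit B Vd (short_roots \<union> long_roots) e1"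
        "\<alpha> + (\<sigma> 2 + \<sigma> 3) \<in> short_roots \<union> long_roots - refl_orbit B Vd (short_roots \<union> long_roots) e1"
        "\<alpha> + \<sigma> 3 \<in> short_roots \<union> long_roots - refl_orbit B Vd (short_roots \<union> long_roots) e1"
        "\<alpha> + 0 \<in> short_roots \<union> long_roots - refl_orbit B Vd (short_roots \<union> long_roots) e1"
        using corner[of "\<sigma> 1 + \<sigma> 2" 3] corner[of "\<sigma> 1" 2] corner[of "\<sigma> 1 + \<sigma> 3" 2]
          corner[of "\<sigma> 2" 1] corner[of "\<sigma> 2 + \<sigma> 3" 1] corner[of "\<sigma> 3" 1] corner[of 0 1]
          \<sigma>L group_closure_add by auto
      then show ?thesis unfolding list.set by blast
    qed
    ultimately show "\<exists>\<beta>s. set \<beta>s \<subseteq> short_roots \<union> long_roots - refl_orbit B Vd (short_roots \<union> long_roots) e1 \<and> refl_word B \<beta>s = refl_map B \<beta>"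
      by blast
  qed
qed

end

section \<open>Duality between short and long roots\<close>

lemma group_closure_scaleR:
  fixes S :: "'v::real_vector set"
  shows "group_closure ((\<lambda>x. k *\<^sub>R x) ` S) = (\<lambda>x. k *\<^sub>R x) ` group_closure S"
proof
  show "group_closure ((\<lambda>x. k *\<^sub>R x) ` S) \<subseteq> (\<lambda>x. k *\<^sub>R x) ` group_closure S"
  proof (rule group_closure_subset_subgroup)
    show "0 \<in> (\<lambda>x. k *\<^sub>R x) ` group_closure S"
      by (rule image_eqI[of _ _ 0]) simp_all
    fix x y assume "x \<in> (\<lambda>x. k *\<^sub>R x) ` group_closure S" "y \<in> (\<lambda>x. k *\<^sub>R x) ` group_closure S"
    then obtain a b where "x = k *\<^sub>R a" "y = k *\<^sub>R b" "a \<in> group_closure S" "b \<in> group_closure S"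
      by blast
    then show "x - y \<in> (\<lambda>x. k *\<^sub>R x) ` group_closure S"
      by (intro image_eqI[of _ _ "a - b"]) (simp_all add: scaleR_right_diff_distrib group_closure.diff)
  qed (use group_closure_superset in blast)
  show "(\<lambda>x. k *\<^sub>R x) ` group_closure S \<subseteq> group_closure ((\<lambda>x. k *\<^sub>R x) ` S)"
  proof clarify
    fix x assume "x \<in> group_closure S"
    then show "k *\<^sub>R x \<in> group_closure ((\<lambda>x. k *\<^sub>R x) ` S)"
    proof induction
      case (base s)
      then show ?case by (auto intro: group_closure.base)
    next
      case (diff s t)
      then show ?case by (simp add: scaleR_right_diff_distrib group_closure.diff)
    qed
  qed
qed

context b2_roots
begin

text \<open>
  The map with \<open>e1 \<mapsto> e1 + e2\<close> and \<open>e2 \<mapsto> e1 - e2\<close> is a similarity that turns short roots into long ones and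
  long roots into doubles of short ones. Accordingly the dual system is built on \<open>S2\<close> and \<open>2 S1\<close>.
\<close>

lemma dual_b2_roots:
  assumes "semilattice_in V2 S2"
  shows "b2_roots B Vd V2 V1 (2 * c) (e1 + e2) (e1 - e2) S2 ((\<lambda>x. 2 *\<^sub>R x) ` S1)"
proof
  show "2 * c > 0" "B (e1 + e2) (e1 + e2) = 2 * c" "B (e1 - e2) (e1 - e2) = 2 * c"
    "B (e1 + e2) (e1 - e2) = 0"
    using c e2e1 by (simp_all add: form_simps)
  show "e1 + e2 \<in> Vd" "e1 - e2 \<in> Vd"
    using eVd subspaces(1) by (auto intro: subspace_add subspace_diff)
  show "y = 0 \<and> x = 0" if "d \<in> Vd" "y \<in> V2" "x \<in> V1" "d + y + x = 0" for d x y
    using direct[OF that(1,3,2)] that(4) by (simp add: add.assoc add.commute add.left_commute)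
  show "(\<lambda>x. 2 *\<^sub>R x) ` S1 \<subseteq> V1"
    using lattice_subset(1) group_closure_superset[of S1] subspaces(2) by (auto intro: subspace_scale)
  show "0 \<in> (\<lambda>x. 2 *\<^sub>R x) ` S1"
    using semilattice_zero[OF S1] by force
qed (use assms subspaces radical in auto)

lemma dual_root_sets:
  assumes S2': "semilattice_in V2 S2"
  shows "b2_roots.short_roots (e1 + e2) (e1 - e2) S2 ((\<lambda>x. 2 *\<^sub>R x) ` S1) = long_roots"
    "b2_roots.long_roots (e1 + e2) (e1 - e2) S2 ((\<lambda>x. 2 *\<^sub>R x) ` S1) = (\<lambda>x. 2 *\<^sub>R x) ` short_roots"
proof -
  interpret D: b2_roots B Vd V2 V1 "2 * c" "e1 + e2" "e1 - e2" S2 "(\<lambda>x. 2 *\<^sub>R x) ` S1"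
    by (rule dual_b2_roots[OF S2'])
  have short: "D.short0 = long0"
    unfolding D.short0_def long0_def by auto
  have long: "D.long0 = (\<lambda>x. 2 *\<^sub>R x) ` short0"
    unfolding D.long0_def short0_def by (auto simp: scaleR_2)
  show "D.short_roots = long_roots"
  proof (intro equalityI subsetI)
    fix w assume "w \<in> D.short_roots"
    then obtain \<gamma> x y where *: "w = \<gamma> + y + 2 *\<^sub>R x" "\<gamma> \<in> long0" "x \<in> group_closure S1" "y \<in> S2"
      unfolding D.short_roots_def short group_closure_scaleR by blast
    have "w = \<gamma> + 2 *\<^sub>R x + y" by (simp add: *(1) algebra_simps)
    then show "w \<in> long_roots" unfolding long_roots_def using * by blast
  next
    fix w assume "w \<in> long_roots"
    then obtain \<gamma> x y where *: "w = \<gamma> + 2 *\<^sub>R x + y" "\<gamma> \<in> long0" "x \<in> group_closure S1" "y \<in> S2"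
      unfolding long_roots_def by blast
    have "w = \<gamma> + y + 2 *\<^sub>R x" by (simp add: *(1) algebra_simps)
    then show "w \<in> D.short_roots" unfolding D.short_roots_def short group_closure_scaleR using * by blast
  qed
  show "D.long_roots = (\<lambda>x. 2 *\<^sub>R x) ` short_roots"
  proof (intro equalityI subsetI)
    fix w assume "w \<in> D.long_roots"
    then obtain \<delta> x y where "w = 2 *\<^sub>R \<delta> + 2 *\<^sub>R y + 2 *\<^sub>R x" "\<delta> \<in> short0" "x \<in> S1" "y \<in> group_closure S2"
      unfolding D.long_roots_def long by blast
    then show "w \<in> (\<lambda>x. 2 *\<^sub>R x) ` short_roots"
      unfolding short_roots_def by (intro image_eqI[of _ _ "\<delta> + x + y"]) (auto simp: scaleR_right_distrib)
  next
    fix w assume "w \<in> (\<lambda>x. 2 *\<^sub>R x) ` short_roots"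
    then obtain \<delta> x y where *: "w = 2 *\<^sub>R (\<delta> + x + y)" "\<delta> \<in> short0" "x \<in> S1" "y \<in> group_closure S2"
      unfolding short_roots_def by blast
    have "w = 2 *\<^sub>R \<delta> + 2 *\<^sub>R y + 2 *\<^sub>R x" by (simp add: *(1) algebra_simps)
    then show "w \<in> D.long_roots" unfolding D.long_roots_def long using * by blast
  qed
qed

lemma removable_dual:
  assumes "\<alpha> \<in> long_roots"
  shows "removable B Vd (long_roots \<union> (\<lambda>x. 2 *\<^sub>R x) ` short_roots) \<alpha> \<longleftrightarrow> removable B Vd (short_roots \<union> long_roots) \<alpha>"
  using removable_rescale[of long_roots "2 * c" short_roots c \<alpha> Vd] norm_long norm_short c(1) assms
  by (simp add: Un_commute)

lemma long_not_removable:
  assumes S2': "semilattice_in V2 S2"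
    and "int_basis_from S2 n \<sigma>" "card (supp S2 n \<sigma>) \<le> n + 4" "\<alpha> \<in> long_roots"
  shows "\<not> removable B Vd (short_roots \<union> long_roots) \<alpha>"
proof -
  interpret D: b2_roots B Vd V2 V1 "2 * c" "e1 + e2" "e1 - e2" S2 "(\<lambda>x. 2 *\<^sub>R x) ` S1"
    by (rule dual_b2_roots[OF S2'])
  show ?thesis
    using D.short_not_removable[of n \<sigma> \<alpha>] assms removable_dual by (simp add: dual_root_sets[OF S2'])
qed

lemma long_removable:
  assumes S2': "semilattice_in V2 S2"
    and "int_basis_from S2 3 \<sigma>" "supp S2 3 \<sigma> = Pow {1..3}"
  shows "\<exists>\<alpha>\<in>long_roots. removable B Vd (short_roots \<union> long_roots) \<alpha>"
proof -
  interpret D: b2_roots B Vd V2 V1 "2 * c" "e1 + e2" "e1 - e2" S2 "(\<lambda>x. 2 *\<^sub>R x) ` S1"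
    by (rule dual_b2_roots[OF S2'])
  show ?thesis
    using D.short_removable[OF assms(2,3)] removable_dual unfolding dual_root_sets[OF S2'] by blast
qed

end

section \<open>Minimality\<close>

text \<open>
  Index 7 means eight cosets, and a lattice of rank at most three has eight cosets modulo two only if the rank
  is three, in which case they all belong to \<open>S\<close>.
\<close>

lemma full_support_of_ind_7:
  assumes S: "semilattice_in U S" and dim: "dim U \<le> 3" and "ind S = 7"
  obtains \<sigma> where "int_basis_from S 3 \<sigma>" "supp S 3 \<sigma> = Pow {1..3}"
proof -
  obtain \<sigma> where \<sigma>: "int_basis_from S (dim U) \<sigma>" "ind S + 1 = card (supp S (dim U) \<sigma>)"
    by (rule ind_eq_card_supp[OF S])
  have sub: "supp S (dim U) \<sigma> \<subseteq> Pow {1..dim U}" by (auto simp: supp_def)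
  have "card (supp S (dim U) \<sigma>) = 8" using \<sigma>(2) \<open>ind S = 7\<close> by simp
  moreover have "card (supp S (dim U) \<sigma>) \<le> 2 ^ dim U"
    using card_mono[OF _ sub] by (simp add: card_Pow)
  ultimately have "(2::nat) ^ 3 \<le> 2 ^ dim U" by simp
  then have "3 \<le> dim U" by (rule power_le_imp_le_exp[rotated]) simp
  then have "dim U = 3" using dim by simp
  moreover from this have "supp S 3 \<sigma> = Pow {1..3}"
    using sub \<open>card (supp S (dim U) \<sigma>) = 8\<close> by (intro card_subset_eq) (simp_all add: card_Pow)
  ultimately show thesis using that[of \<sigma>] \<sigma>(1) by simp
qed

lemma ind_bound_rank_3:
  assumes S: "semilattice_in U S" and dim: "dim U \<le> 3" and "ind S \<noteq> 7"
  shows "ind S \<le> dim U + 3"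
proof -
  obtain \<sigma> where \<sigma>: "int_basis_from S (dim U) \<sigma>" "ind S + 1 = card (supp S (dim U) \<sigma>)"
    by (rule ind_eq_card_supp[OF S])
  have sub: "supp S (dim U) \<sigma> \<subseteq> Pow {1..dim U}" by (auto simp: supp_def)
  have le: "ind S + 1 \<le> 2 ^ dim U"
    using card_mono[OF _ sub] \<sigma>(2) by (simp add: card_Pow)
  have "k \<le> d + 3" if "k + 1 \<le> 2 ^ d" "d \<le> 3" "k \<noteq> 7" for k d :: nat
  proof -
    have "d = 0 \<or> d = 1 \<or> d = 2 \<or> d = 3" using \<open>d \<le> 3\<close> by linarith
    then show ?thesis using that by auto
  qed
  then show ?thesis using le dim \<open>ind S \<noteq> 7\<close> by blast
qed

lemma set_plus_three:
  fixes A C D :: "'a::semigroup_add set"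
  shows "A + (C + D) = {a + x + y | a x y. a \<in> A \<and> x \<in> C \<and> y \<in> D}"
proof (intro equalityI subsetI)
  fix w assume "w \<in> A + (C + D)"
  then obtain a x y where "w = a + (x + y)" "a \<in> A" "x \<in> C" "y \<in> D"
    by (metis set_plus_elim)
  then show "w \<in> {a + x + y | a x y. a \<in> A \<and> x \<in> C \<and> y \<in> D}"
    unfolding add.assoc[symmetric] by blast
next
  fix w assume "w \<in> {a + x + y | a x y. a \<in> A \<and> x \<in> C \<and> y \<in> D}"
  then obtain a x y where "w = a + (x + y)" "a \<in> A" "x \<in> C" "y \<in> D"
    unfolding add.assoc by blast
  then show "w \<in> A + (C + D)" using set_plus_intro by blast
qed

theorem corollary36:
  fixes B :: "'v::euclidean_space \<Rightarrow> 'v \<Rightarrow> real"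
    and Vd V0 V1 V2 Rsh Rlg S1 S2 R :: "'v set"
    and \<nu> t :: nat
  assumes "bilinear B"
    and "\<And>x y. B x y = B y x"
    and "\<And>x. B x x \<ge> 0"
    and "V0 = {x. \<forall>y. B x y = 0}"
    and "direct_sum UNIV Vd V0"
    and "direct_sum V0 V1 V2"
    and "t \<le> \<nu>"
    and "dim V1 = t"
    and "dim V2 = \<nu> - t"
    and "finite_root_system_B2 B Vd Rsh Rlg"
    and "semilattice_in V1 S1"
    and "semilattice_in V2 S2"
    and "R = ears_B2 Rsh Rlg S1 S2"
  shows "((int (ind S1) - int t \<le> 3 \<and> int (ind S2) - (int \<nu> - int t) \<le> 3)
             \<or> (int t \<le> 3 \<and> int \<nu> - int t \<le> 3 \<and> ind S1 \<noteq> 7 \<and> ind S2 \<noteq> 7)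
            \<longrightarrow> minimal_ears B Vd R)
         \<and> (int \<nu> - int t \<le> 3 \<and> int t \<le> 3
            \<longrightarrow> (minimal_ears B Vd R \<longleftrightarrow> ind S1 \<noteq> 7 \<and> ind S2 \<noteq> 7))"
proof -
  obtain e1 e2 where e: "B e1 e1 > 0" "B e2 e2 = B e1 e1" "B e1 e2 = 0"
    "Rsh = {e1, - e1, e2, - e2}" "Rlg = {e1 + e2, e1 - e2, - e1 + e2, - e1 - e2}"
    and Vd: "span (Rsh \<union> Rlg) = Vd"
    using assms(10) unfolding finite_root_system_B2_def by blast
  have sub: "subspace Vd" "subspace V1" "subspace V2" and V12: "V1 \<inter> V2 = {0}" "V0 = V1 + V2"
    and Vd0: "Vd \<inter> V0 = {0}" and V0: "subspace V0"
    using assms(5,6) by (auto simp: direct_sum_def)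
  have V1V0: "x \<in> V0" if "x \<in> V1 \<or> x \<in> V2" for x
    using that set_plus_intro[of x V1 0 V2] set_plus_intro[of 0 V1 x V2] sub V12(2)
    by (auto simp: subspace_0)
  have rad: "B v x = 0" if "x \<in> V0" for v x
    using that assms(2)[of v x] by (simp add: assms(4))
  interpret b2_roots B Vd V1 V2 "B e1 e1" e1 e2 S1 S2
  proof
    show "e1 \<in> Vd" "e2 \<in> Vd" unfolding Vd[symmetric] e(4) by (auto intro: span_base)
    show "B v x = 0" if "x \<in> V1 \<union> V2" for v x using that V1V0 rad by blast
    show "x = 0 \<and> y = 0" if xy: "d \<in> Vd" "x \<in> V1" "y \<in> V2" "d + x + y = 0" for d x y
    proof -
      have "x + y \<in> V0" using xy V12(2) set_plus_intro by blast
      moreover have "d = - (x + y)" using xy(4) by (simp add: add.assoc add_eq_0_iff2)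
      ultimately have "d \<in> Vd \<inter> V0" using xy(1) V0 by (metis IntI subspace_neg)
      then have "d = 0" using Vd0 by blast
      then have "x = - y" using xy(4) by (simp add: add_eq_0_iff2)
      then have "x \<in> V1 \<inter> V2" using xy sub by (metis IntI subspace_neg)
      then have "x = 0" using V12(1) by blast
      then show ?thesis using \<open>x = - y\<close> by simp
    qed
  qed (use assms(1,2,11,12) e sub semilattice_zero in \<open>auto simp: semilattice_in_def\<close>)
  have RS: "Rsh = short0" "Rlg = long0" by (simp_all add: e short0_def long0_def)
  have Q: "nonisotropic B R = short_roots \<union> long_roots"
  proof -
    have Rsh: "Rsh + (S1 + group_closure S2) = short_roots"
      unfolding RS short_roots_def set_plus_three ..
    have Rlg: "Rlg + ((\<lambda>x. 2 *\<^sub>R x) ` group_closure S1 + S2) = long_roots"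
      unfolding RS long_roots_def set_plus_three by blast
    have iso: "B x x = 0" if mem: "x \<in> (S1 + group_closure S2) + (S1 + group_closure S2)" for x
    proof -
      have "S1 + group_closure S2 \<subseteq> V0"
        unfolding V12(2) using lattice_subset group_closure_superset[of S1]
        by (intro set_plus_mono2) auto
      moreover obtain y z where "x = y + z" "y \<in> S1 + group_closure S2" "z \<in> S1 + group_closure S2"
        using mem by (rule set_plus_elim)
      ultimately have "x \<in> V0" using V0 subspace_add by blast
      then show ?thesis by (rule rad)
    qed
    show ?thesis
      unfolding nonisotropic_def assms(13) ears_B2_def Let_def Rsh Rlg
      using iso nonisotropic_roots by blast
  qed
  have minimal_iff: "minimal_ears B Vd R \<longleftrightarrow> \<not> (\<exists>\<alpha>\<in>short_roots \<union> long_roots. removable B Vd (short_roots \<union> long_roots) \<alpha>)"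
    unfolding minimal_ears_iff_no_removable Q ..
  have few: "minimal_ears B Vd R" if "ind S1 \<le> dim V1 + 3" "ind S2 \<le> dim V2 + 3"
  proof -
    obtain \<sigma> where \<sigma>: "int_basis_from S1 (dim V1) \<sigma>" "ind S1 + 1 = card (supp S1 (dim V1) \<sigma>)"
      by (rule ind_eq_card_supp[OF assms(11)])
    obtain \<tau> where \<tau>: "int_basis_from S2 (dim V2) \<tau>" "ind S2 + 1 = card (supp S2 (dim V2) \<tau>)"
      by (rule ind_eq_card_supp[OF assms(12)])
    show ?thesis
      unfolding minimal_iff
      using short_not_removable[OF \<sigma>(1)] long_not_removable[OF assms(12) \<tau>(1)] \<sigma>(2) \<tau>(2) that by auto
  qed
  have full: "\<not> minimal_ears B Vd R"
    if rank: "dim V1 \<le> 3" "dim V2 \<le> 3" and ind7: "ind S1 = 7 \<or> ind S2 = 7"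
    using ind7
  proof
    assume "ind S1 = 7"
    then obtain \<sigma> where \<sigma>: "int_basis_from S1 3 \<sigma>" "supp S1 3 \<sigma> = Pow {1..3}"
      using full_support_of_ind_7[OF assms(11) rank(1)] by blast
    then show ?thesis unfolding minimal_iff using short_removable[OF \<sigma>] by blast
  next
    assume "ind S2 = 7"
    then obtain \<sigma> where \<sigma>: "int_basis_from S2 3 \<sigma>" "supp S2 3 \<sigma> = Pow {1..3}"
      using full_support_of_ind_7[OF assms(12) rank(2)] by blast
    then show ?thesis unfolding minimal_iff using long_removable[OF assms(12) \<sigma>] by blast
  qed
  have low: "minimal_ears B Vd R" if "dim V1 \<le> 3" "dim V2 \<le> 3" "ind S1 \<noteq> 7" "ind S2 \<noteq> 7"
    using few ind_bound_rank_3[OF assms(11) that(1,3)] ind_bound_rank_3[OF assms(12) that(2,4)]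
    by blast
  have a: "ind S1 \<le> dim V1 + 3 \<and> ind S2 \<le> dim V2 + 3"
    if "int (ind S1) - int t \<le> 3 \<and> int (ind S2) - (int \<nu> - int t) \<le> 3"
    using that assms(7) unfolding assms(8,9) by linarith
  have b: "dim V1 \<le> 3 \<and> dim V2 \<le> 3" if "int \<nu> - int t \<le> 3" "int t \<le> 3"
    using that assms(7) unfolding assms(8,9) by linarith
  show ?thesis
    using few a b low full by blast
qed

end
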